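(* Let $F:M^n\to\mathbb R^{n+1}_1$ be a (co-orientable) $L$-complete null $C^r$-wave front. Then there exist an $(n-1)$-manifold $\Sigma^{n-1}$, a co-orientable $C^r$-wave front $f:\Sigma^{n-1}\to\mathbb R^n_0$ with unit normal vector field $\nu$, and a diffeomorphism $\Phi:M^n\to\mathbb R\times\Sigma^{n-1}$ such that $F\circ\Phi^{-1}=\mathcal F^f_+$, that is, $$F\circ\Phi^{-1}(t,x)=(0,f(x))+t\,(1,\nu(x))\qquad(t\in\mathbb R,\ x\in\Sigma^{n-1}).$$
   Context: Here $n\ge 2$, $r=\infty$ or $r=\omega$ ($C^\omega$ means real analytic), and $M^n$ is a $C^r$-differentiable $n$-manifold. $\mathbb R^{n+1}_1$ is $\mathbb R^{n+1}$ with coordinates $(t,x_1,\dots,x_n)$ and Lorentzian inner product $\langle v,w\rangle=-v_0w_0+\sum_{i=1}^n v_iw_i$; $(\,,\,)_E$ is the standard Euclidean inner product on the same space and $|v|_E=\sqrt{(v,v)_E}$. A non-zero vector $v$ is light-like if $\langle v,v\rangle=0$, and points in the future direction if $v_0>0$. $\mathbb R^n_0$ is Euclidean $n$-space, identified with $\{0\}\times\mathbb R^n\subset\mathbb R^{n+1}_1$. A $C^r$-map $F:M^n\to\mathbb R^{n+1}$ is a (co-orientable) $C^r$-wave front if there is a $C^r$-map $\tilde\alpha:M^n\to(\mathbb R^{n+1})^*\setminus\{0\}$ with $\tilde\alpha_p(dF_p(v))=0$ for all $p\in M^n$, $v\in T_pM^n$, such that $(F,\pi\circ\tilde\alpha):M^n\to\mathbb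 R^{n+1}\times P^*(\mathbb R^{n+1})$ is an immersion, where $\pi:(\mathbb R^{n+1})^*\setminus\{0\}\to P^*(\mathbb R^{n+1})$ is the projection onto the projective space of $(\mathbb R^{n+1})^*$. It is null if the vector field $\hat\xi$ along $F$ given by $\langle\hat\xi_p,x\rangle=\tilde\alpha_p(x)$ is light-like at every $p$. The $E$-normalized normal vector field $\hat\xi_E$ is the rescaling of $\hat\xi$ that points in the future direction and satisfies $|\hat\xi_E|_E=\sqrt2$. The $E$-normalized null vector field $\xi_E$ of $F$ is the unique $C^r$ vector field on $M^n$ with $dF(\xi_E)=\hat\xi_E$ whose integral curves are mapped by $F$ into light-like lines (it exists for every null wave front). $F$ is $L$-complete if for each $p\in M^n$ there is an integral curve $\gamma:\mathbb R\to M^n$ of $\xi_E$ passing through $p$ such that $F\circ\gamma(\mathbb R)$ is an entire light-like line in $\mathbb R^{n+1}_1$. A $C^r$-map $f:\Sigma^{n-1}\to\mathbb R^n_0$ from an $(n-1)$-manifold is a co-orientable wave front if there is a unit normal vector field $\nu$ along $f$ defined on $\Sigma^{n-1}$ such that $(f,\nu):\Sigma^{n-1}\to\mathbb R^n_0\times S^{n-1}$ is an immersion. The normal form associated with $f$ is $\mathcal F^f_+(t,x):=(0,f(x))+t(1,\nu(x))$ on $\mathbb R\times\Sigma^{n-1}$. *)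

theory Defs
  imports "HOL-Analysis.Analysis"
begin

section \<open>Functions of class \<open>C\<^sup>r\<close>, for r infinity or omega\<close>

datatype regularity = C_infinity | C_omega

text \<open>The derivative is taken in one fixed direction at a time, so that the codomain does not
  change in the recursion; in finite dimension this is the usual notion of class \<open>C\<^sup>k\<close>.\<close>

primrec Ck_on :: "nat \<Rightarrow> 'e::euclidean_space set \<Rightarrow> ('e \<Rightarrow> 'v::real_normed_vector) \<Rightarrow> bool" where
  "Ck_on 0 U f \<longleftrightarrow> continuous_on U f"
| "Ck_on (Suc k) U f \<longleftrightarrow>
     (\<forall>x\<in>U. f differentiable (at x)) \<and>
     (\<forall>v. Ck_on k U (\<lambda>x. frechet_derivative f (at x) v))"

text \<open>Multi-indices are the extensional functions from \<open>Basis\<close> to the natural numbers.\<close>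

definition real_analytic_on :: "'e::euclidean_space set \<Rightarrow> ('e \<Rightarrow> 'v::real_normed_vector) \<Rightarrow> bool" where
  "real_analytic_on U f \<longleftrightarrow>
     (\<forall>a\<in>U. \<exists>\<rho>>0. \<exists>coef :: ('e \<Rightarrow> nat) \<Rightarrow> 'v. ball a \<rho> \<subseteq> U \<and>
        (\<forall>x\<in>ball a \<rho>.
           ((\<lambda>k. (\<Prod>b\<in>Basis. ((x - a) \<bullet> b) ^ k b) *\<^sub>R coef k) has_sum f x)
             (Basis \<rightarrow>\<^sub>E UNIV)))"

fun Cr_on :: "regularity \<Rightarrow> 'e::euclidean_space set \<Rightarrow> ('e \<Rightarrow> 'v::real_normed_vector) \<Rightarrow> bool" where
  "Cr_on C_infinity U f \<longleftrightarrow> (\<forall>k. Ck_on k U f)"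
| "Cr_on C_omega U f \<longleftrightarrow> real_analytic_on U f"


section \<open>Manifolds\<close>

text \<open>A chart is a pair of its domain and its coordinate map, whose values outside the domain are
  irrelevant. The dimension of a manifold is that of the model space \<open>'e\<close>. Likewise a map between
  manifolds is a total function of which only the values on the carrier \<open>topspace (mtop M)\<close>
  matter.\<close>

type_synonym ('a, 'e) chart = "'a set \<times> ('a \<Rightarrow> 'e)"

record ('a, 'e) mfd =
  mtop :: "'a topology"
  atlas :: "('a, 'e) chart set"

abbreviation carrier_of :: "('a, 'e) mfd \<Rightarrow> 'a set" where
  "carrier_of M \<equiv> topspace (mtop M)"

definition chart_inv :: "('a, 'e) chart \<Rightarrow> 'e \<Rightarrow> 'a" where
  "chart_inv c = inv_into (fst c) (snd c)"

definition charts_at :: "('a, 'e) mfd \<Rightarrow> 'a \<Rightarrow> ('a, 'e) chart set" where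
  "charts_at M p = {c \<in> atlas M. p \<in> fst c}"

definition Cr_manifold :: "regularity \<Rightarrow> ('a, 'e::euclidean_space) mfd \<Rightarrow> bool" where
  "Cr_manifold r M \<longleftrightarrow>
     Hausdorff_space (mtop M) \<and> second_countable (mtop M) \<and>
     (\<forall>(U, \<phi>)\<in>atlas M. openin (mtop M) U \<and> open (\<phi> ` U) \<and>
        homeomorphic_map (subtopology (mtop M) U) (top_of_set (\<phi> ` U)) \<phi>) \<and>
     (\<Union>c\<in>atlas M. fst c) = carrier_of M \<and>
     (\<forall>c\<in>atlas M. \<forall>d\<in>atlas M. Cr_on r (snd c ` (fst c \<inter> fst d)) (snd d \<circ> chart_inv c))"

definition Cr_map ::
  "regularity \<Rightarrow> ('a, 'e::euclidean_space) mfd \<Rightarrow> ('b, 'f::euclidean_space) mfd \<Rightarrow> ('a \<Rightarrow> 'b) \<Rightarrow> bool" where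
  "Cr_map r M N F \<longleftrightarrow>
     continuous_map (mtop M) (mtop N) F \<and>
     (\<forall>c\<in>atlas M. \<forall>d\<in>atlas N.
        Cr_on r (snd c ` (fst c \<inter> F -` fst d)) (snd d \<circ> F \<circ> chart_inv c))"

definition Cr_diffeomorphism ::
  "regularity \<Rightarrow> ('a, 'e::euclidean_space) mfd \<Rightarrow> ('b, 'f::euclidean_space) mfd \<Rightarrow> ('a \<Rightarrow> 'b) \<Rightarrow> bool" where
  "Cr_diffeomorphism r M N \<Phi> \<longleftrightarrow>
     bij_betw \<Phi> (carrier_of M) (carrier_of N) \<and>
     Cr_map r M N \<Phi> \<and> Cr_map r N M (inv_into (carrier_of M) \<Phi>)"

text \<open>\<open>C\<^sup>r\<close> maps into a normed vector space; unlike \<open>Cr_map\<close> this covers the dual space, whose type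
  is not in class \<open>euclidean_space\<close>.\<close>

definition Cr_vec_map ::
  "regularity \<Rightarrow> ('a, 'e::euclidean_space) mfd \<Rightarrow> ('a \<Rightarrow> 'v::real_normed_vector) \<Rightarrow> bool" where
  "Cr_vec_map r M F \<longleftrightarrow> (\<forall>c\<in>atlas M. Cr_on r (snd c ` fst c) (F \<circ> chart_inv c))"

definition euclidean_mfd :: "('e::euclidean_space, 'e) mfd" where
  "euclidean_mfd = \<lparr>mtop = euclidean, atlas = {(UNIV, id)}\<rparr>"

definition prod_mfd :: "('a, 'e) mfd \<Rightarrow> ('b, 'f) mfd \<Rightarrow> ('a \<times> 'b, 'e \<times> 'f) mfd" where
  "prod_mfd M N =
     \<lparr>mtop = prod_topology (mtop M) (mtop N),
      atlas = {(fst c \<times> fst d, map_prod (snd c) (snd d)) | c d. c \<in> atlas M \<and> d \<in> atlas N}\<rparr>"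

text \<open>A tangent vector at p assigns to every chart around p a coordinate vector, subject to the
  usual transformation law (and the value 0 at all other charts, so that equality of tangent
  vectors is equality of functions).\<close>

definition tangent_space ::
  "('a, 'e::euclidean_space) mfd \<Rightarrow> 'a \<Rightarrow> (('a, 'e) chart \<Rightarrow> 'e) set" where
  "tangent_space M p =
     {v. (\<forall>c\<in>charts_at M p. \<forall>d\<in>charts_at M p.
            v d = frechet_derivative (snd d \<circ> chart_inv c) (at (snd c p)) (v c)) \<and>
         (\<forall>c. c \<notin> charts_at M p \<longrightarrow> v c = 0)}"

text \<open>By the chain rule the next two notions do not depend on the chosen chart.\<close>

definition chart_around :: "('a, 'e) mfd \<Rightarrow> 'a \<Rightarrow> ('a, 'e) chart" where
  "chart_around M p = (SOME c. c \<in> charts_at M p)"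

definition differential ::
  "('a, 'e::euclidean_space) mfd \<Rightarrow> ('b, 'f::euclidean_space) mfd \<Rightarrow> ('a \<Rightarrow> 'b) \<Rightarrow> 'a \<Rightarrow>
     (('a, 'e) chart \<Rightarrow> 'e) \<Rightarrow> (('b, 'f) chart \<Rightarrow> 'f)" where
  "differential M N F p v =
     (\<lambda>d. if d \<in> charts_at N (F p)
          then let c = chart_around M p
               in frechet_derivative (snd d \<circ> F \<circ> chart_inv c) (at (snd c p)) (v c)
          else 0)"

text \<open>The differential of a vector-valued map, with the tangent spaces of the target identified
  with the target.\<close>

definition vec_differential ::
  "('a, 'e::euclidean_space) mfd \<Rightarrow> ('a \<Rightarrow> 'v::real_normed_vector) \<Rightarrow> 'a \<Rightarrow>
     (('a, 'e) chart \<Rightarrow> 'e) \<Rightarrow> 'v" where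
  "vec_differential M F p v =
     (let c = chart_around M p in frechet_derivative (F \<circ> chart_inv c) (at (snd c p)) (v c))"

definition Cr_immersion ::
  "regularity \<Rightarrow> ('a, 'e::euclidean_space) mfd \<Rightarrow> ('b, 'f::euclidean_space) mfd \<Rightarrow> ('a \<Rightarrow> 'b) \<Rightarrow> bool" where
  "Cr_immersion r M N F \<longleftrightarrow>
     Cr_map r M N F \<and>
     (\<forall>p\<in>carrier_of M. inj_on (differential M N F p) (tangent_space M p))"

definition Cr_vector_field ::
  "regularity \<Rightarrow> ('a, 'e::euclidean_space) mfd \<Rightarrow> ('a \<Rightarrow> ('a, 'e) chart \<Rightarrow> 'e) \<Rightarrow> bool" where
  "Cr_vector_field r M \<xi> \<longleftrightarrow>
     (\<forall>p\<in>carrier_of M. \<xi> p \<in> tangent_space M p) \<and>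
     (\<forall>c\<in>atlas M. Cr_on r (snd c ` fst c) (\<lambda>x. \<xi> (chart_inv c x) c))"

definition integral_curve ::
  "('a, 'e::euclidean_space) mfd \<Rightarrow> ('a \<Rightarrow> ('a, 'e) chart \<Rightarrow> 'e) \<Rightarrow> real set \<Rightarrow> (real \<Rightarrow> 'a) \<Rightarrow> bool" where
  "integral_curve M \<xi> I \<gamma> \<longleftrightarrow>
     open I \<and> is_interval I \<and> I \<noteq> {} \<and>
     continuous_map (top_of_set I) (mtop M) \<gamma> \<and>
     (\<forall>t\<in>I. \<forall>c\<in>charts_at M (\<gamma> t). ((snd c \<circ> \<gamma>) has_vector_derivative \<xi> (\<gamma> t) c) (at t))"


section \<open>The sphere and the projective space of the dual space\<close>

text \<open>The charts of the unit sphere are the orthogonal projections of the open hemisphere centred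
  at u along u, the hyperplane orthogonal to u being identified isometrically with the model space.
  This is meant for \<open>CARD('m) = CARD('n) - 1\<close>; the image of such a chart is then the open unit
  ball.\<close>

definition sphere_mfd :: "(real ^ 'n, real ^ 'm) mfd" where
  "sphere_mfd =
     \<lparr>mtop = top_of_set (sphere 0 1),
      atlas = {({x \<in> sphere 0 1. 0 < x \<bullet> u}, P) | u P.
                 norm u = 1 \<and> linear P \<and> P u = 0 \<and> (\<forall>x. x \<bullet> u = 0 \<longrightarrow> norm (P x) = norm x)}\<rparr>"

text \<open>In \<open>real \<times> (real ^ 'n)\<close> the first factor is the time coordinate t.\<close>

type_synonym 'n spacetime = "real \<times> (real ^ 'n)"
type_synonym 'n codual = "'n spacetime \<Rightarrow>\<^sub>L real"

text \<open>Points of the projective space are the one-dimensional subspaces of the dual space; it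
  carries the quotient topology of the projection \<open>\<pi>\<close>. For a standard basis vector e and an
  enumeration b of the other ones, the affine chart maps the class of a to the quotients of a
  on b by a on e.\<close>

definition proj_class :: "'n::finite codual \<Rightarrow> 'n codual set" where
  "proj_class a = span {a}"

definition proj_space_topology :: "'n::finite codual set topology" where
  "proj_space_topology =
     topology (\<lambda>S. S \<subseteq> proj_class ` (- {0}) \<and> open {a. a \<noteq> 0 \<and> proj_class a \<in> S})"

definition proj_chart :: "'n::finite spacetime \<Rightarrow> ('n \<Rightarrow> 'n spacetime) \<Rightarrow> ('n codual set, real ^ 'n) chart" where
  "proj_chart e b =
     ({proj_class a | a. blinfun_apply a e \<noteq> 0},
      \<lambda>L. let a = (SOME a. a \<in> L \<and> a \<noteq> 0) in \<chi> j. blinfun_apply a (b j) / blinfun_apply a e)"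

definition proj_mfd :: "('n::finite codual set, real ^ 'n) mfd" where
  "proj_mfd =
     \<lparr>mtop = proj_space_topology,
      atlas = {proj_chart e b | e b. e \<in> Basis \<and> bij_betw b UNIV (Basis - {e})}\<rparr>"


lemma openin_proj_space_topology:
  "openin proj_space_topology S \<longleftrightarrow>
     S \<subseteq> proj_class ` (- {0}) \<and> open {a. a \<noteq> 0 \<and> proj_class a \<in> S}"
proof -
  define pre :: "'a codual set set \<Rightarrow> 'a codual set"
    where "pre S = {a. a \<noteq> 0 \<and> proj_class a \<in> S}" for S
  have pre_Int: "pre (S \<inter> T) = pre S \<inter> pre T" for S T
    unfolding pre_def by blast
  have pre_Union: "pre (\<Union>\<K>) = (\<Union>S\<in>\<K>. pre S)" for \<K>
    unfolding pre_def by blast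
  have "istopology (\<lambda>S. S \<subseteq> proj_class ` (- {0}) \<and> open (pre S))"
    unfolding istopology_def pre_Int pre_Union
    by (intro conjI allI impI open_Int open_UN) blast+
  then show ?thesis
    unfolding proj_space_topology_def pre_def by (simp only: topology_inverse')
qed

text \<open>The atlases of both model manifolds cover them.\<close>

lemma sphere_charts_cover:
  assumes "CARD('m::finite) = CARD('n::finite) - 1" and "norm (u :: real ^ 'n) = 1"
  shows "charts_at (sphere_mfd :: (real ^ 'n, real ^ 'm) mfd) u \<noteq> {}"
proof -
  let ?H = "{x. u \<bullet> x = 0}"
  have u0: "u \<noteq> 0" using assms(2) by auto
  have "dim ?H = dim (UNIV :: (real ^ 'm) set)"
    using dim_hyperplane[OF u0] assms(1) by simp
  then obtain f :: "real ^ 'n \<Rightarrow> real ^ 'm" where f: "linear f" "\<And>x. x \<in> ?H \<Longrightarrow> norm (f x) = norm x"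
    using isometries_subspaces[OF subspace_hyperplane[of u] subspace_UNIV] by metis
  define P where "P x = f (x - (x \<bullet> u) *\<^sub>R u)" for x
  have "linear P" unfolding P_def
    by (rule linearI) (simp_all add: linear_diff[OF f(1)] linear_add[OF f(1)] linear_scale[OF f(1)] inner_add_left algebra_simps)
  moreover have "P u = 0" using assms(2) by (simp add: P_def dot_square_norm linear_0[OF f(1)])
  moreover have "norm (P x) = norm x" if "x \<bullet> u = 0" for x
    using f(2)[of x] that by (simp add: P_def inner_commute)
  ultimately have "({x \<in> sphere 0 1. 0 < x \<bullet> u}, P) \<in> charts_at (sphere_mfd :: (real ^ 'n, real ^ 'm) mfd) u"
    using assms(2) by (auto simp: charts_at_def sphere_mfd_def dot_square_norm)
  then show ?thesis by blast
qed

lemma proj_charts_cover: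
  assumes "(a :: 'n::finite codual) \<noteq> 0"
  shows "charts_at proj_mfd (proj_class a) \<noteq> {}"
proof -
  have "\<exists>e\<in>Basis. blinfun_apply a e \<noteq> 0"
  proof (rule ccontr)
    assume "\<not> (\<exists>e\<in>Basis. blinfun_apply a e \<noteq> 0)"
    then have "a = 0" by (intro blinfun_euclidean_eqI) simp
    with assms show False ..
  qed
  then obtain e :: "'n spacetime" where e: "e \<in> Basis" "blinfun_apply a e \<noteq> 0" ..
  have "card (UNIV :: 'n set) = card (Basis - {e})" using e(1) by simp
  then have "\<exists>b. bij_betw b (UNIV :: 'n set) (Basis - {e})"
    by (intro finite_same_card_bij) simp_all
  then obtain b :: "'n \<Rightarrow> 'n spacetime" where b: "bij_betw b UNIV (Basis - {e})" ..
  have "proj_class a \<in> fst (proj_chart e b)"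
    unfolding proj_chart_def fst_conv using e(2) by blast
  moreover have "proj_chart e b \<in> atlas proj_mfd"
    unfolding proj_mfd_def mfd.simps using e(1) b by blast
  ultimately have "proj_chart e b \<in> charts_at proj_mfd (proj_class a)"
    unfolding charts_at_def by (intro CollectI conjI)
  then show ?thesis by (metis empty_iff)
qed


section \<open>Null wave fronts\<close>

definition lorentz :: "'n::finite spacetime \<Rightarrow> 'n spacetime \<Rightarrow> real" where
  "lorentz v w = - (fst v * fst w) + snd v \<bullet> snd w"

definition lightlike :: "'n::finite spacetime \<Rightarrow> bool" where
  "lightlike v \<longleftrightarrow> v \<noteq> 0 \<and> lorentz v v = 0"

definition future_directed :: "'n::finite spacetime \<Rightarrow> bool" where
  "future_directed v \<longleftrightarrow> fst v > 0"

definition lightlike_line :: "'n::finite spacetime set \<Rightarrow> bool" where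
  "lightlike_line L \<longleftrightarrow> (\<exists>q v. lightlike v \<and> L = range (\<lambda>s. q + s *\<^sub>R v))"

definition wave_front ::
  "regularity \<Rightarrow> ('a, real ^ 'n) mfd \<Rightarrow> ('a \<Rightarrow> 'n::finite spacetime) \<Rightarrow> ('a \<Rightarrow> 'n codual) \<Rightarrow> bool" where
  "wave_front r M F \<alpha> \<longleftrightarrow>
     Cr_vec_map r M F \<and> Cr_vec_map r M \<alpha> \<and>
     (\<forall>p\<in>carrier_of M. \<alpha> p \<noteq> 0) \<and>
     (\<forall>p\<in>carrier_of M. \<forall>v\<in>tangent_space M p.
        blinfun_apply (\<alpha> p) (vec_differential M F p v) = 0) \<and>
     Cr_immersion r M (prod_mfd euclidean_mfd proj_mfd) (\<lambda>p. (F p, proj_class (\<alpha> p)))"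

definition lorentz_dual :: "'n::finite codual \<Rightarrow> 'n spacetime" where
  "lorentz_dual a = (THE w. \<forall>x. lorentz w x = blinfun_apply a x)"

definition null_wave_front ::
  "regularity \<Rightarrow> ('a, real ^ 'n) mfd \<Rightarrow> ('a \<Rightarrow> 'n::finite spacetime) \<Rightarrow> ('a \<Rightarrow> 'n codual) \<Rightarrow> bool" where
  "null_wave_front r M F \<alpha> \<longleftrightarrow>
     wave_front r M F \<alpha> \<and> (\<forall>p\<in>carrier_of M. lightlike (lorentz_dual (\<alpha> p)))"

text \<open>The norm of the product type is the Euclidean norm.\<close>

definition E_normalized :: "'n::finite spacetime \<Rightarrow> 'n spacetime" where
  "E_normalized v = (THE w. (\<exists>k. w = k *\<^sub>R v) \<and> future_directed w \<and> norm w = sqrt 2)"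

definition E_normalized_null_field ::
  "regularity \<Rightarrow> ('a, real ^ 'n) mfd \<Rightarrow> ('a \<Rightarrow> 'n::finite spacetime) \<Rightarrow> ('a \<Rightarrow> 'n codual) \<Rightarrow>
     ('a \<Rightarrow> ('a, real ^ 'n) chart \<Rightarrow> real ^ 'n) \<Rightarrow> bool" where
  "E_normalized_null_field r M F \<alpha> \<xi> \<longleftrightarrow>
     Cr_vector_field r M \<xi> \<and>
     (\<forall>p\<in>carrier_of M. vec_differential M F p (\<xi> p) = E_normalized (lorentz_dual (\<alpha> p))) \<and>
     (\<forall>I \<gamma>. integral_curve M \<xi> I \<gamma> \<longrightarrow> (\<exists>L. lightlike_line L \<and> (F \<circ> \<gamma>) ` I \<subseteq> L))"

text \<open>For a null wave front the E-normalized null vector field exists and is unique, so the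
  existential quantifier merely names it.\<close>

definition L_complete ::
  "regularity \<Rightarrow> ('a, real ^ 'n) mfd \<Rightarrow> ('a \<Rightarrow> 'n::finite spacetime) \<Rightarrow> ('a \<Rightarrow> 'n codual) \<Rightarrow> bool" where
  "L_complete r M F \<alpha> \<longleftrightarrow>
     (\<exists>\<xi>. E_normalized_null_field r M F \<alpha> \<xi> \<and>
        (\<forall>p\<in>carrier_of M. \<exists>\<gamma>. integral_curve M \<xi> UNIV \<gamma> \<and> p \<in> range \<gamma> \<and>
           lightlike_line (range (F \<circ> \<gamma>))))"


section \<open>Wave fronts in Euclidean space\<close>

definition euclidean_wave_front ::
  "regularity \<Rightarrow> ('a, real ^ 'm) mfd \<Rightarrow> ('a \<Rightarrow> real ^ 'n) \<Rightarrow> ('a \<Rightarrow> real ^ 'n) \<Rightarrow> bool" where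
  "euclidean_wave_front r S f \<nu> \<longleftrightarrow>
     Cr_vec_map r S f \<and>
     (\<forall>x\<in>carrier_of S. norm (\<nu> x) = 1) \<and>
     (\<forall>x\<in>carrier_of S. \<forall>v\<in>tangent_space S x. \<nu> x \<bullet> vec_differential S f x v = 0) \<and>
     Cr_immersion r S
       (prod_mfd euclidean_mfd (sphere_mfd :: (real ^ 'n, real ^ 'm) mfd)) (\<lambda>x. (f x, \<nu> x))"

definition normal_form :: "('a \<Rightarrow> real ^ 'n) \<Rightarrow> ('a \<Rightarrow> real ^ 'n) \<Rightarrow> real \<times> 'a \<Rightarrow> 'n::finite spacetime" where
  "normal_form f \<nu> = (\<lambda>(t, x). (0, f x) + t *\<^sub>R (1, \<nu> x))"

end

theory Submission
  imports Defs "HOL-Complex_Analysis.Complex_Analysis"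
begin

text \<open>
  Along an integral curve of \<open>\<xi>\<^sub>E\<close> the time coordinate \<open>\<tau>\<close> of \<open>F\<close> grows with unit speed, while the light ray
  on which \<open>F\<close> moves, recorded by its position at time 0 and its direction, stays constant. By
  the immersion property, \<open>\<tau>\<close> together with finitely many linear functions of the ray is a local
  coordinate system at every point. In such coordinates the flow of \<open>\<xi>\<^sub>E\<close> only changes \<open>\<tau>\<close>; so
  uniqueness of integral curves and \<open>C\<^sup>r\<close> dependence on the initial point come from the inverse
  function theorem and need no theory of differential equations. Completeness makes the flow
  global, and \<open>p \<mapsto> (\<tau> p, point of the curve through p at time 0)\<close> is a diffeomorphism onto
  \<open>\<real> \<times> {\<tau> = 0}\<close>; functions of the ray are the charts of the slice \<open>{\<tau> = 0}\<close>.

  For \<open>r = \<omega>\<close> the calculus of real analytic functions is reduced to that of complex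
  differentiable functions of class \<open>C\<^sup>1\<close>: a function is real analytic iff locally it has a
  holomorphic extension to the complexified space.
\<close>

section \<open>Calculus of functions of class \<open>C\<^sup>k\<close>\<close>

text \<open>Completeness is given only pointwise: through each point runs some integral curve whose
  image is an entire light-like line. On it \<open>F\<close> has velocity (1, direction) and stays
  on a straight line, so the direction is constant, and with it the position at time 0; this is why
  the ray is constant. The immersion property yields coordinates because \<alpha> at p is, up to a
  nonzero factor, the covector sending x to \<open>dir p \<bullet> snd x - fst x\<close>: its
  projective class carries no more information than the direction, and \<open>F\<close> is a
  function of time, base point and direction. A vector killed by the differentials of time and ray
  is therefore killed by the differential of the whole lift of \<open>F\<close>. Exactly n - 1
  linear functions of the ray are taken: its differential has rank at most n - 1, since it vanishes
  on \<xi>. For the analytic case, asking the holomorphic extensions to be of class C^1 lets one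
  inverse function theorem serve both regularities; the way back to power series in several
  variables is an Osgood-type argument, one variable at a time.\<close>

lemma has_derivative_frechet:
  "f differentiable (at x) \<Longrightarrow> (f has_derivative frechet_derivative f (at x)) (at x)"
  by (rule iffD1[OF frechet_derivative_works])

lemma frechet_derivativeI: "(f has_derivative D) (at x) \<Longrightarrow> frechet_derivative f (at x) = D"
  by (rule frechet_derivative_at[symmetric])

lemma Ck_on_cong:
  assumes "open U" "\<And>x. x \<in> U \<Longrightarrow> f x = g x" "Ck_on k U f"
  shows "Ck_on k U g"
  using assms(2,3)
proof (induction k arbitrary: f g)
  case 0
  then show ?case using continuous_on_cong[of U U f g] by simp
next
  case (Suc k)
  have D: "(g has_derivative frechet_derivative f (at x)) (at x)" if "x \<in> U" for x
    by (rule has_derivative_transform_within_open[OF has_derivative_frechet assms(1) that])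
      (use Suc.prems that in \<open>simp_all del: Ck_on.simps(2) add: Ck_on.simps(2)[of k U f]\<close>)
  have "Ck_on k U (\<lambda>x. frechet_derivative g (at x) v)" for v
    by (rule Suc.IH[of "\<lambda>x. frechet_derivative f (at x) v"])
      (use Suc.prems(2) in \<open>simp_all add: frechet_derivativeI[OF D]\<close>)
  moreover have "g differentiable (at x)" if "x \<in> U" for x
    using D[OF that] unfolding differentiable_def by blast
  ultimately show ?case by simp
qed

lemma Ck_on_subset: "Ck_on k U f \<Longrightarrow> V \<subseteq> U \<Longrightarrow> Ck_on k V f"
  by (induction k arbitrary: f) (auto intro: continuous_on_subset)

lemma Ck_on_imp_continuous: "Ck_on k U f \<Longrightarrow> continuous_on U f"
  by (cases k) (simp_all add: continuous_at_imp_continuous_on differentiable_imp_continuous_within)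

lemma Ck_on_SucD: "Ck_on (Suc k) U f \<Longrightarrow> Ck_on k U f"
proof (induction k arbitrary: f)
  case 0
  then show ?case using Ck_on_imp_continuous[of "Suc 0" U f] by simp
next
  case (Suc k)
  from Suc.prems have "Ck_on k U (\<lambda>x. frechet_derivative f (at x) v)" for v
    by (intro Suc.IH) (simp only: Ck_on.simps(2)[of "Suc k" U f])
  with Suc.prems show ?case by simp
qed

lemma Ck_on_local:
  assumes "\<And>x. x \<in> U \<Longrightarrow> \<exists>V. open V \<and> x \<in> V \<and> Ck_on k V f"
  shows "Ck_on k U f"
  using assms
proof (induction k arbitrary: f)
  case 0
  have "isCont f x" if "x \<in> U" for x
    using 0[OF that] by (auto simp: continuous_on_eq_continuous_at)
  then show ?case by (simp add: continuous_at_imp_continuous_on)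
next
  case (Suc k)
  then have "f differentiable (at x)" if "x \<in> U" for x
    using that unfolding Ck_on.simps(2) by blast
  moreover have "Ck_on k U (\<lambda>x. frechet_derivative f (at x) v)" for v
    using Suc.prems unfolding Ck_on.simps(2) by (intro Suc.IH) blast
  ultimately show ?case by simp
qed

text \<open>Lets the derivative be given by an explicit formula, so that the rules below can be
  proved by induction on the order without computing \<open>frechet_derivative\<close>.\<close>

lemma Ck_on_SucI:
  assumes "open U" "\<And>x. x \<in> U \<Longrightarrow> (f has_derivative f' x) (at x)"
    and "\<And>v. Ck_on k U (\<lambda>x. f' x v)"
  shows "Ck_on (Suc k) U f"
proof -
  have "Ck_on k U (\<lambda>x. frechet_derivative f (at x) v)" for v
    by (rule Ck_on_cong[OF assms(1) _ assms(3)[of v]]) (simp add: frechet_derivativeI[OF assms(2)])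
  moreover have "f differentiable (at x)" if "x \<in> U" for x
    using assms(2)[OF that] unfolding differentiable_def by blast
  ultimately show ?thesis by simp
qed

lemma Ck_on_has_derivative:
  "Ck_on (Suc k) U f \<Longrightarrow> x \<in> U \<Longrightarrow> (f has_derivative frechet_derivative f (at x)) (at x)"
  by (simp add: has_derivative_frechet)

lemma Ck_on_const: "open U \<Longrightarrow> Ck_on k U (\<lambda>x. c)"
proof (induction k arbitrary: c)
  case (Suc k)
  then show ?case by (intro Ck_on_SucI[of _ _ "\<lambda>_ _. 0"]) auto
qed simp

lemma Ck_on_bounded_linear:
  assumes "open U" "bounded_linear L" "Ck_on k U f"
  shows "Ck_on k U (\<lambda>x. L (f x))"
  using assms(3)
proof (induction k arbitrary: f)
  case 0
  then show ?case using bounded_linear.continuous_on[OF assms(2)] by simp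
next
  case (Suc k)
  show ?case
  proof (rule Ck_on_SucI[OF assms(1)])
    show "((\<lambda>x. L (f x)) has_derivative (\<lambda>v. L (frechet_derivative f (at x) v))) (at x)"
      if "x \<in> U" for x
      by (intro bounded_linear.has_derivative[OF assms(2)] Ck_on_has_derivative[OF Suc.prems] that)
    show "Ck_on k U (\<lambda>x. L (frechet_derivative f (at x) v))" for v
      using Suc by simp
  qed
qed

lemma Ck_on_add:
  assumes "open U" "Ck_on k U f" "Ck_on k U g"
  shows "Ck_on k U (\<lambda>x. f x + g x)"
  using assms(2,3)
proof (induction k arbitrary: f g)
  case 0
  then show ?case by (auto intro: continuous_on_add)
next
  case (Suc k)
  show ?case
  proof (rule Ck_on_SucI[OF assms(1)])
    show "((\<lambda>x. f x + g x) has_derivative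
        (\<lambda>v. frechet_derivative f (at x) v + frechet_derivative g (at x) v)) (at x)" if "x \<in> U" for x
      by (intro has_derivative_add Ck_on_has_derivative[OF Suc.prems(1)]
        Ck_on_has_derivative[OF Suc.prems(2)] that)
    show "Ck_on k U (\<lambda>x. frechet_derivative f (at x) v + frechet_derivative g (at x) v)" for v
      using Suc.prems by (intro Suc.IH) simp_all
  qed
qed

lemma Ck_on_sum:
  assumes "open U" "\<And>i. i \<in> I \<Longrightarrow> Ck_on k U (f i)"
  shows "Ck_on k U (\<lambda>x. \<Sum>i\<in>I. f i x)"
  using assms(2)
  by (induction I rule: infinite_finite_induct) (auto intro: Ck_on_add Ck_on_const assms(1))

lemma Ck_on_scaleR:
  fixes s :: "_ \<Rightarrow> real"
  assumes "open U" "Ck_on k U s" "Ck_on k U f"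
  shows "Ck_on k U (\<lambda>x. s x *\<^sub>R f x)"
  using assms(2,3)
proof (induction k arbitrary: s f)
  case 0
  then show ?case by (auto intro: continuous_on_scaleR)
next
  case (Suc k)
  show ?case
  proof (rule Ck_on_SucI[OF assms(1)])
    show "((\<lambda>x. s x *\<^sub>R f x) has_derivative (\<lambda>v. s x *\<^sub>R frechet_derivative f (at x) v
        + frechet_derivative s (at x) v *\<^sub>R f x)) (at x)" if "x \<in> U" for x
      by (intro has_derivative_scaleR Ck_on_has_derivative[OF Suc.prems(1)]
          Ck_on_has_derivative[OF Suc.prems(2)] that)
    show "Ck_on k U (\<lambda>x. s x *\<^sub>R frechet_derivative f (at x) v
        + frechet_derivative s (at x) v *\<^sub>R f x)" for v
      by (intro Ck_on_add assms(1) Suc.IH Suc.prems[THEN Ck_on_SucD])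
        (use Suc.prems in simp_all)
  qed
qed

lemma Ck_on_ident: "open U \<Longrightarrow> Ck_on k U (\<lambda>x. x)"
proof (cases k)
  case (Suc j)
  then show "open U \<Longrightarrow> ?thesis"
    using Ck_on_SucI[of U "\<lambda>x. x" "\<lambda>_ v. v" j] Ck_on_const by auto
qed simp

lemma Ck_on_componentwise:
  fixes f :: "_ \<Rightarrow> 'f::euclidean_space"
  assumes "open U" "\<And>b. b \<in> Basis \<Longrightarrow> Ck_on k U (\<lambda>x. f x \<bullet> b)"
  shows "Ck_on k U f"
proof -
  have "Ck_on k U (\<lambda>x. \<Sum>b\<in>Basis. (f x \<bullet> b) *\<^sub>R b)"
    by (intro Ck_on_sum Ck_on_scaleR assms Ck_on_const)
  then show ?thesis by (simp add: euclidean_representation)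
qed

lemma linear_expand:
  fixes L :: "'e::euclidean_space \<Rightarrow> 'v::real_vector"
  assumes "linear L"
  shows "L w = (\<Sum>b\<in>Basis. (w \<bullet> b) *\<^sub>R L b)"
proof -
  have "L w = L (\<Sum>b\<in>Basis. (w \<bullet> b) *\<^sub>R b)" by (simp add: euclidean_representation)
  then show ?thesis by (simp only: linear_sum[OF assms] linear_scale[OF assms])
qed

lemma Ck_on_compose:
  fixes g :: "'e::euclidean_space \<Rightarrow> 'g::euclidean_space" and f :: "'g \<Rightarrow> 'v::real_normed_vector"
  assumes "open U" "open V" "Ck_on k V f" "Ck_on k U g" "g ` U \<subseteq> V"
  shows "Ck_on k U (\<lambda>x. f (g x))"
  using assms(3,4)
proof (induction k arbitrary: f)
  case 0
  then show ?case using continuous_on_compose2[of V f U g] assms(5) by simp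
next
  case (Suc k)
  let ?Df = "\<lambda>x. frechet_derivative f (at x)" and ?Dg = "\<lambda>x. frechet_derivative g (at x)"
  show ?case
  proof (rule Ck_on_SucI[OF assms(1)])
    fix x assume x: "x \<in> U"
    have f: "(f has_derivative ?Df (g x)) (at (g x))"
      using Ck_on_has_derivative[OF Suc.prems(1)] assms(5) x by blast
    have "((\<lambda>x. f (g x)) has_derivative (\<lambda>v. ?Df (g x) (?Dg x v))) (at x)"
      using diff_chain_at[OF Ck_on_has_derivative[OF Suc.prems(2) x] f] by (simp add: o_def)
    \<comment> \<open>\<open>Ck_on\<close> controls the derivative of f in fixed directions only,
      while \<open>?Dg x v\<close> moves with x. Expansion in the basis leaves the fixed directions
      b, with scalar coefficients that depend on x.\<close>
    moreover have "(\<lambda>v. ?Df (g x) (?Dg x v)) = (\<lambda>v. \<Sum>b\<in>Basis. (?Dg x v \<bullet> b) *\<^sub>R ?Df (g x) b)"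
      by (rule ext, rule linear_expand[OF bounded_linear.linear[OF has_derivative_bounded_linear[OF f]]])
    ultimately show "((\<lambda>x. f (g x)) has_derivative (\<lambda>v. \<Sum>b\<in>Basis. (?Dg x v \<bullet> b) *\<^sub>R ?Df (g x) b)) (at x)"
      by (simp only:)
  next
    fix v
    have "Ck_on k U (\<lambda>x. ?Dg x v \<bullet> b)" for b
      by (rule Ck_on_bounded_linear[OF assms(1) bounded_linear_inner_left]) (use Suc.prems(2) in simp)
    moreover have "Ck_on k U (\<lambda>x. ?Df (g x) b)" for b
      by (rule Suc.IH[of "\<lambda>y. ?Df y b", OF _ Ck_on_SucD[OF Suc.prems(2)]]) (use Suc.prems(1) in simp)
    ultimately show "Ck_on k U (\<lambda>x. \<Sum>b\<in>Basis. (?Dg x v \<bullet> b) *\<^sub>R ?Df (g x) b)"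
      by (intro Ck_on_sum Ck_on_scaleR assms(1))
  qed
qed

lemma Ck_on_inverse: "Ck_on k (- {0}) (inverse :: real \<Rightarrow> real)"
proof (induction k)
  case 0
  show ?case by (auto intro!: continuous_intros)
next
  case (Suc k)
  show ?case
  proof (rule Ck_on_SucI)
    show "(inverse has_derivative (\<lambda>v. - (inverse x * v * inverse x))) (at x)" if "x \<in> - {0}" for x :: real
      using that by (intro has_derivative_inverse') simp
    have "Ck_on k (- {0}) (\<lambda>x::real. (- v) *\<^sub>R (inverse x *\<^sub>R inverse x))" for v :: real
      by (intro Ck_on_scaleR Ck_on_const Suc.IH) auto
    then show "Ck_on k (- {0}) (\<lambda>x::real. - (inverse x * v * inverse x))" for v :: real
      by (simp add: mult_ac)
  qed auto
qed

lemma Ck_on_Pair: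
  fixes f :: "_ \<Rightarrow> 'f::euclidean_space" and g :: "_ \<Rightarrow> 'g::euclidean_space"
  assumes "open U" "Ck_on k U f" "Ck_on k U g"
  shows "Ck_on k U (\<lambda>x. (f x, g x))"
proof -
  have "bounded_linear (\<lambda>x. (x::'f, 0::'g))" "bounded_linear (\<lambda>x. (0::'f, x::'g))"
    by (intro bounded_linear_Pair bounded_linear_ident bounded_linear_zero)+
  then have "Ck_on k U (\<lambda>x. (f x, 0) + (0, g x))"
    by (intro Ck_on_add assms(1) Ck_on_bounded_linear[OF assms(1) _ assms(2)]
        Ck_on_bounded_linear[OF assms(1) _ assms(3)])
  then show ?thesis by simp
qed

section \<open>The inverse function theorem for functions of class \<open>C\<^sup>k\<close>\<close>

text \<open>K need only be continuous at a: in s x K a + s x (K x - K a) the second term is o(|x -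
  a|), because s vanishes at a and is therefore O(|x - a|). This serves to differentiate inverses of
  linear maps, where differentiability of K is the very thing to be shown.\<close>

lemma has_derivative_mult_vanishing:
  fixes s :: "'e::real_normed_vector \<Rightarrow> real" and K :: "'e \<Rightarrow> 'v::real_normed_vector"
  assumes s: "(s has_derivative s') (at a)" and "s a = 0" and K: "isCont K a"
  shows "((\<lambda>x. s x *\<^sub>R K x) has_derivative (\<lambda>h. s' h *\<^sub>R K a)) (at a)"
proof -
  have "((\<lambda>x. s x *\<^sub>R K a) has_derivative (\<lambda>h. s' h *\<^sub>R K a)) (at a)"
    using bounded_linear.has_derivative[OF bounded_linear_scaleR_left s] .
  moreover have "((\<lambda>x. s x *\<^sub>R (K x - K a)) has_derivative (\<lambda>h. 0)) (at a)"
  proof -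
    obtain C where C: "C > 0" "\<And>h. norm (s' h) \<le> norm h * C"
      using bounded_linear.pos_bounded[OF has_derivative_bounded_linear[OF s]] by blast
    have "((\<lambda>x. norm (s x - s a - s' (x - a)) / norm (x - a)) \<longlongrightarrow> 0) (at a)"
      using s unfolding has_derivative_iff_norm by blast
    then have "\<forall>\<^sub>F x in at a. norm (s x - s a - s' (x - a)) / norm (x - a) < 1"
      by (rule order_tendstoD) simp
    \<comment> \<open>The bound C comes from the derivative of s and the 1 from its remainder
      term.\<close>
    then have ev: "\<forall>\<^sub>F x in at a. norm (s x) / norm (x - a) \<le> 1 + C"
      unfolding eventually_at_filter
    proof eventually_elim
      case (elim x)
      show ?case
      proof (intro impI)
        assume "x \<noteq> a"
        have "norm (s x - s' (x - a)) \<le> norm (x - a)"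
          using elim assms(2) \<open>x \<noteq> a\<close> by (auto simp: divide_less_eq split: if_splits)
        then have "norm (s x) \<le> (1 + C) * norm (x - a)"
          using C(2)[of "x - a"] norm_triangle_ineq2[of "s x" "s' (x - a)"] by (auto simp: algebra_simps)
        then show "norm (s x) / norm (x - a) \<le> 1 + C" using \<open>x \<noteq> a\<close> by (simp add: divide_le_eq)
      qed
    qed
    have lim: "((\<lambda>x. norm (s x) / norm (x - a) * norm (K x - K a)) \<longlongrightarrow> 0) (at a)"
    proof (rule Lim_null_comparison)
      show "\<forall>\<^sub>F x in at a. norm (norm (s x) / norm (x - a) * norm (K x - K a)) \<le> (1 + C) * norm (K x - K a)"
        using ev
      proof eventually_elim
        case (elim x)
        then show ?case
          using mult_right_mono[OF elim, of "norm (K x - K a)"] by (simp add: abs_mult)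
      qed
      have "((\<lambda>x. norm (K x - K a)) \<longlongrightarrow> 0) (at a)"
        using K by (simp add: isCont_def LIM_zero tendsto_norm_zero)
      then show "((\<lambda>x. (1 + C) * norm (K x - K a)) \<longlongrightarrow> 0) (at a)"
        by (rule tendsto_mult_right_zero)
    qed
    show ?thesis unfolding has_derivative_iff_norm
      using lim assms(2) by simp
  qed
  ultimately have "((\<lambda>x. s x *\<^sub>R K a + s x *\<^sub>R (K x - K a)) has_derivative (\<lambda>h. s' h *\<^sub>R K a + 0)) (at a)"
    by (rule has_derivative_add)
  then show ?thesis by (simp add: algebra_simps)
qed

text \<open>\<open>A a\<close> is bounded below by some m > 0. For y near a the operators differ by
  at most m / 2, so \<open>A y\<close> is bounded below by m / 2 uniformly, and the difference of
  the two solutions is controlled by how far \<open>A y\<close> moves the fixed vector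
  \<open>inv (A a) v\<close>.\<close>

lemma continuous_on_linear_inverse:
  fixes A :: "'x::t2_space \<Rightarrow> 'e::euclidean_space \<Rightarrow> 'e"
  assumes "open V" and lin: "\<And>y. y \<in> V \<Longrightarrow> linear (A y)" and bij: "\<And>y. y \<in> V \<Longrightarrow> bij (A y)"
    and cont: "\<And>v. continuous_on V (\<lambda>y. A y v)"
  shows "continuous_on V (\<lambda>y. inv (A y) v)"
proof (intro continuous_at_imp_continuous_on ballI)
  fix a assume a: "a \<in> V"
  let ?W = "\<lambda>y. inv (A y) v"
  obtain m where m: "m > 0" "\<And>w. m * norm w \<le> norm (A a w)"
    using linear_inj_bounded_below_pos[OF lin[OF a] bij_is_inj[OF bij[OF a]]]
    by blast
  let ?d = "\<lambda>y w. norm (A y w - A a w)"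
  have lim: "((\<lambda>y. ?d y w) \<longlongrightarrow> 0) (at a)" for w
  proof -
    have "isCont (\<lambda>y. A y w) a" using cont a assms(1) by (simp add: continuous_on_eq_continuous_at)
    then show ?thesis by (simp add: isCont_def LIM_zero tendsto_norm_zero)
  qed
  have "((\<lambda>y. \<Sum>b\<in>Basis. ?d y b) \<longlongrightarrow> 0) (at a)"
    using tendsto_sum[of Basis "\<lambda>b y. ?d y b" "\<lambda>_. 0" "at a"] lim by simp
  then have "\<forall>\<^sub>F y in at a. (\<Sum>b\<in>Basis. ?d y b) < m / 2"
    using m(1) by (intro order_tendstoD) auto
  moreover have "\<forall>\<^sub>F y in at a. y \<in> V" using a assms(1) eventually_at_in_open' by blast
  ultimately have "\<forall>\<^sub>F y in at a. norm (?W y - ?W a) \<le> 2 / m * ?d y (?W a)"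
  proof eventually_elim
    case (elim y)
    have bound: "?d y w \<le> m / 2 * norm w" for w
    proof -
      have "linear (\<lambda>w. A y w - A a w)" by (intro linear_compose_sub lin elim a)
      then have "A y w - A a w = (\<Sum>b\<in>Basis. (w \<bullet> b) *\<^sub>R (A y b - A a b))" by (rule linear_expand)
      then have "?d y w \<le> (\<Sum>b\<in>Basis. norm ((w \<bullet> b) *\<^sub>R (A y b - A a b)))"
        by (simp only: norm_sum)
      also have "\<dots> \<le> (\<Sum>b\<in>Basis. norm w * ?d y b)"
        by (intro sum_mono) (auto intro!: mult_right_mono Basis_le_norm)
      also have "\<dots> = norm w * (\<Sum>b\<in>Basis. ?d y b)" by (rule sum_distrib_left[symmetric])
      also have "\<dots> \<le> norm w * (m / 2)" using elim by (intro mult_left_mono) auto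
      finally show ?thesis by (simp add: mult.commute)
    qed
    let ?w = "?W y - ?W a"
    have inv: "A z (?W z) = v" if "z \<in> V" for z
      using bij[OF that] by (simp add: bij_is_surj surj_f_inv_f)
    have "m * norm ?w \<le> norm (A y ?w) + ?d y ?w"
      using m(2)[of ?w] norm_triangle_ineq2[of "A a ?w" "A y ?w"] by (simp add: norm_minus_commute)
    then have "m / 2 * norm ?w \<le> norm (A y ?w)" using bound[of ?w] by linarith
    also have "A y ?w = A a (?W a) - A y (?W a)"
      using inv[OF elim(2)] inv[OF a] by (simp add: linear_diff[OF lin[OF elim(2)]])
    finally show ?case using m(1) by (simp add: norm_minus_commute field_simps)
  qed
  moreover have "((\<lambda>y. 2 / m * ?d y (?W a)) \<longlongrightarrow> 0) (at a)" by (rule tendsto_mult_right_zero[OF lim])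
  ultimately have "((\<lambda>y. ?W y - ?W a) \<longlongrightarrow> 0) (at a)" by (rule Lim_null_comparison)
  then show "isCont ?W a" by (simp add: isCont_def LIM_zero_cancel)
qed

text \<open>With W y the solution of A y w = v one has W y = W a - inv (A y) (A y (W a) - v). The
  bracket vanishes at y = a, so mere continuity of the inverse already gives differentiability, with
  the usual derivative - inv A (A' W). That formula contains only the inverse itself and derivatives
  of A, which drives the induction.\<close>

lemma Ck_on_linear_inverse:
  fixes A :: "'x::euclidean_space \<Rightarrow> 'e::euclidean_space \<Rightarrow> 'e"
  assumes "open V" and lin: "\<And>y. y \<in> V \<Longrightarrow> linear (A y)" and bij: "\<And>y. y \<in> V \<Longrightarrow> bij (A y)"
    and Ck: "\<And>v. Ck_on k V (\<lambda>y. A y v)"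
  shows "Ck_on k V (\<lambda>y. inv (A y) v)"
  using Ck
proof (induction k arbitrary: v)
  case 0
  then show ?case using continuous_on_linear_inverse[OF assms(1) lin bij] by simp
next
  case (Suc k)
  let ?W = "\<lambda>y. inv (A y) v" and ?D = "\<lambda>c y. frechet_derivative (\<lambda>y. A y c) (at y)"
  let ?R' = "\<lambda>y h. \<Sum>c\<in>Basis. (?W y \<bullet> c) *\<^sub>R ?D c y h"
  have IH: "Ck_on k V (\<lambda>y. inv (A y) v)" for v
    using Suc.IH Suc.prems by (meson Ck_on_SucD)
  show ?case
  proof (rule Ck_on_SucI[OF assms(1)])
    fix a assume a: "a \<in> V"
    \<comment> \<open>The bracket A y (W a) - v, expanded in the basis so that A is differentiated
      only at fixed vectors c.\<close>
    let ?R = "\<lambda>y. (\<Sum>c\<in>Basis. (?W a \<bullet> c) *\<^sub>R A y c) - v"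
    have R: "?R y = A y (?W a) - v" if "y \<in> V" for y
      using linear_expand[OF lin[OF that], of "?W a"] by simp
    have inv_lin: "linear (inv (A y))" if "y \<in> V" for y
      using lin[OF that] bij[OF that] inj_linear_imp_inv_linear bij_is_inj by blast
    have "(?R has_derivative (\<lambda>h. ?R' a h - 0)) (at a)"
      by (intro has_derivative_diff has_derivative_sum has_derivative_const
          bounded_linear.has_derivative[OF bounded_linear_scaleR_right]
          Ck_on_has_derivative[OF Suc.prems a])
    then have "((\<lambda>y. ?R y \<bullet> b) has_derivative (\<lambda>h. ?R' a h \<bullet> b)) (at a)" for b
      using bounded_linear.has_derivative[OF bounded_linear_inner_left] by simp blast
    moreover have "?R a = 0" using R[OF a] bij[OF a] by (simp add: bij_is_surj surj_f_inv_f)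
    moreover have "isCont (\<lambda>y. inv (A y) b) a" for b
      using Ck_on_imp_continuous[OF IH[of b]] a assms(1) by (simp add: continuous_on_eq_continuous_at)
    ultimately have "((\<lambda>y. (?R y \<bullet> b) *\<^sub>R inv (A y) b) has_derivative
        (\<lambda>h. (?R' a h \<bullet> b) *\<^sub>R inv (A a) b)) (at a)" for b
      by (intro has_derivative_mult_vanishing) auto
    then have D: "((\<lambda>y. ?W a - (\<Sum>b\<in>Basis. (?R y \<bullet> b) *\<^sub>R inv (A y) b)) has_derivative
        (\<lambda>h. 0 - (\<Sum>b\<in>Basis. (?R' a h \<bullet> b) *\<^sub>R inv (A a) b))) (at a)"
      by (intro has_derivative_diff has_derivative_sum has_derivative_const)
    have eq: "?W a - (\<Sum>b\<in>Basis. (?R y \<bullet> b) *\<^sub>R inv (A y) b) = ?W y" if y: "y \<in> V" for y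
    proof -
      have "(\<Sum>b\<in>Basis. (?R y \<bullet> b) *\<^sub>R inv (A y) b) = inv (A y) (A y (?W a) - v)"
        unfolding R[OF y] by (rule linear_expand[OF inv_lin[OF y], symmetric])
      also have "\<dots> = ?W a - ?W y"
        using bij_is_inj[OF bij[OF y]] by (simp add: linear_diff[OF inv_lin[OF y]])
      finally show ?thesis by simp
    qed
    show "(?W has_derivative (\<lambda>h. - (\<Sum>b\<in>Basis. (?R' a h \<bullet> b) *\<^sub>R inv (A a) b))) (at a)"
      by (rule has_derivative_transform_within_open[OF D[unfolded diff_0] assms(1) a eq])
  next
    fix h
    have comp: "Ck_on k V (\<lambda>y. f y \<bullet> b)" if "Ck_on k V f" for f :: "'x \<Rightarrow> 'e" and b
      by (rule Ck_on_bounded_linear[OF assms(1) bounded_linear_inner_left that])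
    have "Ck_on k V (\<lambda>y. ?D c y h)" for c
      using Suc.prems[of c] by simp
    then have R': "Ck_on k V (\<lambda>y. ?R' y h)"
      by (intro Ck_on_sum Ck_on_scaleR assms(1) comp IH)
    have "Ck_on k V (\<lambda>y. (-1) *\<^sub>R (\<Sum>b\<in>Basis. (?R' y h \<bullet> b) *\<^sub>R inv (A y) b))"
      by (intro Ck_on_scaleR Ck_on_const Ck_on_sum assms(1) comp[OF R'] IH)
    then show "Ck_on k V (\<lambda>y. - (\<Sum>b\<in>Basis. (?R' y h \<bullet> b) *\<^sub>R inv (A y) b))" by simp
  qed
qed

text \<open>Bootstrapping: the derivative of g at y is the inverse of the derivative of f at g y,
  hence as smooth as g itself while f permits it. The neighbourhoods come from the case C^1 and are
  the same for every k, so one local inverse serves for C^\<infinity> as well.\<close>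

lemma Ck_inverse_function:
  fixes f :: "'e::euclidean_space \<Rightarrow> 'e"
  assumes "open U" "Ck_on (Suc 0) U f" "a \<in> U" "bij (frechet_derivative f (at a))"
  obtains U' V g where "open U'" "U' \<subseteq> U" "a \<in> U'" "open V" "f a \<in> V" "homeomorphism U' V f g"
    "\<And>k. Ck_on (Suc k) U f \<Longrightarrow> Ck_on (Suc k) V g"
    "\<And>y. y \<in> V \<Longrightarrow> (g has_derivative inv (frechet_derivative f (at (g y)))) (at y)"
    "\<And>y. y \<in> V \<Longrightarrow> bij (frechet_derivative f (at (g y)))"
proof -
  let ?D = "\<lambda>x. frechet_derivative f (at x)"
  define f' where "f' x = Blinfun (?D x)" for x
  have bl: "bounded_linear (?D x)" if "x \<in> U" for x
    using has_derivative_bounded_linear[OF Ck_on_has_derivative[OF assms(2) that]] .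
  have f': "blinfun_apply (f' x) = ?D x" if "x \<in> U" for x
    using bounded_linear_Blinfun_apply[OF bl[OF that]] by (simp add: f'_def)
  have "continuous_on U (\<lambda>x. blinfun_apply (f' x) b)" for b
    using assms(2) continuous_on_cong[of U U "\<lambda>x. blinfun_apply (f' x) b" "\<lambda>x. ?D x b"] f' by simp
  then have cont: "continuous_on U f'"
    by (intro continuous_on_blinfun_componentwise)
  have lin_inv: "bounded_linear (inv (?D a))"
    using bl[OF assms(3)] assms(4) bij_is_inj bounded_linear.linear inj_linear_imp_inv_linear linear_conv_bounded_linear
    by blast
  have "Blinfun (inv (?D a)) o\<^sub>L f' a = id_blinfun"
    using bounded_linear_Blinfun_apply[OF lin_inv] f'[OF assms(3)] bij_is_inj[OF assms(4)]
    by (intro blinfun_eqI) simp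
  moreover have der: "(f has_derivative blinfun_apply (f' x)) (at x)" if "x \<in> U" for x
    using Ck_on_has_derivative[OF assms(2) that] f'[OF that] by simp
  ultimately obtain U' V g g' where g: "open U'" "U' \<subseteq> U" "a \<in> U'" "open V" "f a \<in> V"
    "homeomorphism U' V f g" "\<And>y. y \<in> V \<Longrightarrow> (g has_derivative (g' y)) (at y)"
    "\<And>y. y \<in> V \<Longrightarrow> g' y = inv (blinfun_apply (f' (g y)))"
    "\<And>y. y \<in> V \<Longrightarrow> bij (blinfun_apply (f' (g y)))"
    using inverse_function_theorem[OF assms(1) der cont assms(3)] by metis
  have gU: "g y \<in> U" if "y \<in> V" for y
    using that g(2,6) unfolding homeomorphism_def by blast
  have der_g: "(g has_derivative inv (?D (g y))) (at y)" "bij (?D (g y))" if "y \<in> V" for y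
    using g(7-9)[OF that] f'[OF gU[OF that]] by auto
  have "Ck_on (Suc k) V g" if "Ck_on (Suc k) U f" for k
    using that
  proof (induction k)
    case 0
    show ?case
    proof (rule Ck_on_SucI[OF g(4) der_g(1)])
      have "Ck_on 0 V (\<lambda>y. ?D (g y) w)" for w
        using 0 g(2,6) gU continuous_on_compose2[of U "\<lambda>x. ?D x w" V g]
        by (auto simp: homeomorphism_def)
      then show "Ck_on 0 V (\<lambda>y. inv (?D (g y)) v)" for v
        by (intro Ck_on_linear_inverse g(4) der_g(2) bounded_linear.linear bl gU)
    qed
  next
    case (Suc k)
    show ?case
    proof (rule Ck_on_SucI[OF g(4) der_g(1)])
      have "Ck_on (Suc k) U (\<lambda>x. ?D x w)" for w
        using Suc.prems by simp
      then have "Ck_on (Suc k) V (\<lambda>y. ?D (g y) w)" for w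
        using gU by (intro Ck_on_compose[OF g(4) assms(1) _ Suc.IH[OF Ck_on_SucD[OF Suc.prems]]]) auto
      then show "Ck_on (Suc k) V (\<lambda>y. inv (?D (g y)) v)" for v
        by (intro Ck_on_linear_inverse g(4) der_g(2) bounded_linear.linear bl gU)
    qed
  qed
  then show thesis using that g(1-6) der_g by blast
qed

section \<open>Power series of separately holomorphic functions\<close>

lemma Cauchy_coefficient_bound:
  assumes "f holomorphic_on ball 0 R" "0 < r" "r < R" "\<And>u. norm u < R \<Longrightarrow> norm (f u) \<le> K"
  shows "norm ((deriv ^^ j) f 0 / fact j) \<le> K / r ^ j"
proof -
  have "norm ((deriv ^^ j) f 0) \<le> fact j * K / r ^ j"
    using assms by (intro Cauchy_inequality holomorphic_on_subset[OF assms(1)]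
      holomorphic_on_imp_continuous_on) auto
  then show ?thesis by (simp add: norm_divide field_simps)
qed

text \<open>The coefficients are holomorphic one after the other: each is the uniform limit of the
  difference quotients formed with the preceding ones.\<close>

lemma holomorphic_on_power_series_coefficient:
  fixes h :: "complex \<Rightarrow> complex \<Rightarrow> complex"
  assumes "R > 0" and bound: "\<And>s u. norm s < R \<Longrightarrow> norm u < R \<Longrightarrow> norm (h s u) \<le> K"
    and hol: "\<And>s. norm s < R \<Longrightarrow> h s holomorphic_on ball 0 R"
    and hol_par: "\<And>u. norm u < R \<Longrightarrow> (\<lambda>s. h s u) holomorphic_on ball 0 R"
  shows "(\<lambda>s. (deriv ^^ j) (h s) 0 / fact j) holomorphic_on ball 0 R"
proof (induction j rule: less_induct)
  case (less j)
  define a where "a s j = (deriv ^^ j) (h s) 0 / fact j" for s j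
  define r where "r = R / 2"
  have r: "0 < r" "r < R" using assms(1) by (auto simp: r_def)
  have a_bound: "norm (a s i) \<le> K / r ^ i" if "norm s < R" for s i
    unfolding a_def by (rule Cauchy_coefficient_bound[OF hol[OF that] r bound[OF that]])

  \<comment> \<open>The quotients are formed at the real points r / (n + 2). By the Cauchy bounds
    the error is dominated by a geometric series in x, and x / (1 - x) = 1 / (n + 1) then tends to 0
    uniformly in s.\<close>
  define x where "x n = 1 / real (n + 2)" for n
  have x: "0 < x n" "x n < 1" for n by (auto simp: x_def)
  define u where "u n = complex_of_real (r * x n)" for n
  have u: "u n \<noteq> 0" "norm (u n) < R" for n
  proof -
    have "r * x n < R * 1" using r x[of n] by (intro mult_strict_mono) auto
    then show "u n \<noteq> 0" "norm (u n) < R" using r x[of n] by (auto simp: u_def norm_mult)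
  qed
  define q where "q n s = (h s (u n) - (\<Sum>i<j. a s i * u n ^ i)) / u n ^ j" for n s
  have q_hol: "q n holomorphic_on ball 0 R" for n
    unfolding q_def using u less.IH
    by (intro holomorphic_intros hol_par) (auto simp: a_def)
  have est: "norm (q n s - a s j) \<le> K / r ^ j * (1 / (real n + 1))" if s: "norm s < R" for n s
  proof -
    have "(\<lambda>i. a s i * u n ^ i) sums h s (u n)"
      using holomorphic_power_series[OF hol[OF s], of "u n"] u(2)[of n] by (simp add: a_def)
    then have "(\<lambda>i. a s (i + Suc j) * u n ^ (i + Suc j)) sums
        (h s (u n) - (\<Sum>i<Suc j. a s i * u n ^ i))"
      by (rule iffD2[OF sums_iff_shift'[where f = "\<lambda>i. a s i * u n ^ i"]])
    then have "(\<lambda>i. a s (i + Suc j) * u n ^ (i + Suc j) / u n ^ j) sums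
        ((h s (u n) - (\<Sum>i<Suc j. a s i * u n ^ i)) / u n ^ j)"
      by (rule sums_divide)
    moreover have "(h s (u n) - (\<Sum>i<Suc j. a s i * u n ^ i)) / u n ^ j = q n s - a s j"
      using u(1)[of n] by (simp add: q_def field_simps)
    ultimately have S: "(\<lambda>i. a s (i + Suc j) * u n ^ (i + Suc j) / u n ^ j) sums (q n s - a s j)"
      by simp
    have "(\<lambda>i. K / r ^ j * x n * x n ^ i) sums (K / r ^ j * x n * (1 / (1 - x n)))"
      using x[of n] by (intro sums_mult geometric_sums) auto
    moreover have "x n * (1 / (1 - x n)) = 1 / (real n + 1)"
      by (simp add: x_def field_simps)
    ultimately have G: "(\<lambda>i. K / r ^ j * x n * x n ^ i) sums (K / r ^ j * (1 / (real n + 1)))"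
      by (simp only: mult.assoc)
    have tm: "norm (a s (i + Suc j) * u n ^ (i + Suc j) / u n ^ j) \<le> K / r ^ j * x n * x n ^ i" for i
    proof -
      have "norm (a s (i + Suc j) * u n ^ (i + Suc j) / u n ^ j) = norm (a s (i + Suc j)) * (r * x n) ^ Suc i"
        using u(1)[of n] r x[of n] by (simp add: norm_mult norm_divide norm_power power_add u_def)
      also have "\<dots> \<le> K / r ^ (i + Suc j) * (r * x n) ^ Suc i"
        by (intro mult_right_mono a_bound s) (use r x[of n] in auto)
      also have "\<dots> = K / r ^ j * x n * x n ^ i"
        using r by (simp add: power_add power_mult_distrib field_simps)
      finally show ?thesis .
    qed
    have "norm (q n s - a s j) = norm (\<Sum>i. a s (i + Suc j) * u n ^ (i + Suc j) / u n ^ j)"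
      using S by (simp add: sums_iff)
    also have "\<dots> \<le> (\<Sum>i. K / r ^ j * x n * x n ^ i)"
      by (rule norm_suminf_le[OF tm sums_summable[OF G]])
    also have "\<dots> = K / r ^ j * (1 / (real n + 1))" using G by (simp add: sums_iff)
    finally show ?thesis .
  qed
  have "(\<lambda>s. a s j) holomorphic_on ball 0 R"
  proof (rule holomorphic_uniform_sequence[OF open_ball q_hol])
    fix s :: complex assume "s \<in> ball 0 R"
    then obtain d where d: "d > 0" "cball s d \<subseteq> ball 0 R"
      using open_ball[of "0::complex" R] unfolding open_contains_cball by blast
    have "uniform_limit (cball s d) q (\<lambda>s. a s j) sequentially"
    proof (rule uniform_limitI)
      fix e :: real assume "e > 0"
      have "(\<lambda>n. K / r ^ j * (1 / (real n + 1))) \<longlonglongrightarrow> 0"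
        by real_asymp
      then have "\<forall>\<^sub>F n in sequentially. K / r ^ j * (1 / (real n + 1)) < e"
        using \<open>e > 0\<close> by (rule order_tendstoD)
      then show "\<forall>\<^sub>F n in sequentially. \<forall>y\<in>cball s d. dist (q n y) (a y j) < e"
      proof eventually_elim
        case (elim n)
        show ?case
        proof
          fix y assume "y \<in> cball s d"
          then have "norm y < R" using d by auto
          then show "dist (q n y) (a y j) < e" using est[of y n] elim by (simp add: dist_norm)
        qed
      qed
    qed
    then show "\<exists>d>0. cball s d \<subseteq> ball 0 R \<and> uniform_limit (cball s d) q (\<lambda>s. a s j) sequentially"
      using d by blast
  qed
  then show ?case by (simp add: a_def)
qed

text \<open>The geometric series over multi-indices; it dominates the power series built
  next.\<close>

lemma summable_on_geometric_PiE:
  fixes x :: "'i \<Rightarrow> real"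
  assumes "finite B" "\<And>i. i \<in> B \<Longrightarrow> 0 \<le> x i \<and> x i < 1"
  shows "(\<lambda>k. \<Prod>i\<in>B. x i ^ k i) summable_on (B \<rightarrow>\<^sub>E UNIV)"
proof -
  have "Infinite_Set_Sum.abs_summable_on (\<lambda>n. x i ^ n) UNIV" if "i \<in> B" for i
    using assms(2)[OF that] by (simp add: abs_summable_on_nat_iff' summable_geometric)
  then have "Infinite_Set_Sum.abs_summable_on (\<lambda>k. \<Prod>i\<in>B. x i ^ k i) (B \<rightarrow>\<^sub>E UNIV)"
    by (intro abs_summable_on_prod_PiE[where f = "\<lambda>i n. x i ^ n"] assms(1)) auto
  then have "(\<lambda>k. norm (\<Prod>i\<in>B. x i ^ k i)) summable_on (B \<rightarrow>\<^sub>E UNIV)"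
    by (simp only: abs_summable_equivalent)
  then show ?thesis by (rule abs_summable_summable)
qed

text \<open>Osgood's lemma for bounded functions, by induction on the variables. Expand in one
  variable b; each coefficient is bounded by Cauchy's estimate and separately holomorphic in the
  remaining variables by the preceding lemma, so it has a series of its own. The gap between r and R
  is the room for Cauchy's estimates. Coordinates outside B are frozen at 0, since the series does
  not see them.\<close>

lemma separately_holomorphic_has_power_series:
  fixes G :: "('i \<Rightarrow> complex) \<Rightarrow> complex"
  assumes "finite B" "0 < r" "r < R"
    and "\<And>w. (\<And>i. i \<in> B \<Longrightarrow> norm (w i) < R) \<Longrightarrow> norm (G w) \<le> K"
    and "\<And>w i. (\<And>i. i \<in> B \<Longrightarrow> norm (w i) < R) \<Longrightarrow> i \<in> B \<Longrightarrow> (\<lambda>s. G (w(i := s))) holomorphic_on ball 0 R"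
  shows "\<exists>c. (\<forall>k \<in> B \<rightarrow>\<^sub>E UNIV. norm (c k) \<le> K / r ^ (\<Sum>i\<in>B. k i)) \<and>
    (\<forall>w. (\<forall>i\<in>B. norm (w i) < r) \<longrightarrow> (\<forall>i. i \<notin> B \<longrightarrow> w i = 0) \<longrightarrow>
      ((\<lambda>k. (\<Prod>i\<in>B. w i ^ k i) * c k) has_sum G w) (B \<rightarrow>\<^sub>E UNIV))"
  using assms(1,4,5)
proof (induction B arbitrary: G K rule: finite_induct)
  case empty
  show ?case
  proof (intro exI conjI ballI allI impI)
    show "norm (G (\<lambda>_. 0)) \<le> K / r ^ (\<Sum>i\<in>{}. k i)" for k :: "'i \<Rightarrow> nat"
      using empty.prems(1)[of "\<lambda>_. 0"] by simp
    fix w :: "'i \<Rightarrow> complex" assume "\<forall>i. i \<notin> {} \<longrightarrow> w i = 0"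
    then have "w = (\<lambda>_. 0)" by auto
    then show "((\<lambda>k. (\<Prod>i\<in>{}. w i ^ k i) * G (\<lambda>_. 0)) has_sum G w) ({} \<rightarrow>\<^sub>E UNIV)"
      unfolding PiE_empty_domain by (intro has_sum_finiteI) simp_all
  qed
next
  case (insert b B)
  define C where "C j w = (deriv ^^ j) (\<lambda>u. G (w(b := u))) 0 / fact j" for j w
  define poly where "poly B' w \<longleftrightarrow> (\<forall>i\<in>B'. norm (w i) < R)" for B' and w :: "'i \<Rightarrow> complex"
  have R: "R > 0" using assms by simp
  have upd: "poly (insert b B) (w(b := u))" if "poly B w" "norm u < R" for w u
    using that by (auto simp: poly_def)
  have bnd': "norm (G w) \<le> K" if "poly (insert b B) w" for w
    using insert.prems(1)[of w] that unfolding poly_def by blast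
  have hol': "(\<lambda>s. G (w(i := s))) holomorphic_on ball 0 R" if "poly (insert b B) w" "i \<in> insert b B" for w i
    using insert.prems(2)[of w i] that unfolding poly_def by blast
  have hol: "(\<lambda>u. G (w(b := u))) holomorphic_on ball 0 R" if "poly B w" for w
    using hol'[OF upd[OF that, of 0], of b] R by simp
  have bnd: "norm (G (w(b := u))) \<le> K" if "poly B w" "norm u < R" for w u
    by (rule bnd'[OF upd[OF that]])
  \<comment> \<open>What the induction hypothesis gives for the coefficient of order j, with
    Cauchy's bound K / r^j in place of K.\<close>
  let ?P = "\<lambda>j c. (\<forall>k \<in> B \<rightarrow>\<^sub>E UNIV. norm (c k) \<le> K / r ^ j / r ^ (\<Sum>i\<in>B. k i)) \<and>
    (\<forall>w. (\<forall>i\<in>B. norm (w i) < r) \<longrightarrow> (\<forall>i. i \<notin> B \<longrightarrow> w i = 0) \<longrightarrow>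
      ((\<lambda>k. (\<Prod>i\<in>B. w i ^ k i) * c k) has_sum C j w) (B \<rightarrow>\<^sub>E UNIV))"
  have ex: "\<exists>c. ?P j c" for j
  proof (rule insert.IH)
    fix w :: "'i \<Rightarrow> complex" assume "\<And>i. i \<in> B \<Longrightarrow> norm (w i) < R"
    then have w: "poly B w" by (simp add: poly_def)
    show "norm (C j w) \<le> K / r ^ j"
      unfolding C_def by (rule Cauchy_coefficient_bound[OF hol[OF w] assms(2,3) bnd[OF w]])
    fix i assume i: "i \<in> B"
    then have "i \<noteq> b" using insert.hyps by auto
    have ws: "poly B (w(i := s))" if "norm s < R" for s using w that by (auto simp: poly_def)
    have swap: "w(i := s, b := u) = w(b := u, i := s)" for s u
      using \<open>i \<noteq> b\<close> by (rule fun_upd_twist)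
    show "(\<lambda>s. C j (w(i := s))) holomorphic_on ball 0 R"
      unfolding C_def
    proof (rule holomorphic_on_power_series_coefficient[OF R, where h = "\<lambda>s u. G (w(i := s, b := u))"])
      show "norm (G (w(i := s, b := u))) \<le> K" if "norm s < R" "norm u < R" for s u
        by (rule bnd[OF ws[OF that(1)] that(2)])
      show "(\<lambda>u. G (w(i := s, b := u))) holomorphic_on ball 0 R" if "norm s < R" for s
        by (rule hol[OF ws[OF that]])
      show "(\<lambda>s. G (w(i := s, b := u))) holomorphic_on ball 0 R" if "norm u < R" for u
        unfolding swap using hol'[OF upd[OF w that], of i] i by simp
    qed
  qed
  have "\<exists>c. \<forall>j. ?P j (c j)" by (rule choice) (intro allI ex)
  then obtain c where c: "\<And>j k. k \<in> B \<rightarrow>\<^sub>E UNIV \<Longrightarrow> norm (c j k) \<le> K / r ^ j / r ^ (\<Sum>i\<in>B. k i)"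
    "\<And>j w. (\<forall>i\<in>B. norm (w i) < r) \<Longrightarrow> (\<forall>i. i \<notin> B \<longrightarrow> w i = 0) \<Longrightarrow>
      ((\<lambda>k. (\<Prod>i\<in>B. w i ^ k i) * c j k) has_sum C j w) (B \<rightarrow>\<^sub>E UNIV)"
    by blast
  \<comment> \<open>A multi-index on \<open>insert b B\<close> is an exponent of b together with a
    multi-index on B.\<close>
  define c' where "c' k = c (k b) (restrict k B)" for k
  have restr: "restrict k B \<in> B \<rightarrow>\<^sub>E UNIV" for k :: "'i \<Rightarrow> nat" by auto
  have bound: "norm (c' k) \<le> K / r ^ (\<Sum>i\<in>insert b B. k i)" for k
    using c(1)[OF restr, of "k b" k] insert.hyps by (simp add: c'_def power_add cong: sum.cong)
  show ?case
  proof (intro exI[of _ c'] conjI ballI allI impI bound)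
    fix w :: "'i \<Rightarrow> complex"
    assume w: "\<forall>i\<in>insert b B. norm (w i) < r" "\<forall>i. i \<notin> insert b B \<longrightarrow> w i = 0"
    let ?t = "\<lambda>k. (\<Prod>i\<in>insert b B. w i ^ k i) * c' k"
    let ?ext = "\<lambda>(j, k). k(b := j :: nat)"
    have img: "insert b B \<rightarrow>\<^sub>E UNIV = ?ext ` (UNIV \<times> (B \<rightarrow>\<^sub>E UNIV))"
      by (rule PiE_insert_eq)
    have inj: "inj_on ?ext (UNIV \<times> (B \<rightarrow>\<^sub>E UNIV))"
      using inj_combinator[OF insert.hyps(2), of "\<lambda>_. UNIV"] .
    \<comment> \<open>Absolute summability allows the unordered sum to be evaluated in stages: for
      fixed j over the multi-indices on B, then over j by the one-variable expansion.\<close>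
    have "(\<lambda>k. norm (?t k)) summable_on (insert b B \<rightarrow>\<^sub>E UNIV)"
    proof (rule Infinite_Sum.abs_summable_on_comparison_test')
      show "(\<lambda>k. K * (\<Prod>i\<in>insert b B. (norm (w i) / r) ^ k i)) summable_on (insert b B \<rightarrow>\<^sub>E UNIV)"
        using w assms(2) insert.hyps
        by (intro summable_on_cmult_right summable_on_geometric_PiE) auto
      fix k
      have "norm (?t k) \<le> (\<Prod>i\<in>insert b B. norm (w i) ^ k i) * (K / r ^ (\<Sum>i\<in>insert b B. k i))"
        unfolding norm_mult prod_norm[symmetric] norm_power
        by (intro mult_left_mono bound prod_nonneg) auto
      also have "\<dots> = K * (\<Prod>i\<in>insert b B. (norm (w i) / r) ^ k i)"
        by (simp only: power_sum power_divide prod_dividef) simp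
      finally show "norm (?t k) \<le> K * (\<Prod>i\<in>insert b B. (norm (w i) / r) ^ k i)" .
    qed
    then have "?t summable_on (insert b B \<rightarrow>\<^sub>E UNIV)" by (rule abs_summable_summable)
    then have summable: "(?t \<circ> ?ext) summable_on (UNIV \<times> (B \<rightarrow>\<^sub>E UNIV))"
      unfolding img by (simp only: summable_on_reindex[OF inj])
    \<comment> \<open>The induction hypothesis applies only to points that vanish outside B;
      resetting the coordinate b is harmless, because C substitutes for it anyway.\<close>
    define w' where "w' = w(b := 0)"
    have wR: "poly B w'" using w assms(3) insert.hyps by (force simp: poly_def w'_def)
    have "((?t \<circ> ?ext) has_sum G w) (UNIV \<times> (B \<rightarrow>\<^sub>E UNIV))"
    proof (rule has_sum_SigmaI[OF _ _ summable])
      show "((\<lambda>k. (?t \<circ> ?ext) (j, k)) has_sum (w b ^ j * C j w')) (B \<rightarrow>\<^sub>E UNIV)" for j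
      proof -
        have "((\<lambda>k. w b ^ j * ((\<Prod>i\<in>B. w' i ^ k i) * c j k)) has_sum (w b ^ j * C j w')) (B \<rightarrow>\<^sub>E UNIV)"
          using w insert.hyps by (intro has_sum_cmult_right c(2)) (auto simp: w'_def)
        moreover have "w b ^ j * ((\<Prod>i\<in>B. w' i ^ k i) * c j k) = (?t \<circ> ?ext) (j, k)"
          if "k \<in> B \<rightarrow>\<^sub>E UNIV" for k
        proof -
          have "restrict (k(b := j)) B = k" using that insert.hyps by (auto simp: PiE_def extensional_def)
          moreover have "(\<Prod>i\<in>B. w' i ^ k i) = (\<Prod>i\<in>B. w i ^ (k(b := j)) i)"
            using insert.hyps by (intro prod.cong) (auto simp: w'_def)
          ultimately show ?thesis using insert.hyps by (simp add: c'_def)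
        qed
        ultimately show ?thesis by (simp only: cong: has_sum_cong)
      qed
      have S: "(\<lambda>j. w b ^ j * C j w') sums G w"
        using holomorphic_power_series[OF hol[OF wR], of "w b"] w assms(3)
        by (simp add: C_def w'_def mult.commute fun_upd_idem)
      have "summable (\<lambda>j. K * (norm (w b) / r) ^ j)"
        using w assms(2) by (intro summable_mult summable_geometric) auto
      then have "summable (\<lambda>j. norm (w b ^ j * C j w'))"
      proof (rule summable_comparison_test')
        fix j
        have "norm (C j w') \<le> K / r ^ j"
          unfolding C_def by (rule Cauchy_coefficient_bound[OF hol[OF wR] assms(2,3) bnd[OF wR]])
        then show "norm (norm (w b ^ j * C j w')) \<le> K * (norm (w b) / r) ^ j"
          using mult_left_mono[of "norm (C j w')" "K / r ^ j" "norm (w b) ^ j"]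
          by (simp add: norm_mult norm_power power_divide mult.commute)
      qed
      then show "((\<lambda>j. w b ^ j * C j w') has_sum G w) UNIV"
        using S by (rule norm_summable_imp_has_sum)
    qed
    then show "(?t has_sum G w) (insert b B \<rightarrow>\<^sub>E UNIV)"
      unfolding img by (simp only: has_sum_reindex[OF inj])
  qed
qed

section \<open>Real analyticity in terms of holomorphic extensions\<close>

text \<open>The space \<open>'e \<times> 'e\<close> serves as the complexification of \<open>'e\<close>, with \<open>imult\<close> as multiplication by
  the imaginary unit.\<close>

definition imult :: "'e::real_vector \<times> 'e \<Rightarrow> 'e \<times> 'e" where
  "imult z = (- snd z, fst z)"

text \<open>The Cauchy-Riemann equations, as complex linearity of the real derivative. The
  continuity of the derivative is built in so that the real C^1 inverse function theorem applies
  directly.\<close>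

definition holo_on ::
  "('e::euclidean_space \<times> 'e) set \<Rightarrow> ('e \<times> 'e \<Rightarrow> 'f::euclidean_space \<times> 'f) \<Rightarrow> bool" where
  "holo_on W g \<longleftrightarrow> Ck_on (Suc 0) W g \<and>
     (\<forall>z\<in>W. \<forall>v. frechet_derivative g (at z) (imult v) = imult (frechet_derivative g (at z) v))"

text \<open>Stated at a single point, so that the calculus rules need no bookkeeping of domains.
  Agreement with f is demanded at all real points of W, hence the property passes to nearby
  points.\<close>

definition holo_ext_at :: "('e::euclidean_space \<Rightarrow> 'f::euclidean_space) \<Rightarrow> 'e \<Rightarrow> bool" where
  "holo_ext_at f a \<longleftrightarrow>
     (\<exists>W g. open W \<and> (a, 0) \<in> W \<and> holo_on W g \<and> (\<forall>x. (x, 0) \<in> W \<longrightarrow> g (x, 0) = (f x, 0)))"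

lemma holo_onI:
  assumes "open W" "\<And>z. z \<in> W \<Longrightarrow> (g has_derivative g' z) (at z)"
    and "\<And>v. continuous_on W (\<lambda>z. g' z v)"
    and "\<And>z v. z \<in> W \<Longrightarrow> g' z (imult v) = imult (g' z v)"
  shows "holo_on W g"
  unfolding holo_on_def
proof (intro conjI ballI allI)
  show "Ck_on (Suc 0) W g"
    using assms(3) by (intro Ck_on_SucI[OF assms(1,2)]) simp_all
  show "frechet_derivative g (at z) (imult v) = imult (frechet_derivative g (at z) v)" if "z \<in> W" for z v
    using assms(4)[OF that] by (simp add: frechet_derivativeI[OF assms(2)[OF that]])
qed

lemma holo_on_has_derivative:
  "holo_on W g \<Longrightarrow> z \<in> W \<Longrightarrow> (g has_derivative frechet_derivative g (at z)) (at z)"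
  unfolding holo_on_def by (meson Ck_on_has_derivative)

lemma holo_on_imult:
  "holo_on W g \<Longrightarrow> z \<in> W \<Longrightarrow>
    frechet_derivative g (at z) (imult v) = imult (frechet_derivative g (at z) v)"
  unfolding holo_on_def by blast

lemma holo_on_continuous_derivative:
  assumes "holo_on W g"
  shows "continuous_on W (\<lambda>z. frechet_derivative g (at z) v)"
proof -
  have "Ck_on 0 W (\<lambda>z. frechet_derivative g (at z) v)"
    using assms unfolding holo_on_def Ck_on.simps(2) by blast
  then show ?thesis by (simp only: Ck_on.simps(1))
qed

lemma holo_on_continuous: "holo_on W g \<Longrightarrow> continuous_on W g"
  unfolding holo_on_def by (meson Ck_on_imp_continuous)

lemma holo_on_subset: "holo_on W g \<Longrightarrow> V \<subseteq> W \<Longrightarrow> holo_on V g"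
  unfolding holo_on_def by (blast intro: Ck_on_subset)

lemma holo_on_compose:
  assumes "open U" "open V" "holo_on V f" "holo_on U g" "g ` U \<subseteq> V"
  shows "holo_on U (\<lambda>x. f (g x))"
  unfolding holo_on_def
proof (intro conjI ballI allI)
  show "Ck_on (Suc 0) U (\<lambda>x. f (g x))"
    using assms(3,4) unfolding holo_on_def by (blast intro: Ck_on_compose[OF assms(1,2) _ _ assms(5), of "Suc 0" f])
  fix z v assume z: "z \<in> U"
  then have gz: "g z \<in> V" using assms(5) by blast
  have "frechet_derivative (\<lambda>x. f (g x)) (at z) = frechet_derivative f (at (g z)) \<circ> frechet_derivative g (at z)"
    using diff_chain_at[OF holo_on_has_derivative[OF assms(4) z] holo_on_has_derivative[OF assms(3) gz]]
    by (intro frechet_derivativeI) (simp add: o_def)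
  then show "frechet_derivative (\<lambda>x. f (g x)) (at z) (imult v) = imult (frechet_derivative (\<lambda>x. f (g x)) (at z) v)"
    by (simp only: o_apply holo_on_imult[OF assms(4) z] holo_on_imult[OF assms(3) gz])
qed

section \<open>Closure properties of functions with a holomorphic extension\<close>

lemma holo_ext_at_cong:
  assumes "holo_ext_at f a" "open U" "a \<in> U" "\<And>x. x \<in> U \<Longrightarrow> f x = g x"
  shows "holo_ext_at g a"
proof -
  obtain W h where W: "open W" "(a, 0) \<in> W" "holo_on W h" "\<And>x. (x, 0) \<in> W \<Longrightarrow> h (x, 0) = (f x, 0)"
    using assms(1) unfolding holo_ext_at_def by blast
  let ?W = "W \<inter> U \<times> UNIV"
  have "open ?W" using W(1) assms(2) by (intro open_Int open_Times) auto
  moreover have "holo_on ?W h" using holo_on_subset[OF W(3)] by blast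
  ultimately show ?thesis
    unfolding holo_ext_at_def using W assms(3,4) by (intro exI[of _ ?W] exI[of _ h]) auto
qed

lemma holo_ext_at_imp_Ck:
  assumes "holo_ext_at f a"
  shows "\<exists>V. open V \<and> a \<in> V \<and> Ck_on (Suc 0) V f"
proof -
  obtain W g where W: "open W" "(a, 0) \<in> W" "holo_on W g" "\<And>x. (x, 0) \<in> W \<Longrightarrow> g (x, 0) = (f x, 0)"
    using assms unfolding holo_ext_at_def by blast
  let ?V = "(\<lambda>x. (x, 0)) -` W"
  have V: "open ?V" by (intro open_vimage W(1) continuous_intros)
  have emb: "Ck_on (Suc 0) ?V (\<lambda>x. (x, 0 :: 'a))"
    by (intro Ck_on_Pair Ck_on_ident Ck_on_const V)
  have "Ck_on (Suc 0) ?V (\<lambda>x. g (x, 0))"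
    by (rule Ck_on_compose[OF V W(1) _ emb]) (use W(3) in \<open>auto simp only: holo_on_def\<close>)
  then have "Ck_on (Suc 0) ?V (\<lambda>x. fst (g (x, 0)))"
    by (rule Ck_on_bounded_linear[OF V bounded_linear_fst])
  then have "Ck_on (Suc 0) ?V f"
    by (rule Ck_on_cong[OF V, rotated]) (simp add: W(4) del: Ck_on.simps)
  then show ?thesis using V W(2) by (intro exI[of _ ?V]) simp
qed

lemma holo_ext_at_compose:
  assumes "holo_ext_at g a" "holo_ext_at f (g a)"
  shows "holo_ext_at (\<lambda>x. f (g x)) a"
proof -
  obtain W h where W: "open W" "(a, 0) \<in> W" "holo_on W h" "\<And>x. (x, 0) \<in> W \<Longrightarrow> h (x, 0) = (g x, 0)"
    using assms(1) unfolding holo_ext_at_def by blast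
  obtain V k where V: "open V" "(g a, 0) \<in> V" "holo_on V k" "\<And>x. (x, 0) \<in> V \<Longrightarrow> k (x, 0) = (f x, 0)"
    using assms(2) unfolding holo_ext_at_def by blast
  let ?W = "W \<inter> h -` V"
  have "open ?W"
    using continuous_open_preimage[OF holo_on_continuous[OF W(3)] W(1) V(1)] by simp
  moreover have "holo_on ?W (\<lambda>z. k (h z))"
    using holo_on_subset[OF W(3), of ?W] calculation by (intro holo_on_compose[OF _ V(1,3)]) auto
  ultimately show ?thesis
    unfolding holo_ext_at_def using W V by (intro exI[of _ ?W] exI[of _ "\<lambda>z. k (h z)"]) auto
qed

lemma holo_ext_at_bounded_linear:
  assumes "bounded_linear L"
  shows "holo_ext_at L a"
proof -
  let ?g = "\<lambda>z. (L (fst z), L (snd z))"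
  have "bounded_linear ?g"
    by (intro bounded_linear_Pair bounded_linear_compose[OF assms] bounded_linear_fst bounded_linear_snd)
  moreover have "imult (?g v) = ?g (imult v)" for v
    by (simp add: imult_def linear_neg[OF bounded_linear.linear[OF assms]])
  ultimately have "holo_on UNIV ?g"
    by (intro holo_onI[of UNIV ?g "\<lambda>_. ?g"]) (auto intro: bounded_linear_imp_has_derivative)
  then show ?thesis
    unfolding holo_ext_at_def
    by (intro exI[of _ UNIV] exI[of _ ?g]) (simp add: linear_0[OF bounded_linear.linear[OF assms]])
qed

lemma holo_ext_at_const: "holo_ext_at (\<lambda>_. c) a"
proof -
  have "holo_on UNIV (\<lambda>_ :: 'a \<times> 'a. (c, 0))"
    by (intro holo_onI[of UNIV _ "\<lambda>_ _. 0"]) (auto simp: imult_def zero_prod_def[symmetric])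
  then show ?thesis unfolding holo_ext_at_def by (intro exI[of _ UNIV] exI[of _ "\<lambda>_. (c, 0)"]) simp
qed

lemma holo_ext_at_Pair:
  assumes "holo_ext_at f a" "holo_ext_at g a"
  shows "holo_ext_at (\<lambda>x. (f x, g x)) a"
proof -
  obtain W h where W: "open W" "(a, 0) \<in> W" "holo_on W h" "\<And>x. (x, 0) \<in> W \<Longrightarrow> h (x, 0) = (f x, 0)"
    using assms(1) unfolding holo_ext_at_def by blast
  obtain V k where V: "open V" "(a, 0) \<in> V" "holo_on V k" "\<And>x. (x, 0) \<in> V \<Longrightarrow> k (x, 0) = (g x, 0)"
    using assms(2) unfolding holo_ext_at_def by blast
  let ?g = "\<lambda>z. ((fst (h z), fst (k z)), (snd (h z), snd (k z)))"
  let ?D = "\<lambda>f z. frechet_derivative f (at z)"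
  have "holo_on (W \<inter> V) ?g"
  proof (rule holo_onI)
    show "open (W \<inter> V)" using W V by auto
    show "(?g has_derivative (\<lambda>v. ((fst (?D h z v), fst (?D k z v)), (snd (?D h z v), snd (?D k z v))))) (at z)"
      if "z \<in> W \<inter> V" for z
      using that by (intro has_derivative_Pair has_derivative_fst has_derivative_snd
          holo_on_has_derivative[OF W(3)] holo_on_has_derivative[OF V(3)]) auto
    have "continuous_on (W \<inter> V) (\<lambda>z. ?D h z v)" "continuous_on (W \<inter> V) (\<lambda>z. ?D k z v)" for v
      by (blast intro: continuous_on_subset holo_on_continuous_derivative[OF W(3)]
          holo_on_continuous_derivative[OF V(3)])+
    then show "continuous_on (W \<inter> V) (\<lambda>z. ((fst (?D h z v), fst (?D k z v)), (snd (?D h z v), snd (?D k z v))))" for v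
      by (intro continuous_intros)
    show "((fst (?D h z (imult v)), fst (?D k z (imult v))), (snd (?D h z (imult v)), snd (?D k z (imult v)))) =
      imult ((fst (?D h z v), fst (?D k z v)), (snd (?D h z v), snd (?D k z v)))" if "z \<in> W \<inter> V" for z v
      using that by (simp add: holo_on_imult[OF W(3)] holo_on_imult[OF V(3)]) (simp add: imult_def)
  qed
  then show ?thesis
    unfolding holo_ext_at_def using W V
    by (intro exI[of _ "W \<inter> V"] exI[of _ ?g]) (auto simp: zero_prod_def[symmetric])
qed

lemma holo_ext_at_add:
  assumes "holo_ext_at f a" "holo_ext_at g a"
  shows "holo_ext_at (\<lambda>x. f x + g x) a"
proof -
  have "bounded_linear (\<lambda>p :: 'b \<times> 'b. fst p + snd p)"
    by (intro bounded_linear_add bounded_linear_fst bounded_linear_snd)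
  then show ?thesis
    using holo_ext_at_compose[OF holo_ext_at_Pair[OF assms] holo_ext_at_bounded_linear] by fastforce
qed

lemma holo_ext_at_linear_compose:
  assumes "bounded_linear L" "holo_ext_at f a"
  shows "holo_ext_at (\<lambda>x. L (f x)) a"
  by (rule holo_ext_at_compose[OF assms(2) holo_ext_at_bounded_linear[OF assms(1)]])

lemma holo_ext_at_sum:
  "(\<And>i. i \<in> I \<Longrightarrow> holo_ext_at (f i) a) \<Longrightarrow> holo_ext_at (\<lambda>x. \<Sum>i\<in>I. f i x) a"
  by (induction I rule: infinite_finite_induct) (auto intro: holo_ext_at_add holo_ext_at_const)

lemma holo_ext_at_componentwise:
  fixes f :: "'e::euclidean_space \<Rightarrow> 'f::euclidean_space"
  assumes "\<And>b. b \<in> Basis \<Longrightarrow> holo_ext_at (\<lambda>x. f x \<bullet> b) a"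
  shows "holo_ext_at f a"
proof -
  have "holo_ext_at (\<lambda>x. \<Sum>b\<in>Basis. (f x \<bullet> b) *\<^sub>R b) a"
    by (intro holo_ext_at_sum holo_ext_at_linear_compose[OF bounded_linear_scaleR_left] assms)
  then show ?thesis by (simp add: euclidean_representation)
qed

section \<open>Extensions obtained from holomorphic functions of one complex variable\<close>

lemma holo_on_of_complex:
  assumes "open S" "k holomorphic_on S"
  shows "holo_on {z. Complex (fst z) (snd z) \<in> S}
    (\<lambda>z. (Re (k (Complex (fst z) (snd z))), Im (k (Complex (fst z) (snd z)))))"
proof (rule holo_onI)
  let ?\<phi> = "\<lambda>z. Complex (fst z) (snd z)"
  let ?d = "\<lambda>z v. deriv k (?\<phi> z) * ?\<phi> v"
  have \<phi>: "bounded_linear ?\<phi>"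
    unfolding Complex_eq
    by (intro bounded_linear_add bounded_linear_compose[OF bounded_linear_of_real]
        bounded_linear_const_mult bounded_linear_fst bounded_linear_snd)
  have cont: "continuous_on A ?\<phi>" for A
    using \<phi> by (rule linear_continuous_on)
  show "open {z. ?\<phi> z \<in> S}"
    using open_vimage[OF assms(1) cont[of UNIV]] by (simp add: vimage_def)
  show "((\<lambda>z. (Re (k (?\<phi> z)), Im (k (?\<phi> z)))) has_derivative (\<lambda>v. (Re (?d z v), Im (?d z v)))) (at z)"
    if "z \<in> {z. ?\<phi> z \<in> S}" for z
  proof -
    have "(k has_derivative (*) (deriv k (?\<phi> z))) (at (?\<phi> z))"
      using holomorphic_derivI[OF assms(2,1)] that by (simp add: has_field_derivative_def)
    from diff_chain_at[OF bounded_linear_imp_has_derivative[OF \<phi>] this]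
    have "((\<lambda>z. k (?\<phi> z)) has_derivative ?d z) (at z)"
      by (simp add: o_def)
    then show ?thesis
      by (intro has_derivative_Pair bounded_linear.has_derivative[OF bounded_linear_Re]
          bounded_linear.has_derivative[OF bounded_linear_Im])
  qed
  have "continuous_on S (deriv k)"
    using assms by (intro holomorphic_on_imp_continuous_on holomorphic_deriv)
  then have "continuous_on {z. ?\<phi> z \<in> S} (\<lambda>z. deriv k (?\<phi> z))"
    by (rule continuous_on_compose2[OF _ cont]) auto
  then show "continuous_on {z. ?\<phi> z \<in> S} (\<lambda>z. (Re (?d z v), Im (?d z v)))" for v
    by (intro continuous_intros)
  show "(Re (?d z (imult v)), Im (?d z (imult v))) = imult (Re (?d z v), Im (?d z v))" for z v
    by (simp add: imult_def algebra_simps)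
qed

lemma holo_ext_at_power2: "holo_ext_at (\<lambda>x::real. x\<^sup>2) a"
  unfolding holo_ext_at_def
  using holo_on_of_complex[of UNIV "\<lambda>z. z\<^sup>2"]
  by (intro exI[of _ UNIV] exI[of _ "\<lambda>z. (Re ((Complex (fst z) (snd z))\<^sup>2), Im ((Complex (fst z) (snd z))\<^sup>2))"])
    (auto simp: holomorphic_intros power2_eq_square)

lemma holo_ext_at_inverse:
  assumes "a \<noteq> (0::real)"
  shows "holo_ext_at inverse a"
proof -
  let ?\<phi> = "\<lambda>z. Complex (fst z) (snd z)"
  have "open (?\<phi> -` (- {0}))"
    unfolding Complex_eq by (intro open_vimage continuous_intros open_Compl closed_singleton)
  then have "open {z. ?\<phi> z \<in> - {0}}" by (simp add: vimage_def)
  moreover have "holo_on {z. ?\<phi> z \<in> - {0}} (\<lambda>z. (Re (inverse (?\<phi> z)), Im (inverse (?\<phi> z))))"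
    by (rule holo_on_of_complex) (auto intro!: holomorphic_intros)
  moreover have "inverse (Complex x 0) = Complex (inverse x) 0" for x by (simp add: Complex_eq)
  ultimately show ?thesis
    unfolding holo_ext_at_def using assms
    by (intro exI[of _ "{z. ?\<phi> z \<in> - {0}}"] exI[of _ "\<lambda>z. (Re (inverse (?\<phi> z)), Im (inverse (?\<phi> z)))"])
      (auto simp del: inverse_eq_divide simp: Complex_eq_0)
qed

text \<open>Polarization: f g = ((f + g)^2 - (f - g)^2) / 4, which reduces products to sums and to
  composition with the square.\<close>

lemma holo_ext_at_mult:
  fixes f g :: "'e::euclidean_space \<Rightarrow> real"
  assumes "holo_ext_at f a" "holo_ext_at g a"
  shows "holo_ext_at (\<lambda>x. f x * g x) a"
proof -
  have sq: "holo_ext_at (\<lambda>x. (h x)\<^sup>2) a" if "holo_ext_at h a" for h :: "'e \<Rightarrow> real"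
    by (rule holo_ext_at_compose[OF that holo_ext_at_power2])
  have lin: "holo_ext_at (\<lambda>x. c * h x) a" if "holo_ext_at h a" for h :: "'e \<Rightarrow> real" and c
    by (rule holo_ext_at_linear_compose[OF bounded_linear_mult_right that])
  have "holo_ext_at (\<lambda>x. (1/4) * (f x + g x)\<^sup>2 + (-1/4) * (f x + (-1) * g x)\<^sup>2) a"
    by (intro holo_ext_at_add lin sq assms)
  then show ?thesis by (simp add: power2_eq_square algebra_simps)
qed

text \<open>At a real point the derivative of the extension F is the complexification of the
  derivative of f, hence bijective, so F has a local C^1 inverse G. Inverses of complex linear maps
  are complex linear, so G is holomorphic; and F sends (g y, 0) to (y, 0), so G extends g.\<close>

lemma holo_ext_at_inverse_function:
  fixes f :: "'e::euclidean_space \<Rightarrow> 'e"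
  assumes "holo_ext_at f b" "bij (frechet_derivative f (at b))" "f differentiable (at b)"
    and hom: "open U" "open V" "homeomorphism U V f g" "b \<in> U"
  shows "holo_ext_at g (f b)"
proof -
  obtain W F where W: "open W" "(b, 0) \<in> W" "holo_on W F" "\<And>x. (x, 0) \<in> W \<Longrightarrow> F (x, 0) = (f x, 0)"
    using assms(1) unfolding holo_ext_at_def by blast
  let ?D = "\<lambda>z. frechet_derivative F (at z)" and ?A = "frechet_derivative f (at b)"
  have FD: "(F has_derivative ?D z) (at z)" if "z \<in> W" for z
    by (rule holo_on_has_derivative[OF W(3) that])
  have Fi: "?D z (imult v) = imult (?D z v)" if "z \<in> W" for z v
    using holo_on_imult[OF W(3) that] .
  \<comment> \<open>Real directions: differentiate the identity F (x, 0) = (f x, 0).\<close>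
  have fst: "?D (b, 0) (v, 0) = (?A v, 0)" for v
  proof -
    have emb: "((\<lambda>x. (x, 0 :: 'e)) has_derivative (\<lambda>v. (v, 0))) (at b)"
      by (intro has_derivative_Pair has_derivative_ident has_derivative_const)
    have "((\<lambda>x. F (x, 0)) has_derivative (\<lambda>v. ?D (b, 0) (v, 0))) (at b)"
      using diff_chain_at[OF emb FD[OF W(2)]] by (simp add: o_def)
    moreover have "((\<lambda>x. F (x, 0)) has_derivative (\<lambda>v. (?A v, 0))) (at b)"
    proof (rule has_derivative_transform_within_open)
      show "((\<lambda>x. (f x, 0 :: 'e)) has_derivative (\<lambda>v. (?A v, 0))) (at b)"
        by (intro has_derivative_Pair has_derivative_frechet[OF assms(3)] has_derivative_const)
      show "open ((\<lambda>x. (x, 0)) -` W)" by (intro open_vimage W(1) continuous_intros)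
    qed (use W(2,4) in auto)
    ultimately show ?thesis using has_derivative_unique by (metis (no_types))
  qed
  have lin: "linear (?D (b, 0))" using FD[OF W(2)] by (rule has_derivative_linear)
  \<comment> \<open>Imaginary directions follow from complex linearity.\<close>
  have D: "?D (b, 0) z = (?A (fst z), ?A (snd z))" for z
  proof -
    have "?D (b, 0) z = ?D (b, 0) (fst z, 0) + ?D (b, 0) (imult (snd z, 0))"
      by (simp add: linear_add[OF lin, symmetric] imult_def)
    also have "\<dots> = (?A (fst z), 0) + imult (?A (snd z), 0)"
      by (simp only: Fi[OF W(2)] fst)
    finally show ?thesis by (simp add: imult_def)
  qed
  have "?D (b, 0) = map_prod ?A ?A" by (rule ext) (simp add: D map_prod_def case_prod_unfold)
  then have "bij (?D (b, 0))" using bij_betw_map_prod[OF assms(2,2)] by simp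
  moreover have "Ck_on (Suc 0) W F" using W(3) by (simp only: holo_on_def)
  ultimately obtain U' V' G where G: "open U'" "U' \<subseteq> W" "(b, 0) \<in> U'" "open V'" "F (b, 0) \<in> V'"
    "homeomorphism U' V' F G" "Ck_on (Suc 0) V' G"
    "\<And>y. y \<in> V' \<Longrightarrow> (G has_derivative inv (?D (G y))) (at y)" "\<And>y. y \<in> V' \<Longrightarrow> bij (?D (G y))"
    using Ck_inverse_function[OF W(1) _ W(2)] by (metis (no_types))
  have GW: "G y \<in> W" if "y \<in> V'" for y using that G(2,6) unfolding homeomorphism_def by blast
  have "frechet_derivative G (at y) (imult v) = imult (frechet_derivative G (at y) v)" if y: "y \<in> V'" for y v
  proof -
    have "?D (G y) (imult (inv (?D (G y)) v)) = imult v"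
      using G(9)[OF y] by (simp add: Fi[OF GW[OF y]] bij_is_surj surj_f_inv_f)
    then have "inv (?D (G y)) (imult v) = imult (inv (?D (G y)) v)"
      using bij_is_inj[OF G(9)[OF y]] by (metis inv_f_f)
    then show ?thesis by (simp add: frechet_derivativeI[OF G(8)[OF y]])
  qed
  then have holo: "holo_on V' G" using G(7) unfolding holo_on_def by blast
  have fV: "f b \<in> V" using hom unfolding homeomorphism_def by blast
  have g_cont: "continuous_on V g" using hom(3) by (simp add: homeomorphism_def)
  have gfb: "g (f b) = b" using hom by (simp add: homeomorphism_def)
  \<comment> \<open>G inverts F only on U', so y is restricted to those points for which (g y, 0)
    lies there.\<close>
  let ?V = "V \<inter> (\<lambda>y. (g y, 0)) -` U'"
  have "open ?V"
    using continuous_open_preimage[of V "\<lambda>y. (g y, 0)" U'] hom(2) G(1) g_cont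
    by (simp add: continuous_on_Pair)
  then have op: "open (V' \<inter> ?V \<times> UNIV)" by (rule open_Int[OF G(4) open_Times[OF _ open_UNIV]])
  have "G (y, 0) = (g y, 0)" if "(y, 0) \<in> V' \<inter> ?V \<times> UNIV" for y
  proof -
    have y: "y \<in> V" "(g y, 0) \<in> U'" using that by auto
    then have "F (g y, 0) = (y, 0)"
      using W(4)[of "g y"] G(2) hom(3) by (auto simp: homeomorphism_def)
    then show ?thesis using G(6) y(2) by (metis homeomorphism_def)
  qed
  moreover have "(f b, 0) \<in> V' \<inter> ?V \<times> UNIV"
    using G(3,5) W(2,4) fV gfb by auto
  ultimately show ?thesis
    unfolding holo_ext_at_def using op holo_on_subset[OF holo, of "V' \<inter> ?V \<times> UNIV"]
    by (intro exI[of _ "V' \<inter> ?V \<times> UNIV"] exI[of _ G]) auto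
qed

text \<open>Substitute complex coordinates into the series. Unordered convergence is absolute, so
  convergence at the single corner point a + (\<delta>, ..., \<delta>) dominates the terms on a
  whole complex polydisc; on half that radius the termwise derivatives are dominated as well, and
  differentiation under the sum gives a C^1 function with complex linear derivative.\<close>

lemma power_series_imp_holo_ext_at:
  fixes f :: "'e::euclidean_space \<Rightarrow> real"
  assumes "\<rho> > 0"
    and f: "\<And>x. x \<in> ball a \<rho> \<Longrightarrow>
      ((\<lambda>k. (\<Prod>b\<in>Basis. ((x - a) \<bullet> b) ^ k b) *\<^sub>R coef k) has_sum f x) (Basis \<rightarrow>\<^sub>E UNIV)"
  shows "holo_ext_at f a"
proof -
  let ?I = "Basis \<rightarrow>\<^sub>E UNIV :: ('e \<Rightarrow> nat) set"
  \<comment> \<open>The corner point is at distance at most DIM \<delta> from a, which must stay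
    below \<rho>.\<close>
  define \<delta> where "\<delta> = \<rho> / (real DIM('e) + 1)"
  have \<delta>: "\<delta> > 0" "\<delta> * real DIM('e) < \<rho>" "\<delta> \<le> \<rho>"
    using assms(1) by (auto simp: \<delta>_def field_simps)
  define M where "M k = \<delta> ^ (\<Sum>b\<in>Basis. k b) * \<bar>coef k\<bar>" for k :: "'e \<Rightarrow> nat"
  have M_summable: "M summable_on ?I"
  proof -
    let ?x = "a + (\<Sum>b\<in>Basis. \<delta> *\<^sub>R b)"
    have "norm (\<Sum>b\<in>Basis. \<delta> *\<^sub>R b :: 'e) \<le> (\<Sum>b\<in>(Basis::'e set). \<delta>)"
      using \<delta>(1) by (intro sum_norm_le) auto
    then have "?x \<in> ball a \<rho>" using \<delta>(2) by (simp add: dist_norm mult.commute)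
    moreover have "(?x - a) \<bullet> b = \<delta>" if "b \<in> Basis" for b
      using that by (simp add: inner_sum_left inner_Basis if_distrib sum.delta cong: if_cong)
    ultimately have "((\<lambda>k. \<delta> ^ (\<Sum>b\<in>Basis. k b) * coef k) has_sum f ?x) ?I"
      using f[of ?x] by (simp add: power_sum cong: has_sum_cong prod.cong)
    then have "(\<lambda>k. norm (\<delta> ^ (\<Sum>b\<in>Basis. k b) * coef k)) summable_on ?I"
      using has_sum_imp_summable summable_on_iff_abs_summable_on_real by fast
    moreover have "norm (\<delta> ^ (\<Sum>b\<in>Basis. k b) * coef k) = M k" for k
      using \<delta>(1) by (simp add: M_def abs_mult)
    ultimately show ?thesis by simp
  qed
  have "countable ?I" by (intro countable_PiE) auto
  \<comment> \<open>Needed to enumerate the multi-indices by the natural numbers without repetition;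
    the theorems on termwise differentiation are about sequences.\<close>
  moreover have "infinite ?I"
  proof -
    obtain b0 :: 'e where "b0 \<in> Basis" using nonempty_Basis by blast
    then have "inj (\<lambda>n::nat. \<lambda>b\<in>(Basis::'e set). n)"
      by (intro injI) (metis restrict_apply')
    then show ?thesis
      using infinite_iff_countable_subset[of ?I] by (fastforce simp: image_subset_iff)
  qed
  ultimately have e: "bij_betw (from_nat_into ?I) UNIV ?I" by (rule bij_betw_from_nat_into)
  define e where "e = from_nat_into ?I"
  have MS: "summable (\<lambda>n. M (e n))"
    using M_summable summable_on_reindex_bij_betw[OF e, of M]
    by (simp add: e_def summable_on_imp_summable)
  \<comment> \<open>The complex coordinate centred at a in direction b, and its linear part.\<close>
  define \<zeta> where "\<zeta> b z = Complex ((fst z - a) \<bullet> b) (snd z \<bullet> b)" for b and z :: "'e \<times> 'e"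
  define L where "L b v = Complex (fst v \<bullet> b) (snd v \<bullet> b)" for b and v :: "'e \<times> 'e"
  define t where "t k z = (\<Prod>b\<in>Basis. \<zeta> b z ^ k b) * complex_of_real (coef k)" for k z
  define t' where "t' k z v = (\<Sum>b\<in>Basis. of_nat (k b) * L b v * \<zeta> b z ^ (k b - 1) *
    (\<Prod>b'\<in>Basis - {b}. \<zeta> b' z ^ k b')) * complex_of_real (coef k)" for k z v
  \<comment> \<open>Half the radius absorbs the exponent produced by differentiation: by n \<le> 2^n
    one gets n (\<delta>/2)^(n-1) \<le> (2/\<delta>) \<delta>^n.\<close>
  define W where "W = ball (a, 0 :: 'e) (\<delta> / 2)"
  have L: "bounded_linear (L b)" for b
    unfolding L_def Complex_eq
    by (intro bounded_linear_add bounded_linear_compose[OF bounded_linear_of_real]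
        bounded_linear_const_mult bounded_linear_compose[OF bounded_linear_inner_left]
        bounded_linear_fst bounded_linear_snd)
  have \<zeta>L: "\<zeta> b = (\<lambda>z. L b z - Complex (a \<bullet> b) 0)" for b
    by (rule ext) (simp add: \<zeta>_def L_def complex_eq_iff inner_diff_left)
  have \<zeta>_der: "(\<zeta> b has_derivative L b) (at z)" for b z
    unfolding \<zeta>L using has_derivative_diff[OF bounded_linear_imp_has_derivative[OF L] has_derivative_const]
    by fastforce
  have \<zeta>_cont: "continuous_on A (\<zeta> b)" for A b
    unfolding \<zeta>L by (intro continuous_intros linear_continuous_on L)
  have t_der: "(t k has_derivative t' k z) (at z)" for k z
  proof -
    have "((\<lambda>z. \<zeta> b z ^ k b) has_derivative (\<lambda>v. of_nat (k b) * L b v * \<zeta> b z ^ (k b - 1))) (at z)" for b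
      by (rule has_derivative_power[OF \<zeta>_der])
    from has_derivative_mult_left[OF has_derivative_prod[of Basis "\<lambda>b z. \<zeta> b z ^ k b", OF this]]
    show ?thesis unfolding t_def t'_def .
  qed
  have t'_cont: "continuous_on A (\<lambda>z. t' k z v)" for A k v
    unfolding t'_def by (intro continuous_intros \<zeta>_cont)
  have norm_L: "norm (L b v) \<le> norm v" if "b \<in> Basis" for b v
  proof -
    have "(norm (L b v))\<^sup>2 = (fst v \<bullet> b)\<^sup>2 + (snd v \<bullet> b)\<^sup>2" by (simp add: L_def cmod_power2)
    also have "\<dots> \<le> (norm (fst v))\<^sup>2 + (norm (snd v))\<^sup>2"
      using Basis_le_norm[OF that] by (intro add_mono) (auto simp: abs_le_square_iff[symmetric])
    also have "\<dots> = (norm v)\<^sup>2" by (simp add: norm_prod_def)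
    finally show ?thesis by (rule power2_le_imp_le) simp
  qed
  have norm_\<zeta>: "norm (\<zeta> b z) \<le> \<delta> / 2" if "b \<in> Basis" "z \<in> W" for b z
  proof -
    have "\<zeta> b z = L b (z - (a, 0))" by (simp add: \<zeta>_def L_def)
    then show ?thesis
      using norm_L[OF that(1), of "z - (a, 0)"] that(2) by (simp add: W_def dist_norm norm_minus_commute)
  qed
  have pow: "norm (\<zeta> b z) ^ n \<le> \<delta> ^ n" if "b \<in> Basis" "z \<in> W" for b z n
    using norm_\<zeta>[OF that] \<delta>(1) by (intro power_mono) auto
  have t_bound: "norm (t k z) \<le> M k" if z: "z \<in> W" for k z
  proof -
    have "(\<Prod>b\<in>Basis. norm (\<zeta> b z) ^ k b) \<le> (\<Prod>b\<in>Basis. \<delta> ^ k b)"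
      using z by (intro prod_mono) (simp add: pow)
    then show ?thesis
      by (simp add: t_def M_def norm_mult prod_norm[symmetric] norm_power power_sum mult_right_mono)
  qed
  have t'_bound: "norm (t' k z v) \<le> real DIM('e) * 2 / \<delta> * M k * norm v" if z: "z \<in> W" for k z v
  proof -
    have term_bound: "norm (of_nat (k b) * L b v * \<zeta> b z ^ (k b - 1) * (\<Prod>b'\<in>Basis - {b}. \<zeta> b' z ^ k b'))
        \<le> norm v * (2 / \<delta>) * \<delta> ^ (\<Sum>b\<in>Basis. k b)" if b: "b \<in> Basis" for b
    proof -
      have "real (k b) * norm (\<zeta> b z) ^ (k b - 1) \<le> (2 / \<delta>) * \<delta> ^ k b"
      proof (cases "k b")
        case 0
        then show ?thesis using \<delta>(1) by simp
      next
        case (Suc n)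
        have "real (Suc n) \<le> 2 ^ Suc n"
          using less_exp[of "Suc n"] by (metis less_imp_le of_nat_le_iff of_nat_numeral of_nat_power)
        then have "real (Suc n) * norm (\<zeta> b z) ^ n \<le> 2 ^ Suc n * (\<delta> / 2) ^ n"
          using norm_\<zeta>[OF b z] by (intro mult_mono power_mono) auto
        also have "\<dots> = (2 / \<delta>) * \<delta> ^ Suc n" using \<delta>(1) by (simp add: power_divide)
        finally show ?thesis using Suc by simp
      qed
      moreover have "(\<Prod>b'\<in>Basis - {b}. norm (\<zeta> b' z) ^ k b') \<le> (\<Prod>b'\<in>Basis - {b}. \<delta> ^ k b')"
        using z by (intro prod_mono) (simp add: pow)
      ultimately have "(real (k b) * norm (\<zeta> b z) ^ (k b - 1)) * (\<Prod>b'\<in>Basis - {b}. norm (\<zeta> b' z) ^ k b')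
          \<le> ((2 / \<delta>) * \<delta> ^ k b) * (\<Prod>b'\<in>Basis - {b}. \<delta> ^ k b')"
        by (rule mult_mono) (use \<delta>(1) in \<open>auto intro: prod_nonneg\<close>)
      also have "\<dots> = (2 / \<delta>) * \<delta> ^ (\<Sum>b\<in>Basis. k b)"
        using b by (simp add: power_sum prod.remove[of Basis b])
      finally have "norm (L b v) * ((real (k b) * norm (\<zeta> b z) ^ (k b - 1)) * (\<Prod>b'\<in>Basis - {b}. norm (\<zeta> b' z) ^ k b'))
          \<le> norm v * ((2 / \<delta>) * \<delta> ^ (\<Sum>b\<in>Basis. k b))"
        by (rule mult_mono[OF norm_L[OF b]]) (auto intro!: mult_nonneg_nonneg prod_nonneg)
      then show ?thesis
        by (simp add: norm_mult prod_norm[symmetric] norm_power ac_simps)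
    qed
    have "norm (t' k z v) \<le> (\<Sum>b\<in>(Basis::'e set). norm v * (2 / \<delta>) * \<delta> ^ (\<Sum>b\<in>Basis. k b)) * \<bar>coef k\<bar>"
      unfolding t'_def norm_mult norm_of_real by (intro mult_right_mono sum_norm_le term_bound) auto
    then show ?thesis by (simp add: M_def ac_simps)
  qed
  define C where "C = real DIM('e) * 2 / \<delta>"
  have t'_bound: "norm (t' k z v) \<le> C * M k * norm v" if "z \<in> W" for k z v
    using t'_bound[OF that] by (simp add: C_def)
  have C: "C \<ge> 0" using \<delta>(1) by (simp add: C_def)
  have SC: "summable (\<lambda>n. C * M (e n) * x)" for x by (intro summable_mult2 summable_mult MS)
  have t'_summable: "summable (\<lambda>n. t' (e n) z v)" if "z \<in> W" for z v
    by (rule summable_comparison_test'[OF SC t'_bound[OF that]])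
  have t_summable: "summable (\<lambda>n. t (e n) z)" if "z \<in> W" for z
    by (rule summable_comparison_test'[OF MS t_bound[OF that]])
  define g' where "g' z v = (\<Sum>n. t' (e n) z v)" for z v
  have W: "open W" "convex W" "(a, 0) \<in> W" using \<delta>(1) by (auto simp: W_def)
  have unif: "\<forall>\<^sub>F n in sequentially. \<forall>z\<in>W. \<forall>v. norm ((\<Sum>i<n. t' (e i) z v) - g' z v) \<le> \<epsilon> * norm v"
    if "\<epsilon> > 0" for \<epsilon>
  proof -
    have "(\<lambda>n. \<Sum>i. C * M (e (i + n)) * 1) \<longlonglongrightarrow> 0" using suminf_exist_split2[OF SC] .
    then have "\<forall>\<^sub>F n in sequentially. (\<Sum>i. C * M (e (i + n)) * 1) < \<epsilon>"
      using that by (rule order_tendstoD)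
    then show ?thesis
    proof eventually_elim
      case (elim n)
      show ?case
      proof (intro ballI allI)
        fix z v assume z: "z \<in> W"
        have SCn: "summable (\<lambda>i. C * M (e (i + n)) * x)" for x
          using SC[of x] by (rule summable_ignore_initial_segment)
        have "norm ((\<Sum>i<n. t' (e i) z v) - g' z v) = norm (\<Sum>i. t' (e (i + n)) z v)"
          unfolding g'_def
          by (simp add: suminf_split_initial_segment[OF t'_summable[OF z], where k = n])
        also have "\<dots> \<le> (\<Sum>i. C * M (e (i + n)) * norm v)"
          by (rule norm_suminf_le[OF t'_bound[OF z] SCn])
        also have "\<dots> = (\<Sum>i. C * M (e (i + n)) * 1) * norm v"
          using suminf_mult2[OF SCn[of 1], of "norm v"] by simp
        also have "\<dots> \<le> \<epsilon> * norm v" using elim by (intro mult_right_mono) auto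
        finally show "norm ((\<Sum>i<n. t' (e i) z v) - g' z v) \<le> \<epsilon> * norm v" .
      qed
    qed
  qed
  have "\<exists>g. \<forall>z\<in>W. (\<lambda>n. t (e n) z) sums g z \<and> (g has_derivative g' z) (at z within W)"
    by (rule has_derivative_series[OF W(2) has_derivative_at_withinI[OF t_der] unif W(3)
          summable_sums[OF t_summable[OF W(3)]]])
  then obtain g where g: "\<And>z. z \<in> W \<Longrightarrow> (\<lambda>n. t (e n) z) sums g z"
    "\<And>z. z \<in> W \<Longrightarrow> (g has_derivative g' z) (at z)"
    using at_within_open[OF _ W(1)] by metis
  have g'_cont: "continuous_on W (\<lambda>z. g' z v)" for v
  proof (rule uniform_limit_theorem)
    show "uniform_limit W (\<lambda>n z. \<Sum>i<n. t' (e i) z v) (\<lambda>z. g' z v) sequentially"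
      unfolding g'_def by (rule Weierstrass_m_test[OF t'_bound SC])
    show "\<forall>\<^sub>F n in sequentially. continuous_on W (\<lambda>z. \<Sum>i<n. t' (e i) z v)"
      by (intro always_eventually allI continuous_on_sum t'_cont)
  qed simp
  \<comment> \<open>Every summand of t' contains exactly one factor L applied to v, and L is complex
    linear.\<close>
  have g'_imult: "g' z (imult v) = \<i> * g' z v" if "z \<in> W" for z v
  proof -
    have "L b (imult v) = \<i> * L b v" for b by (simp add: L_def imult_def complex_eq_iff)
    then have "t' k z (imult v) = \<i> * t' k z v" for k
      by (simp add: t'_def sum_distrib_left ac_simps)
    then show ?thesis
      unfolding g'_def by (simp add: suminf_mult[OF t'_summable[OF that]])
  qed
  have "holo_on W (\<lambda>z. (Re (g z), Im (g z)))"
  proof (rule holo_onI[OF W(1)])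
    show "((\<lambda>z. (Re (g z), Im (g z))) has_derivative (\<lambda>v. (Re (g' z v), Im (g' z v)))) (at z)"
      if "z \<in> W" for z
      by (intro has_derivative_Pair bounded_linear.has_derivative[OF bounded_linear_Re]
          bounded_linear.has_derivative[OF bounded_linear_Im] g(2)[OF that])
    show "continuous_on W (\<lambda>z. (Re (g' z v), Im (g' z v)))" for v
      by (intro continuous_intros g'_cont)
    show "(Re (g' z (imult v)), Im (g' z (imult v))) = imult (Re (g' z v), Im (g' z v))" if "z \<in> W" for z v
      unfolding g'_imult[OF that] by (simp add: imult_def)
  qed
  moreover have g_real: "g (x, 0) = complex_of_real (f x)" if "(x, 0) \<in> W" for x
  proof -
    have "x \<in> ball a \<rho>" using that \<delta> by (simp add: W_def dist_Pair_Pair)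
    then have "((\<lambda>n. (\<Prod>b\<in>Basis. ((x - a) \<bullet> b) ^ e n b) *\<^sub>R coef (e n)) has_sum f x) UNIV"
      unfolding e_def by (rule has_sum_reindex_bij_betw[OF e, THEN iffD2, OF f])
    then have "(\<lambda>n. complex_of_real ((\<Prod>b\<in>Basis. ((x - a) \<bullet> b) ^ e n b) *\<^sub>R coef (e n))) sums of_real (f x)"
      by (intro sums_of_real has_sum_imp_sums)
    moreover have "complex_of_real ((\<Prod>b\<in>Basis. ((x - a) \<bullet> b) ^ k b) *\<^sub>R coef k) = t k (x, 0)" for k
      by (simp add: t_def \<zeta>_def complex_of_real_def[symmetric])
    ultimately show ?thesis using g(1)[OF that] sums_unique2 by simp
  qed
  ultimately show ?thesis
    unfolding holo_ext_at_def
    by (intro exI[of _ W] exI[of _ "\<lambda>z. (Re (g z), Im (g z))"] conjI allI impI W(1,3)) (simp_all add: g_real)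
qed

text \<open>Read in complex coordinates, the extension is bounded and separately holomorphic on a
  small polydisc, so it has a power series there. At real points its values are real, and the real
  parts of the coefficients represent f.\<close>

lemma holo_ext_at_imp_power_series:
  fixes f :: "'e::euclidean_space \<Rightarrow> real"
  assumes "holo_ext_at f a"
  shows "\<exists>\<rho>>0. \<exists>coef. \<forall>x\<in>ball a \<rho>.
    ((\<lambda>k. (\<Prod>b\<in>Basis. ((x - a) \<bullet> b) ^ k b) *\<^sub>R coef k) has_sum f x) (Basis \<rightarrow>\<^sub>E UNIV)"
proof -
  obtain W g where W: "open W" "(a, 0) \<in> W" "holo_on W g" "\<And>x. (x, 0) \<in> W \<Longrightarrow> g (x, 0) = (f x, 0)"
    using assms unfolding holo_ext_at_def by blast
  obtain \<epsilon> where \<epsilon>: "\<epsilon> > 0" "cball (a, 0) \<epsilon> \<subseteq> W"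
    using W(1,2) open_contains_cball by blast
  \<comment> \<open>Real and imaginary parts of a point of the polydisc each have norm at most DIM
    R, so Z maps the polydisc into the ball of radius \<epsilon>.\<close>
  define R where "R = \<epsilon> / (2 * real DIM('e))"
  have R: "R > 0" "2 * real DIM('e) * R = \<epsilon>" using \<epsilon>(1) by (auto simp: R_def)
  define Z where "Z w = (a + (\<Sum>b\<in>Basis. Re (w b) *\<^sub>R b), (\<Sum>b\<in>Basis. Im (w b) *\<^sub>R b))"
    for w :: "'e \<Rightarrow> complex"
  have Z: "Z w \<in> cball (a, 0) \<epsilon>" if "\<And>b. b \<in> Basis \<Longrightarrow> norm (w b) < R" for w
  proof -
    have "norm (\<Sum>b\<in>Basis. Re (w b) *\<^sub>R b) \<le> (\<Sum>b\<in>(Basis::'e set). R)"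
      using that by (intro sum_norm_le) (auto intro: order_trans[OF abs_Re_le_cmod] less_imp_le)
    moreover have "norm (\<Sum>b\<in>Basis. Im (w b) *\<^sub>R b) \<le> (\<Sum>b\<in>(Basis::'e set). R)"
      using that by (intro sum_norm_le) (auto intro: order_trans[OF abs_Im_le_cmod] less_imp_le)
    moreover have "dist (a, 0) (Z w) \<le> norm (\<Sum>b\<in>Basis. Re (w b) *\<^sub>R b) + norm (\<Sum>b\<in>Basis. Im (w b) *\<^sub>R b)"
      using sqrt_sum_squares_le_sum[of "norm (\<Sum>b\<in>Basis. Re (w b) *\<^sub>R b)" "norm (\<Sum>b\<in>Basis. Im (w b) *\<^sub>R b)"]
      by (simp add: Z_def dist_norm norm_Pair)
    ultimately show ?thesis using R by (simp add: mult.commute)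
  qed
  have "compact (g ` cball (a, 0) \<epsilon>)"
    by (rule compact_continuous_image[OF continuous_on_subset[OF holo_on_continuous[OF W(3)] \<epsilon>(2)]
          compact_cball])
  then have "bounded (g ` cball (a, 0) \<epsilon>)" by (rule compact_imp_bounded)
  then obtain K where K: "\<And>z. z \<in> cball (a, 0) \<epsilon> \<Longrightarrow> norm (g z) \<le> K"
    unfolding bounded_iff by blast
  define G where "G w = Complex (fst (g (Z w))) (snd (g (Z w)))" for w
  have "norm (G w) \<le> K" if "\<And>b. b \<in> Basis \<Longrightarrow> norm (w b) < R" for w
    using K[OF Z[OF that]] by (simp add: G_def cmod_def norm_prod_def)
  moreover have "(\<lambda>s. G (w(b := s))) holomorphic_on ball 0 R"
    if w: "\<And>b. b \<in> Basis \<Longrightarrow> norm (w b) < R" and b: "b \<in> Basis" for w b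
  proof (rule holomorphic_onI)
    fix s :: complex assume "s \<in> ball 0 R"
    then have "Z (w(b := s)) \<in> W" using w \<epsilon>(2) by (intro subsetD[OF \<epsilon>(2) Z]) auto
    let ?D = "frechet_derivative g (at (Z (w(b := s))))"
    have gD: "(g has_derivative ?D) (at (Z (w(b := s))))"
      by (rule holo_on_has_derivative[OF W(3)]) fact
    have aff: "Z (w(b := s)) = Z (w(b := 0)) + (Re s *\<^sub>R b, Im s *\<^sub>R b)" for s
      using b by (simp add: Z_def sum.remove[of Basis b] algebra_simps)
    have aff_fun: "(\<lambda>s. Z (w(b := s))) = (\<lambda>s. Z (w(b := 0)) + (Re s *\<^sub>R b, Im s *\<^sub>R b))"
      by (rule ext, rule aff)
    have "((\<lambda>s. Z (w(b := 0)) + (Re s *\<^sub>R b, Im s *\<^sub>R b)) has_derivative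
        (\<lambda>h. 0 + (Re h *\<^sub>R b, Im h *\<^sub>R b))) (at s)"
      by (intro has_derivative_add has_derivative_const has_derivative_Pair has_derivative_scaleR_left
          bounded_linear.has_derivative[OF bounded_linear_Re has_derivative_ident]
          bounded_linear.has_derivative[OF bounded_linear_Im has_derivative_ident])
    then have "((\<lambda>s. Z (w(b := s))) has_derivative (\<lambda>h. (Re h *\<^sub>R b, Im h *\<^sub>R b))) (at s)"
      unfolding aff_fun add_0_left .
    from diff_chain_at[OF this gD]
    have gZ: "((\<lambda>s. g (Z (w(b := s)))) has_derivative (\<lambda>h. ?D (Re h *\<^sub>R b, Im h *\<^sub>R b))) (at s)"
      by (simp only: o_def)
    \<comment> \<open>The number p + \<i> q is the complex partial derivative in direction b; the
      Cauchy-Riemann equations turn the real derivative into multiplication by it.\<close>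
    define p q where "p = fst (?D (b, 0))" and "q = snd (?D (b, 0))"
    have lin: "linear ?D" using gD by (rule has_derivative_linear)
    have D: "?D (Re h *\<^sub>R b, Im h *\<^sub>R b) = (Re h * p - Im h * q, Re h * q + Im h * p)" for h
    proof -
      have "?D (imult (b, 0)) = imult (?D (b, 0))"
        using W(3) \<open>Z (w(b := s)) \<in> W\<close> by (simp add: holo_on_def)
      then have "?D (0, b) = (- q, p)" by (simp add: imult_def p_def q_def)
      moreover have "?D (b, 0) = (p, q)" by (simp add: p_def q_def)
      moreover have "(Re h *\<^sub>R b, Im h *\<^sub>R b) = Re h *\<^sub>R (b, 0) + Im h *\<^sub>R (0, b)" by simp
      ultimately show ?thesis by (simp only: linear_add[OF lin] linear_scale[OF lin]) simp
    qed
    have "((\<lambda>s. of_real (fst (g (Z (w(b := s))))) + \<i> * of_real (snd (g (Z (w(b := s)))))) has_derivative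
        (\<lambda>h. of_real (fst (?D (Re h *\<^sub>R b, Im h *\<^sub>R b))) + \<i> * of_real (snd (?D (Re h *\<^sub>R b, Im h *\<^sub>R b))))) (at s)"
      by (intro has_derivative_add has_derivative_mult_right bounded_linear.has_derivative[OF bounded_linear_of_real]
          has_derivative_fst has_derivative_snd gZ)
    moreover have "(\<lambda>h. of_real (fst (?D (Re h *\<^sub>R b, Im h *\<^sub>R b))) + \<i> * of_real (snd (?D (Re h *\<^sub>R b, Im h *\<^sub>R b))))
        = (*) (Complex p q)"
      by (rule ext) (simp add: D complex_eq_iff)
    ultimately have "((\<lambda>s. G (w(b := s))) has_field_derivative Complex p q) (at s)"
      unfolding has_field_derivative_def G_def Complex_eq by simp
    then show "(\<lambda>s. G (w(b := s))) field_differentiable at s within ball 0 R"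
      using field_differentiable_at_within field_differentiable_def by blast
  qed
  ultimately obtain c where c: "\<And>w. \<forall>b\<in>Basis. norm (w b) < R / 2 \<Longrightarrow> \<forall>b. b \<notin> Basis \<longrightarrow> w b = 0 \<Longrightarrow>
      ((\<lambda>k. (\<Prod>b\<in>Basis. w b ^ k b) * c k) has_sum G w) (Basis \<rightarrow>\<^sub>E UNIV)"
    using separately_holomorphic_has_power_series[of Basis "R / 2" R G K] R(1) by auto
  have "((\<lambda>k. (\<Prod>b\<in>Basis. ((x - a) \<bullet> b) ^ k b) *\<^sub>R Re (c k)) has_sum f x) (Basis \<rightarrow>\<^sub>E UNIV)"
    if x: "x \<in> ball a (R / 2)" for x
  proof -
    \<comment> \<open>The real coordinates of x - a, extended by 0 off the basis as the power series
      lemma requires.\<close>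
    define w where "w b = (if b \<in> Basis then complex_of_real ((x - a) \<bullet> b) else 0)" for b
    have small: "norm (w b) < R / 2" if "b \<in> Basis" for b
    proof -
      have "norm (w b) = \<bar>(x - a) \<bullet> b\<bar>" using that by (simp only: w_def if_True norm_of_real real_norm_def)
      then show ?thesis
        using Basis_le_norm[OF that, of "x - a"] x by (simp add: dist_norm norm_minus_commute)
    qed
    have "Z w = (x, 0)"
      by (simp add: Z_def w_def euclidean_representation cong: sum.cong)
    moreover have "(x, 0) \<in> W"
      using Z[of w] small R(1) \<epsilon>(2) calculation by force
    ultimately have "G w = complex_of_real (f x)" using W(4) by (simp add: G_def complex_of_real_def)
    then have "((\<lambda>k. (\<Prod>b\<in>Basis. w b ^ k b) * c k) has_sum complex_of_real (f x)) (Basis \<rightarrow>\<^sub>E UNIV)"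
      using c[of w] small by (simp add: w_def)
    from has_sum_Re[OF this]
    have "((\<lambda>k. Re ((\<Prod>b\<in>Basis. w b ^ k b) * c k)) has_sum f x) (Basis \<rightarrow>\<^sub>E UNIV)" by simp
    moreover have "(\<Prod>b\<in>Basis. w b ^ k b) = complex_of_real (\<Prod>b\<in>Basis. ((x - a) \<bullet> b) ^ k b)" for k
      by (simp add: w_def cong: prod.cong)
    ultimately show ?thesis
      by (simp only: scaleR_conv_of_real[symmetric] scaleR_complex.sel real_scaleR_def)
  qed
  then show ?thesis using R(1) by (intro exI[of _ "R / 2"] conjI exI[of _ "\<lambda>k. Re (c k)"] ballI) auto
qed

lemma has_sum_componentwise:
  fixes f :: "'i \<Rightarrow> 'f::euclidean_space"
  shows "(f has_sum x) A \<longleftrightarrow> (\<forall>b\<in>Basis. ((\<lambda>k. f k \<bullet> b) has_sum (x \<bullet> b)) A)"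
proof -
  have "(\<lambda>F. sum f F \<bullet> b) = sum (\<lambda>k. f k \<bullet> b)" for b
    by (rule ext) (rule inner_sum_left)
  then show ?thesis
    unfolding has_sum_def by (subst tendsto_componentwise_iff) (simp only:)
qed

text \<open>Openness of U comes from the balls in the definition. Vector values are treated
  componentwise, and the finitely many radii of convergence have a positive minimum.\<close>

lemma real_analytic_on_iff:
  fixes f :: "'e::euclidean_space \<Rightarrow> 'f::euclidean_space"
  shows "real_analytic_on U f \<longleftrightarrow> open U \<and> (\<forall>a\<in>U. holo_ext_at f a)"
proof (intro iffI conjI ballI)
  assume f: "real_analytic_on U f"
  show "open U"
    unfolding open_contains_ball using f unfolding real_analytic_on_def by blast
  fix a assume "a \<in> U"
  then obtain \<rho> and coef where \<rho>: "\<rho> > 0" "\<And>x. x \<in> ball a \<rho> \<Longrightarrow>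
      ((\<lambda>k. (\<Prod>b\<in>Basis. ((x - a) \<bullet> b) ^ k b) *\<^sub>R coef k) has_sum f x) (Basis \<rightarrow>\<^sub>E UNIV)"
    using f unfolding real_analytic_on_def by blast
  show "holo_ext_at f a"
  proof (rule holo_ext_at_componentwise)
    fix c :: 'f assume "c \<in> Basis"
    then show "holo_ext_at (\<lambda>x. f x \<bullet> c) a"
      using has_sum_componentwise[THEN iffD1, OF \<rho>(2)]
      by (intro power_series_imp_holo_ext_at[OF \<rho>(1), where coef = "\<lambda>k. coef k \<bullet> c"]) simp
  qed
next
  assume f: "open U \<and> (\<forall>a\<in>U. holo_ext_at f a)"
  show "real_analytic_on U f"
    unfolding real_analytic_on_def
  proof
    fix a assume a: "a \<in> U"
    obtain \<rho>0 where \<rho>0: "\<rho>0 > 0" "ball a \<rho>0 \<subseteq> U" using f a open_contains_ball by blast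
    let ?P = "\<lambda>c \<rho> coef. \<rho> > 0 \<and> (\<forall>x\<in>ball a \<rho>.
      ((\<lambda>k. (\<Prod>b\<in>Basis. ((x - a) \<bullet> b) ^ k b) *\<^sub>R coef k) has_sum (f x \<bullet> c)) (Basis \<rightarrow>\<^sub>E UNIV))"
    have "\<exists>\<rho> coef. ?P c \<rho> coef" for c
      using holo_ext_at_imp_power_series[OF holo_ext_at_linear_compose[OF bounded_linear_inner_left[of c], of f a]]
        f a by blast
    then have "\<forall>c. \<exists>q. ?P c (fst q) (snd q)" by (simp del: fst_conv snd_conv) (simp add: split_paired_Ex)
    from choice[OF this] obtain q where q: "\<forall>c. ?P c (fst (q c)) (snd (q c))" ..
    define \<rho> coef where "\<rho> c = fst (q c)" and "coef c = snd (q c)" for c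
    have P: "?P c (\<rho> c) (coef c)" for c unfolding \<rho>_def coef_def using q ..
    define \<rho>1 where "\<rho>1 = Min (insert \<rho>0 (\<rho> ` Basis))"
    have \<rho>1: "\<rho>1 > 0" "\<rho>1 \<le> \<rho>0" using \<rho>0(1) P by (auto simp: \<rho>1_def)
    have \<rho>1_le: "\<rho>1 \<le> \<rho> c" if "c \<in> Basis" for c unfolding \<rho>1_def using that by (intro Min_le) auto
    have "((\<lambda>k. (\<Prod>b\<in>Basis. ((x - a) \<bullet> b) ^ k b) *\<^sub>R (\<Sum>c\<in>Basis. coef c k *\<^sub>R c)) has_sum f x)
        (Basis \<rightarrow>\<^sub>E UNIV)" if "x \<in> ball a \<rho>1" for x
      unfolding has_sum_componentwise[where x = "f x"]
    proof
      fix c :: 'f assume c: "c \<in> Basis"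
      have "x \<in> ball a (\<rho> c)" using that \<rho>1_le[OF c] by auto
      moreover have "(\<Sum>c\<in>Basis. coef c k *\<^sub>R c) \<bullet> c = coef c k" for k
        by (rule inner_sum_left_Basis[OF c])
      ultimately show "((\<lambda>k. ((\<Prod>b\<in>Basis. ((x - a) \<bullet> b) ^ k b) *\<^sub>R (\<Sum>c\<in>Basis. coef c k *\<^sub>R c)) \<bullet> c)
          has_sum (f x \<bullet> c)) (Basis \<rightarrow>\<^sub>E UNIV)"
        using P[of c] by simp
    qed
    moreover have "ball a \<rho>1 \<subseteq> U" using \<rho>0(2) \<rho>1(2) subset_ball by blast
    ultimately show "\<exists>\<rho>>0. \<exists>coef. ball a \<rho> \<subseteq> U \<and> (\<forall>x\<in>ball a \<rho>.
        ((\<lambda>k. (\<Prod>b\<in>Basis. ((x - a) \<bullet> b) ^ k b) *\<^sub>R coef k) has_sum f x) (Basis \<rightarrow>\<^sub>E UNIV))"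
      using \<rho>1(1) by (intro exI[of _ \<rho>1] conjI exI[of _ "\<lambda>k. \<Sum>c\<in>Basis. coef c k *\<^sub>R c"] ballI) auto
  qed
qed

section \<open>Calculus of functions of class \<open>C\<^sup>r\<close>\<close>

lemma Cr_on_imp_C1:
  fixes f :: "'e::euclidean_space \<Rightarrow> 'f::euclidean_space"
  assumes "Cr_on r U f"
  shows "Ck_on (Suc 0) U f"
proof (cases r)
  case C_infinity
  then show ?thesis using assms by (simp del: Ck_on.simps)
next
  case C_omega
  then have "\<forall>a\<in>U. holo_ext_at f a" using assms by (simp add: real_analytic_on_iff)
  then show ?thesis by (intro Ck_on_local holo_ext_at_imp_Ck) blast
qed

lemma Cr_on_has_derivative:
  fixes f :: "'e::euclidean_space \<Rightarrow> 'f::euclidean_space"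
  assumes "Cr_on r U f" "x \<in> U"
  shows "(f has_derivative frechet_derivative f (at x)) (at x)"
  by (rule Ck_on_has_derivative[OF Cr_on_imp_C1[OF assms(1)] assms(2)])

lemma Cr_on_continuous:
  fixes f :: "'e::euclidean_space \<Rightarrow> 'f::euclidean_space"
  assumes "Cr_on r U f"
  shows "continuous_on U f"
  by (rule Ck_on_imp_continuous[OF Cr_on_imp_C1[OF assms]])

lemma Cr_on_localI:
  fixes f :: "'e::euclidean_space \<Rightarrow> 'f::euclidean_space"
  assumes "open U"
    and "\<And>x. x \<in> U \<Longrightarrow> \<exists>V g. open V \<and> x \<in> V \<and> Cr_on r V g \<and> (\<forall>y\<in>V. g y = f y)"
  shows "Cr_on r U f"
proof (cases r)
  case C_infinity
  have "Ck_on k U f" for k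
  proof (rule Ck_on_local)
    fix x assume "x \<in> U"
    then obtain V g where V: "open V" "x \<in> V" "Ck_on k V g" "\<And>y. y \<in> V \<Longrightarrow> g y = f y"
      using assms(2) C_infinity by (metis Cr_on.simps(1))
    then show "\<exists>V. open V \<and> x \<in> V \<and> Ck_on k V f" using Ck_on_cong[OF V(1,4,3)] by blast
  qed
  then show ?thesis using C_infinity by simp
next
  case C_omega
  have "holo_ext_at f x" if x: "x \<in> U" for x
  proof -
    obtain V g where V: "open V" "x \<in> V" "real_analytic_on V g" "\<And>y. y \<in> V \<Longrightarrow> g y = f y"
      using assms(2)[OF x] unfolding C_omega Cr_on.simps by blast
    then show ?thesis using holo_ext_at_cong[of g x V f] by (simp add: real_analytic_on_iff)
  qed
  then show ?thesis using C_omega assms(1) by (simp add: real_analytic_on_iff)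
qed

lemma Cr_on_cong:
  fixes f :: "'e::euclidean_space \<Rightarrow> 'f::euclidean_space"
  assumes "open U" "\<And>x. x \<in> U \<Longrightarrow> f x = g x" "Cr_on r U f"
  shows "Cr_on r U g"
  by (rule Cr_on_localI[OF assms(1)]) (use assms in blast)

lemma Cr_on_subset:
  fixes f :: "'e::euclidean_space \<Rightarrow> 'f::euclidean_space"
  assumes "Cr_on r U f" "open V" "V \<subseteq> U"
  shows "Cr_on r V f"
  using assms by (cases r) (auto simp: real_analytic_on_iff intro: Ck_on_subset)

text \<open>The values of f may lie in any normed space, which is essential for \<alpha> with values
  in the dual. Holomorphic extensions are defined only for Euclidean targets, so the analytic case
  applies L to the power series itself.\<close>

lemma Cr_on_bounded_linear:
  assumes "open U" "bounded_linear L" "Cr_on r U f"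
  shows "Cr_on r U (\<lambda>x. L (f x))"
proof (cases r)
  case C_infinity
  have "Ck_on k U (\<lambda>x. L (f x))" for k
    by (rule Ck_on_bounded_linear[OF assms(1,2)]) (use assms(3) C_infinity in simp)
  then show ?thesis using C_infinity by simp
next
  case C_omega
  have "\<exists>\<rho>>0. \<exists>coef. ball a \<rho> \<subseteq> U \<and> (\<forall>x\<in>ball a \<rho>.
      ((\<lambda>k. (\<Prod>b\<in>Basis. ((x - a) \<bullet> b) ^ k b) *\<^sub>R coef k) has_sum L (f x)) (Basis \<rightarrow>\<^sub>E UNIV))"
    if a: "a \<in> U" for a
  proof -
    obtain \<rho> coef where \<rho>: "\<rho> > 0" "ball a \<rho> \<subseteq> U" "\<And>x. x \<in> ball a \<rho> \<Longrightarrow>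
        ((\<lambda>k. (\<Prod>b\<in>Basis. ((x - a) \<bullet> b) ^ k b) *\<^sub>R coef k) has_sum f x) (Basis \<rightarrow>\<^sub>E UNIV)"
      using assms(3) a unfolding C_omega Cr_on.simps real_analytic_on_def by blast
    have "((\<lambda>k. (\<Prod>b\<in>Basis. ((x - a) \<bullet> b) ^ k b) *\<^sub>R L (coef k)) has_sum L (f x)) (Basis \<rightarrow>\<^sub>E UNIV)"
      if "x \<in> ball a \<rho>" for x
      using has_sum_bounded_linear[OF assms(2) \<rho>(3)[OF that]]
      by (simp add: linear_scale[OF bounded_linear.linear[OF assms(2)]] o_def)
    then show ?thesis using \<rho>(1,2) by (intro exI[of _ \<rho>] conjI exI[of _ "\<lambda>k. L (coef k)"]) auto
  qed
  then show ?thesis using C_omega by (simp add: real_analytic_on_def)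
qed

lemma Cr_on_linear:
  fixes L :: "'e::euclidean_space \<Rightarrow> 'f::euclidean_space"
  assumes "open U" "bounded_linear L"
  shows "Cr_on r U L"
proof (cases r)
  case C_infinity
  have "Ck_on k U L" for k
    by (rule Ck_on_bounded_linear[OF assms Ck_on_ident[OF assms(1)]])
  then show ?thesis using C_infinity by simp
next
  case C_omega
  then show ?thesis using assms by (simp add: real_analytic_on_iff holo_ext_at_bounded_linear)
qed

lemma Cr_on_const:
  fixes c :: "'f::euclidean_space"
  assumes "open U"
  shows "Cr_on r U (\<lambda>_. c)"
  using assms by (cases r) (simp_all add: real_analytic_on_iff holo_ext_at_const Ck_on_const)

lemma Cr_on_compose:
  fixes f :: "'g::euclidean_space \<Rightarrow> 'f::euclidean_space" and g :: "'e::euclidean_space \<Rightarrow> 'g"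
  assumes "open U" "open V" "Cr_on r V f" "Cr_on r U g" "g ` U \<subseteq> V"
  shows "Cr_on r U (\<lambda>x. f (g x))"
proof (cases r)
  case C_infinity
  have "Ck_on k U (\<lambda>x. f (g x))" for k
    by (rule Ck_on_compose[OF assms(1,2) _ _ assms(5)]) (use assms(3,4) C_infinity in simp_all)
  then show ?thesis using C_infinity by simp
next
  case C_omega
  have "holo_ext_at (\<lambda>x. f (g x)) a" if "a \<in> U" for a
    by (rule holo_ext_at_compose) (use assms(3-5) C_omega that in \<open>auto simp: real_analytic_on_iff\<close>)
  then show ?thesis using C_omega assms(1) by (simp add: real_analytic_on_iff)
qed

lemma Cr_on_Pair:
  fixes f :: "'e::euclidean_space \<Rightarrow> 'f::euclidean_space" and g :: "'e \<Rightarrow> 'g::euclidean_space"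
  assumes "open U" "Cr_on r U f" "Cr_on r U g"
  shows "Cr_on r U (\<lambda>x. (f x, g x))"
  using assms by (cases r) (simp_all add: real_analytic_on_iff holo_ext_at_Pair Ck_on_Pair)

lemma Cr_on_componentwise:
  fixes f :: "'e::euclidean_space \<Rightarrow> 'f::euclidean_space"
  assumes "open U" "\<And>b. b \<in> Basis \<Longrightarrow> Cr_on r U (\<lambda>x. f x \<bullet> b)"
  shows "Cr_on r U f"
proof (cases r)
  case C_infinity
  have "Ck_on k U f" for k
    by (rule Ck_on_componentwise[OF assms(1)]) (use assms(2) C_infinity in simp)
  then show ?thesis using C_infinity by simp
next
  case C_omega
  have "holo_ext_at f a" if "a \<in> U" for a
    by (rule holo_ext_at_componentwise) (use assms(2) C_omega that in \<open>simp add: real_analytic_on_iff\<close>)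
  then show ?thesis using C_omega assms(1) by (simp add: real_analytic_on_iff)
qed

lemma Cr_on_mult:
  fixes f g :: "'e::euclidean_space \<Rightarrow> real"
  assumes "open U" "Cr_on r U f" "Cr_on r U g"
  shows "Cr_on r U (\<lambda>x. f x * g x)"
proof (cases r)
  case C_infinity
  have "Ck_on k U (\<lambda>x. f x *\<^sub>R g x)" for k
    by (rule Ck_on_scaleR[OF assms(1)]) (use assms(2,3) C_infinity in simp_all)
  then show ?thesis using C_infinity by simp
next
  case C_omega
  then show ?thesis using assms by (simp add: real_analytic_on_iff holo_ext_at_mult)
qed

lemma Cr_on_inverse:
  fixes f :: "'e::euclidean_space \<Rightarrow> real"
  assumes "open U" "Cr_on r U f" "\<And>x. x \<in> U \<Longrightarrow> f x \<noteq> 0"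
  shows "Cr_on r U (\<lambda>x. inverse (f x))"
proof (rule Cr_on_compose[OF assms(1) _ _ assms(2)])
  show "Cr_on r (- {0}) (inverse :: real \<Rightarrow> real)"
    by (cases r) (auto simp: real_analytic_on_iff holo_ext_at_inverse Ck_on_inverse)
qed (use assms(3) in auto)

lemma Cr_on_add:
  fixes f g :: "'e::euclidean_space \<Rightarrow> 'f::euclidean_space"
  assumes "open U" "Cr_on r U f" "Cr_on r U g"
  shows "Cr_on r U (\<lambda>x. f x + g x)"
  using assms by (cases r) (simp_all add: real_analytic_on_iff holo_ext_at_add Ck_on_add)

text \<open>In the analytic case the local inverse is again the one of the C^1 theorem; its
  analyticity is checked at each point y, where the derivative of f at g y is still
  bijective.\<close>

lemma Cr_inverse_function_endo:
  fixes f :: "'e::euclidean_space \<Rightarrow> 'e"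
  assumes "open U" "Cr_on r U f" "a \<in> U" "bij (frechet_derivative f (at a))"
  obtains U' V g where "open U'" "U' \<subseteq> U" "a \<in> U'" "open V" "f a \<in> V" "homeomorphism U' V f g"
    "Cr_on r V g"
proof -
  obtain U' V g where g: "open U'" "U' \<subseteq> U" "a \<in> U'" "open V" "f a \<in> V" "homeomorphism U' V f g"
    "\<And>k. Ck_on (Suc k) U f \<Longrightarrow> Ck_on (Suc k) V g"
    "\<And>y. y \<in> V \<Longrightarrow> (g has_derivative inv (frechet_derivative f (at (g y)))) (at y)"
    "\<And>y. y \<in> V \<Longrightarrow> bij (frechet_derivative f (at (g y)))"
    by (rule Ck_inverse_function[OF assms(1) Cr_on_imp_C1[OF assms(2)] assms(3,4)]) (rule that)
  have "Cr_on r V g"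
  proof (cases r)
    case C_infinity
    have "Ck_on k V g" for k
    proof (cases k)
      case 0
      then show ?thesis using g(6) by (simp add: homeomorphism_def)
    next
      case (Suc j)
      show ?thesis unfolding Suc
        by (rule g(7)) (use assms(2) C_infinity in \<open>simp only: Cr_on.simps\<close>)
    qed
    then show ?thesis using C_infinity by simp
  next
    case C_omega
    have "holo_ext_at g y" if y: "y \<in> V" for y
    proof -
      have gy: "g y \<in> U'" "f (g y) = y" using y g(6) by (auto simp: homeomorphism_def)
      have "holo_ext_at g (f (g y))"
      proof (rule holo_ext_at_inverse_function[OF _ g(9)[OF y] _ g(1,4,6) gy(1)])
        show "holo_ext_at f (g y)"
          using assms(2) C_omega gy(1) g(2) by (auto simp: real_analytic_on_iff)
        show "f differentiable at (g y)"
          using Cr_on_has_derivative[OF assms(2)] gy(1) g(2) unfolding differentiable_def by blast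
      qed
      then show ?thesis by (simp only: gy(2))
    qed
    then show ?thesis using C_omega g(4) by (simp add: real_analytic_on_iff)
  qed
  then show thesis using that g(1-6) by blast
qed

text \<open>Source and target may be different types of equal dimension, such as
  \<open>real ^ 'n\<close> and \<open>real \<times> (real ^ 'm)\<close>. Composition with the
  inverse of the derivative reduces to a self-map whose derivative at a is the identity.\<close>

lemma Cr_inverse_function:
  fixes f :: "'e::euclidean_space \<Rightarrow> 'g::euclidean_space"
  assumes "open U" "Cr_on r U f" "a \<in> U" "bij (frechet_derivative f (at a))"
  obtains U' V g where "open U'" "U' \<subseteq> U" "a \<in> U'" "open V" "f a \<in> V" "homeomorphism U' V f g"
    "Cr_on r V g"
proof -
  let ?D = "frechet_derivative f (at a)"
  define i where "i = inv ?D"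
  have fD: "(f has_derivative ?D) (at a)" by (rule Cr_on_has_derivative[OF assms(2,3)])
  have D: "linear ?D" using fD by (rule has_derivative_linear)
  have Di: "?D (i y) = y" "i (?D x) = x" for x y
    using assms(4) by (simp_all add: i_def bij_is_surj surj_f_inv_f bij_is_inj)
  have "linear i"
  proof (rule linearI)
    show "i (x + y) = i x + i y" for x y
      using Di(2)[of "i x + i y"] by (simp add: linear_add[OF D] Di(1))
    show "i (c *\<^sub>R x) = c *\<^sub>R i x" for c x
      using Di(2)[of "c *\<^sub>R i x"] by (simp add: linear_scale[OF D] Di(1))
  qed
  then have i: "bounded_linear i" by (rule linear_conv_bounded_linear[THEN iffD1])
  have "((\<lambda>x. i (f x)) has_derivative (\<lambda>v. v)) (at a)"
    using bounded_linear.has_derivative[OF i fD] by (simp add: Di)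
  then have "bij (frechet_derivative (\<lambda>x. i (f x)) (at a))"
    by (simp add: frechet_derivativeI bij_id[unfolded id_def])
  then obtain U' V g where g: "open U'" "U' \<subseteq> U" "a \<in> U'" "open V" "i (f a) \<in> V"
    "homeomorphism U' V (\<lambda>x. i (f x)) g" "Cr_on r V g"
    by (rule Cr_inverse_function_endo[OF assms(1) Cr_on_bounded_linear[OF assms(1) i assms(2)] assms(3)])
  have V: "open (i -` V)" using g(4) linear_continuous_on[OF i] by (rule open_vimage)
  have "homeomorphism U' (i -` V) f (\<lambda>y. g (i y))"
    unfolding homeomorphism_def
  proof (intro conjI ballI)
    have "f x \<in> i -` V" if "x \<in> U'" for x
      using g(6) that by (auto simp: homeomorphism_def)
    moreover have "y \<in> f ` U'" if "y \<in> i -` V" for y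
    proof -
      have "g (i y) \<in> U'" "i (f (g (i y))) = i y"
        using g(6) that by (auto simp: homeomorphism_def)
      then show ?thesis using Di(1) by (metis image_eqI)
    qed
    ultimately show "f ` U' = i -` V" by blast
    show "continuous_on U' f"
      using Cr_on_continuous[OF assms(2)] g(2) by (rule continuous_on_subset)
    show "continuous_on (i -` V) (\<lambda>y. g (i y))"
      by (rule continuous_on_compose2[OF _ linear_continuous_on[OF i], of V])
        (use g(6) in \<open>auto simp: homeomorphism_def\<close>)
    show "g (i (f x)) = x" if "x \<in> U'" for x using g(6) that by (auto simp: homeomorphism_def)
    have "g ` V = U'" using g(6) by (simp add: homeomorphism_def)
    moreover have "i ` (i -` V) = V" using Di(2) by (metis surj_def surj_image_vimage_eq)
    ultimately show "(\<lambda>y. g (i y)) ` (i -` V) = U'" by (metis image_image)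
    show "f (g (i y)) = y" if "y \<in> i -` V" for y
    proof -
      have "i (f (g (i y))) = i y" using g(6) that by (auto simp: homeomorphism_def)
      then show ?thesis using Di(1) by metis
    qed
  qed
  moreover have "Cr_on r (i -` V) (\<lambda>y. g (i y))"
    by (rule Cr_on_compose[OF V g(4,7) Cr_on_linear[OF V i]]) auto
  ultimately show thesis using that g(1-3,5) V by auto
qed

section \<open>Charts, parametrizations and tangent vectors\<close>

lemma prod_mfd_chart:
  assumes "c \<in> atlas M" "d \<in> atlas N"
  shows "(fst c \<times> fst d, map_prod (snd c) (snd d)) \<in> atlas (prod_mfd M N)"
  using assms unfolding prod_mfd_def mfd.simps by blast

locale Cr_mfd =
  fixes r :: regularity and M :: "('a, 'e::euclidean_space) mfd"
  assumes mfd: "Cr_manifold r M"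
begin

section \<open>Charts and their inverses\<close>

lemma chart_openin: "c \<in> atlas M \<Longrightarrow> openin (mtop M) (fst c)"
  using mfd unfolding Cr_manifold_def by force

lemma chart_homeomorphic:
  "c \<in> atlas M \<Longrightarrow> homeomorphic_map (subtopology (mtop M) (fst c)) (top_of_set (snd c ` fst c)) (snd c)"
  using mfd unfolding Cr_manifold_def by force

lemma chart_open_range: "c \<in> atlas M \<Longrightarrow> open (snd c ` fst c)"
  using mfd unfolding Cr_manifold_def by force

lemma chart_subset: "c \<in> atlas M \<Longrightarrow> fst c \<subseteq> carrier_of M"
  by (rule openin_subset[OF chart_openin])

lemma chart_topspace: "c \<in> atlas M \<Longrightarrow> topspace (subtopology (mtop M) (fst c)) = fst c"
  using chart_subset[of c] by auto

lemma chart_inj: "c \<in> atlas M \<Longrightarrow> inj_on (snd c) (fst c)"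
  using homeomorphic_imp_injective_map[OF chart_homeomorphic] chart_topspace by metis

lemma chart_inv_left: "c \<in> atlas M \<Longrightarrow> p \<in> fst c \<Longrightarrow> chart_inv c (snd c p) = p"
  unfolding chart_inv_def by (rule inv_into_f_f[OF chart_inj])

lemma chart_inv_right:
  assumes "x \<in> snd c ` fst c"
  shows "snd c (chart_inv c x) = x" "chart_inv c x \<in> fst c"
  using assms unfolding chart_inv_def by (auto simp: f_inv_into_f inv_into_into)

lemma chart_inv_carrier:
  assumes "c \<in> atlas M" "x \<in> snd c ` fst c"
  shows "chart_inv c x \<in> carrier_of M"
  using chart_inv_right(2)[OF assms(2)] chart_subset[OF assms(1)] by (rule rev_subsetD)

lemma chart_image_open:
  assumes "c \<in> atlas M" "openin (mtop M) V"
  shows "open (snd c ` (fst c \<inter> V))"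
proof -
  have "openin (subtopology (mtop M) (fst c)) (fst c \<inter> V)"
    using assms chart_openin by (simp add: openin_open_subtopology openin_Int)
  then have "openin (top_of_set (snd c ` fst c)) (snd c ` (fst c \<inter> V))"
    using homeomorphic_imp_open_map[OF chart_homeomorphic[OF assms(1)]] by (simp add: open_map_def)
  then show ?thesis using chart_open_range[OF assms(1)] openin_open_trans by blast
qed

lemma chart_preimage_openin:
  assumes "c \<in> atlas M" "open X"
  shows "openin (mtop M) {p \<in> fst c. snd c p \<in> X}"
proof -
  have "openin (subtopology (mtop M) (fst c)) {p \<in> topspace (subtopology (mtop M) (fst c)). snd c p \<in> snd c ` fst c \<inter> X}"
    using homeomorphic_imp_continuous_map[OF chart_homeomorphic[OF assms(1)]]
    by (rule openin_continuous_map_preimage) (use assms(2) in \<open>auto simp: openin_open\<close>)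
  moreover have "{p \<in> topspace (subtopology (mtop M) (fst c)). snd c p \<in> snd c ` fst c \<inter> X} = {p \<in> fst c. snd c p \<in> X}"
    using chart_topspace[OF assms(1)] by auto
  ultimately show ?thesis using openin_open_subtopology[OF chart_openin[OF assms(1)]] by metis
qed

lemma charts_cover: "p \<in> carrier_of M \<Longrightarrow> \<exists>c\<in>atlas M. p \<in> fst c"
  using mfd unfolding Cr_manifold_def by blast

lemma chart_around:
  assumes "p \<in> carrier_of M"
  shows "chart_around M p \<in> atlas M" "p \<in> fst (chart_around M p)"
proof -
  have "chart_around M p \<in> charts_at M p"
    unfolding chart_around_def
    by (rule someI_ex) (use charts_cover[OF assms] in \<open>auto simp: charts_at_def\<close>)
  then show "chart_around M p \<in> atlas M" "p \<in> fst (chart_around M p)" by (auto simp: charts_at_def)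
qed

lemma chart_transition:
  assumes "c \<in> atlas M" "d \<in> atlas M"
  shows "Cr_on r (snd c ` (fst c \<inter> fst d)) (\<lambda>x. snd d (chart_inv c x))"
  using mfd assms unfolding Cr_manifold_def by (auto simp: o_def)

text \<open>C^r maps from an open set of a Euclidean space into the manifold. The dimensions may
  differ and injectivity is not asked for, so curves, chart inverses and flow boxes are all covered.
  Open preimages of chart domains make the coordinate expressions live on open sets.\<close>

definition Cr_param :: "'k::euclidean_space set \<Rightarrow> ('k \<Rightarrow> 'a) \<Rightarrow> bool" where
  "Cr_param X \<kappa> \<longleftrightarrow> open X \<and> \<kappa> ` X \<subseteq> carrier_of M \<and>
     (\<forall>c\<in>atlas M. open {x \<in> X. \<kappa> x \<in> fst c} \<and>
        Cr_on r {x \<in> X. \<kappa> x \<in> fst c} (\<lambda>x. snd c (\<kappa> x)))"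

lemma Cr_paramD:
  assumes "Cr_param X \<kappa>"
  shows "open X" "x \<in> X \<Longrightarrow> \<kappa> x \<in> carrier_of M"
    "c \<in> atlas M \<Longrightarrow> open {x \<in> X. \<kappa> x \<in> fst c}"
    "c \<in> atlas M \<Longrightarrow> Cr_on r {x \<in> X. \<kappa> x \<in> fst c} (\<lambda>x. snd c (\<kappa> x))"
  using assms unfolding Cr_param_def by blast+

lemma Cr_param_chart_inv:
  assumes "c \<in> atlas M"
  shows "Cr_param (snd c ` fst c) (chart_inv c)"
  unfolding Cr_param_def
proof (intro conjI ballI)
  show "open (snd c ` fst c)" by (rule chart_open_range[OF assms])
  show "chart_inv c ` snd c ` fst c \<subseteq> carrier_of M"
    by (rule image_subsetI) (rule chart_inv_carrier[OF assms])
  fix d assume d: "d \<in> atlas M"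
  have "{x \<in> snd c ` fst c. chart_inv c x \<in> fst d} = snd c ` (fst c \<inter> fst d)"
    using chart_inv_left[OF assms] by auto
  then show "open {x \<in> snd c ` fst c. chart_inv c x \<in> fst d}"
    "Cr_on r {x \<in> snd c ` fst c. chart_inv c x \<in> fst d} (\<lambda>x. snd d (chart_inv c x))"
    using chart_image_open[OF assms chart_openin[OF d]] chart_transition[OF assms d] by simp_all
qed

lemma Cr_param_compose:
  fixes g :: "'l::euclidean_space \<Rightarrow> 'k::euclidean_space"
  assumes \<kappa>: "Cr_param X \<kappa>" and "open Y" "Cr_on r Y g" "g ` Y \<subseteq> X"
  shows "Cr_param Y (\<lambda>y. \<kappa> (g y))"
  unfolding Cr_param_def
proof (intro conjI ballI)
  show "(\<lambda>y. \<kappa> (g y)) ` Y \<subseteq> carrier_of M" using Cr_paramD(2)[OF \<kappa>] assms(4) by blast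
  fix c assume c: "c \<in> atlas M"
  let ?X = "{x \<in> X. \<kappa> x \<in> fst c}" and ?Y = "{y \<in> Y. \<kappa> (g y) \<in> fst c}"
  have "?Y = Y \<inter> g -` ?X" using assms(4) by auto
  then show Y: "open ?Y"
    using continuous_open_preimage[OF Cr_on_continuous[OF assms(3)] assms(2) Cr_paramD(3)[OF \<kappa> c]] by simp
  show "Cr_on r ?Y (\<lambda>y. snd c (\<kappa> (g y)))"
    by (rule Cr_on_compose[OF Y Cr_paramD(3,4)[OF \<kappa> c] Cr_on_subset[OF assms(3) Y]]) (use assms(4) in auto)
qed (rule assms(2))

lemma Cr_param_subset:
  assumes "Cr_param X \<kappa>" "open Y" "Y \<subseteq> X"
  shows "Cr_param Y \<kappa>"
  using Cr_param_compose[OF assms(1,2) Cr_on_linear[OF assms(2) bounded_linear_ident]] assms(3) by simp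

lemma Cr_param_localI:
  assumes "open X"
    and local: "\<And>x. x \<in> X \<Longrightarrow> \<exists>Y \<kappa>'. x \<in> Y \<and> Cr_param Y \<kappa>' \<and> (\<forall>y\<in>Y. \<kappa>' y = \<kappa> y)"
  shows "Cr_param X \<kappa>"
  unfolding Cr_param_def
proof (intro conjI ballI)
  show "\<kappa> ` X \<subseteq> carrier_of M"
  proof (rule image_subsetI)
    fix x assume "x \<in> X"
    from local[OF this] obtain Y \<kappa>' where Y: "x \<in> Y \<and> Cr_param Y \<kappa>' \<and> (\<forall>y\<in>Y. \<kappa>' y = \<kappa> y)"
      by (elim exE)
    then have "\<kappa>' x \<in> carrier_of M" using Cr_paramD(2)[of Y \<kappa>' x] by simp
    then show "\<kappa> x \<in> carrier_of M" using Y by simp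
  qed
  fix c assume c: "c \<in> atlas M"
  have ex: "\<exists>T. open T \<and> x \<in> T \<and> T \<subseteq> {x \<in> X. \<kappa> x \<in> fst c} \<and> Cr_on r T (\<lambda>x. snd c (\<kappa> x))"
    if x: "x \<in> {x \<in> X. \<kappa> x \<in> fst c}" for x
  proof -
    from x have "x \<in> X" by simp
    from local[OF this] obtain Y \<kappa>' where "x \<in> Y \<and> Cr_param Y \<kappa>' \<and> (\<forall>y\<in>Y. \<kappa>' y = \<kappa> y)"
      by (elim exE)
    then have Y: "x \<in> Y" "Cr_param Y \<kappa>'" "\<And>y. y \<in> Y \<Longrightarrow> \<kappa>' y = \<kappa> y" by simp_all
    let ?T = "X \<inter> {y \<in> Y. \<kappa>' y \<in> fst c}"
    have T: "open ?T" using assms(1) Cr_paramD(3)[OF Y(2) c] by blast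
    have "Cr_on r ?T (\<lambda>x. snd c (\<kappa>' x))" using Cr_paramD(4)[OF Y(2) c] T by (rule Cr_on_subset) blast
    then have "Cr_on r ?T (\<lambda>x. snd c (\<kappa> x))" by (rule Cr_on_cong[OF T, rotated]) (simp add: Y(3))
    then show ?thesis using T x Y by (intro exI[of _ ?T]) auto
  qed
  show op: "open {x \<in> X. \<kappa> x \<in> fst c}"
  proof (subst open_subopen, intro ballI)
    fix x assume "x \<in> {x \<in> X. \<kappa> x \<in> fst c}"
    from ex[OF this] show "\<exists>T. open T \<and> x \<in> T \<and> T \<subseteq> {x \<in> X. \<kappa> x \<in> fst c}" by (elim exE conjE) (intro exI conjI)
  qed
  show "Cr_on r {x \<in> X. \<kappa> x \<in> fst c} (\<lambda>x. snd c (\<kappa> x))"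
  proof (rule Cr_on_localI[OF op])
    fix x assume "x \<in> {x \<in> X. \<kappa> x \<in> fst c}"
    from ex[OF this] obtain T where T: "open T \<and> x \<in> T \<and> T \<subseteq> {x \<in> X. \<kappa> x \<in> fst c} \<and> Cr_on r T (\<lambda>x. snd c (\<kappa> x))"
      by (elim exE)
    then show "\<exists>V g. open V \<and> x \<in> V \<and> Cr_on r V g \<and> (\<forall>y\<in>V. g y = snd c (\<kappa> y))"
      by (intro exI[of _ T] exI[of _ "\<lambda>x. snd c (\<kappa> x)"]) simp
  qed
qed (rule assms(1))

text \<open>Open preimages of chart domains suffice for continuity, since inside one chart the
  coordinate expression is continuous.\<close>

lemma Cr_param_open_preimage:
  assumes \<kappa>: "Cr_param X \<kappa>" and V: "openin (mtop M) V"
  shows "open {x \<in> X. \<kappa> x \<in> V}"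
proof (subst open_subopen, intro ballI)
  fix x assume x: "x \<in> {x \<in> X. \<kappa> x \<in> V}"
  then obtain c where c: "c \<in> atlas M" "\<kappa> x \<in> fst c" using charts_cover Cr_paramD(2)[OF \<kappa>] by blast
  let ?X = "{x \<in> X. \<kappa> x \<in> fst c}" and ?V = "snd c ` (fst c \<inter> V)"
  let ?T = "?X \<inter> (\<lambda>x. snd c (\<kappa> x)) -` ?V"
  have "open ?T"
    by (rule continuous_open_preimage[OF Cr_on_continuous[OF Cr_paramD(4)[OF \<kappa> c(1)]]
          Cr_paramD(3)[OF \<kappa> c(1)] chart_image_open[OF c(1) V]])
  moreover have "?T \<subseteq> {x \<in> X. \<kappa> x \<in> V}"
    using inj_onD[OF chart_inj[OF c(1)]] by auto
  ultimately show "\<exists>T. open T \<and> x \<in> T \<and> T \<subseteq> {x \<in> X. \<kappa> x \<in> V}"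
    using x c by (intro exI[of _ ?T]) auto
qed

lemma Cr_param_continuous_map:
  assumes "Cr_param X \<kappa>"
  shows "continuous_map (top_of_set X) (mtop M) \<kappa>"
  unfolding continuous_map_def
proof (intro conjI allI impI)
  show "\<kappa> \<in> topspace (top_of_set X) \<rightarrow> carrier_of M" using Cr_paramD(2)[OF assms] by auto
  fix V assume "openin (mtop M) V"
  then have "open {x \<in> X. \<kappa> x \<in> V}" by (rule Cr_param_open_preimage[OF assms])
  moreover have "{x \<in> topspace (top_of_set X). \<kappa> x \<in> V} = {x \<in> X. \<kappa> x \<in> V}" by simp
  ultimately show "openin (top_of_set X) {x \<in> topspace (top_of_set X). \<kappa> x \<in> V}"
    by (simp add: open_openin_trans open_subset)
qed

section \<open>Vector-valued maps on a manifold\<close>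

lemma Cr_vec_map_iff:
  "Cr_vec_map r M f \<longleftrightarrow> (\<forall>c\<in>atlas M. Cr_on r (snd c ` fst c) (\<lambda>x. f (chart_inv c x)))"
  by (simp add: Cr_vec_map_def o_def)

lemma Cr_vec_mapD:
  "Cr_vec_map r M f \<Longrightarrow> c \<in> atlas M \<Longrightarrow> Cr_on r (snd c ` fst c) (\<lambda>x. f (chart_inv c x))"
  by (simp add: Cr_vec_map_iff)

lemma Cr_vec_map_param:
  fixes f :: "'a \<Rightarrow> 'v::euclidean_space"
  assumes f: "Cr_vec_map r M f" and \<kappa>: "Cr_param X \<kappa>"
  shows "Cr_on r X (\<lambda>x. f (\<kappa> x))"
proof (rule Cr_on_localI[OF Cr_paramD(1)[OF \<kappa>]])
  fix x assume x: "x \<in> X"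
  then obtain c where c: "c \<in> atlas M" "\<kappa> x \<in> fst c" using charts_cover Cr_paramD(2)[OF \<kappa>] by blast
  let ?X = "{x \<in> X. \<kappa> x \<in> fst c}"
  have "Cr_on r ?X (\<lambda>x. (f \<circ> chart_inv c) (snd c (\<kappa> x)))"
  proof (rule Cr_on_compose[OF Cr_paramD(3)[OF \<kappa> c(1)] chart_open_range[OF c(1)] _ Cr_paramD(4)[OF \<kappa> c(1)]])
    show "Cr_on r (snd c ` fst c) (f \<circ> chart_inv c)" using f c(1) by (simp add: Cr_vec_map_def)
  qed auto
  then show "\<exists>V g. open V \<and> x \<in> V \<and> Cr_on r V g \<and> (\<forall>y\<in>V. g y = f (\<kappa> y))"
    using Cr_paramD(3)[OF \<kappa> c(1)] x c chart_inv_left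
    by (intro exI[of _ ?X] exI[of _ "\<lambda>x. (f \<circ> chart_inv c) (snd c (\<kappa> x))"]) auto
qed

lemma Cr_vec_map_openin_preimage:
  fixes f :: "'a \<Rightarrow> 'v::euclidean_space"
  assumes f: "Cr_vec_map r M f" and X: "open X"
  shows "openin (mtop M) {p \<in> carrier_of M. f p \<in> X}"
proof (subst openin_subopen, intro ballI)
  fix p assume p: "p \<in> {p \<in> carrier_of M. f p \<in> X}"
  then obtain c where c: "c \<in> atlas M" "p \<in> fst c" using charts_cover by blast
  have cont: "continuous_on (snd c ` fst c) (f \<circ> chart_inv c)"
    using f c(1) by (intro Cr_on_continuous[of r]) (simp add: Cr_vec_map_def)
  let ?T = "{q \<in> fst c. snd c q \<in> snd c ` fst c \<inter> (f \<circ> chart_inv c) -` X}"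
  have "openin (mtop M) ?T"
    by (rule chart_preimage_openin[OF c(1) continuous_open_preimage[OF cont chart_open_range[OF c(1)] X]])
  moreover have "?T \<subseteq> {p \<in> carrier_of M. f p \<in> X}"
  proof
    fix q assume "q \<in> ?T"
    then have q: "q \<in> fst c" "f (chart_inv c (snd c q)) \<in> X" by simp_all
    then show "q \<in> {p \<in> carrier_of M. f p \<in> X}"
      using chart_inv_left[OF c(1) q(1)] chart_subset[OF c(1)] by auto
  qed
  ultimately show "\<exists>T. openin (mtop M) T \<and> p \<in> T \<and> T \<subseteq> {p \<in> carrier_of M. f p \<in> X}"
    using p c chart_inv_left[OF c(1)] by (intro exI[of _ ?T]) auto
qed

lemma Cr_vec_map_continuous_map:
  fixes f :: "'a \<Rightarrow> 'v::euclidean_space"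
  assumes "Cr_vec_map r M f"
  shows "continuous_map (mtop M) euclidean f"
  using Cr_vec_map_openin_preimage[OF assms] by (auto simp: continuous_map_def)

section \<open>Tangent vectors and differentials in coordinates\<close>

lemma tangent_space_eqI:
  assumes "v \<in> tangent_space M p" "w \<in> tangent_space M p" "c \<in> charts_at M p" "v c = w c"
  shows "v = w"
proof
  fix d
  show "v d = w d"
  proof (cases "d \<in> charts_at M p")
    case True
    have "u d = frechet_derivative (snd d \<circ> chart_inv c) (at (snd c p)) (u c)" if "u \<in> tangent_space M p" for u
      using that True assms(3) unfolding tangent_space_def by blast
    then show ?thesis using assms(1,2,4) by metis
  next
    case False
    have "u d = 0" if "u \<in> tangent_space M p" for u
      using that False unfolding tangent_space_def by blast
    then show ?thesis using assms(1,2) by metis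
  qed
qed

lemma transition_has_derivative:
  assumes "c \<in> charts_at M p" "d \<in> charts_at M p"
  shows "((snd d \<circ> chart_inv c) has_derivative frechet_derivative (snd d \<circ> chart_inv c) (at (snd c p))) (at (snd c p))"
proof -
  have "snd c p \<in> snd c ` (fst c \<inter> fst d)" using assms by (auto simp: charts_at_def)
  then show ?thesis
    using Cr_on_has_derivative[OF chart_transition[of c d]] assms by (simp add: charts_at_def o_def)
qed

text \<open>Transport w to the other charts by the transition derivatives; the transformation law is
  then the chain rule. This converts hypotheses on tangent vectors into statements on coordinate
  vectors.\<close>

lemma tangent_space_ex:
  assumes c: "c \<in> charts_at M p"
  shows "\<exists>v\<in>tangent_space M p. v c = w"
proof -
  let ?D = "\<lambda>c d. frechet_derivative (snd d \<circ> chart_inv c) (at (snd c p))"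
  define v where "v d = (if d \<in> charts_at M p then ?D c d w else 0)" for d
  have trans: "?D d e (?D c d w) = ?D c e w" if d: "d \<in> charts_at M p" and e: "e \<in> charts_at M p" for d e
  proof -
    have at: "c \<in> atlas M" "p \<in> fst c" "d \<in> atlas M" "p \<in> fst d"
      using c d by (auto simp: charts_at_def)
    have "(snd d \<circ> chart_inv c) (snd c p) = snd d p"
      using chart_inv_left[OF at(1,2)] by simp
    then have "((snd e \<circ> chart_inv d) \<circ> (snd d \<circ> chart_inv c) has_derivative ?D d e \<circ> ?D c d) (at (snd c p))"
      using diff_chain_at[OF transition_has_derivative[OF c d]] transition_has_derivative[OF d e] by metis
    then have "((snd e \<circ> chart_inv c) has_derivative ?D d e \<circ> ?D c d) (at (snd c p))"
    proof (rule has_derivative_transform_within_open)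
      show "open (snd c ` (fst c \<inter> fst d))"
        using chart_image_open[OF at(1) chart_openin[OF at(3)]] .
      show "snd c p \<in> snd c ` (fst c \<inter> fst d)" using at by auto
      fix x assume "x \<in> snd c ` (fst c \<inter> fst d)"
      then show "((snd e \<circ> chart_inv d) \<circ> (snd d \<circ> chart_inv c)) x = (snd e \<circ> chart_inv c) x"
        using chart_inv_left[OF at(1)] chart_inv_left[OF at(3)] by auto
    qed
    then have "?D c e = ?D d e \<circ> ?D c d" by (rule frechet_derivativeI)
    then show ?thesis by simp
  qed
  have "v \<in> tangent_space M p"
    unfolding tangent_space_def by (auto simp: v_def trans)
  moreover have "v c = w"
  proof -
    have at: "c \<in> atlas M" "p \<in> fst c" using c by (auto simp: charts_at_def)
    have "((snd c \<circ> chart_inv c) has_derivative (\<lambda>x. x)) (at (snd c p))"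
      by (rule has_derivative_transform_within_open[OF has_derivative_ident chart_open_range[OF at(1)]])
        (use at chart_inv_left[OF at(1)] in auto)
    then show ?thesis using c by (simp add: v_def frechet_derivativeI)
  qed
  ultimately show ?thesis by blast
qed

text \<open>The differential in the chart chosen by \<open>chart_around\<close>, acting on plain
  vectors of the model space, so that ordinary calculus applies.\<close>

definition coord_deriv :: "('a \<Rightarrow> 'v::euclidean_space) \<Rightarrow> 'a \<Rightarrow> 'e \<Rightarrow> 'v" where
  "coord_deriv f p = frechet_derivative (f \<circ> chart_inv (chart_around M p)) (at (snd (chart_around M p) p))"

lemma vec_differential_eq: "vec_differential M f p v = coord_deriv f p (v (chart_around M p))"
  by (simp add: vec_differential_def coord_deriv_def Let_def)

lemma chart_around_charts_at: "p \<in> carrier_of M \<Longrightarrow> chart_around M p \<in> charts_at M p"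
  using chart_around by (simp add: charts_at_def)

lemma coord_deriv_has_derivative:
  fixes f :: "'a \<Rightarrow> 'v::euclidean_space"
  assumes "Cr_vec_map r M f" "p \<in> carrier_of M"
  shows "((\<lambda>x. f (chart_inv (chart_around M p) x)) has_derivative coord_deriv f p) (at (snd (chart_around M p) p))"
  unfolding coord_deriv_def o_def
  by (rule Cr_on_has_derivative[OF Cr_vec_mapD[OF assms(1) chart_around(1)[OF assms(2)]]])
    (rule imageI[OF chart_around(2)[OF assms(2)]])

text \<open>Chain rule through the chart chosen at \<kappa> x0; used for integral curves and for
  inverse charts of the slice.\<close>

lemma has_derivative_along:
  fixes f :: "'a \<Rightarrow> 'v::euclidean_space" and \<kappa> :: "'k::real_normed_vector \<Rightarrow> 'a"
  assumes f: "Cr_vec_map r M f" and p: "\<kappa> x0 \<in> carrier_of M"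
    and \<kappa>: "((\<lambda>x. snd (chart_around M (\<kappa> x0)) (\<kappa> x)) has_derivative D) (at x0)"
    and N: "open N" "x0 \<in> N" "\<And>y. y \<in> N \<Longrightarrow> \<kappa> y \<in> fst (chart_around M (\<kappa> x0))"
  shows "((\<lambda>x. f (\<kappa> x)) has_derivative (\<lambda>h. coord_deriv f (\<kappa> x0) (D h))) (at x0)"
proof -
  let ?c = "chart_around M (\<kappa> x0)"
  have "((\<lambda>x. f (chart_inv ?c x)) \<circ> (\<lambda>x. snd ?c (\<kappa> x)) has_derivative coord_deriv f (\<kappa> x0) \<circ> D) (at x0)"
    by (rule diff_chain_at[OF \<kappa> coord_deriv_has_derivative[OF f p]])
  then have "((\<lambda>x. f (\<kappa> x)) has_derivative coord_deriv f (\<kappa> x0) \<circ> D) (at x0)"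
    by (rule has_derivative_transform_within_open[OF _ N(1,2)])
      (use N(3) chart_inv_left[OF chart_around(1)[OF p]] in simp)
  then show ?thesis by (simp add: o_def)
qed

end

section \<open>The rays of a null wave front\<close>

lemma lorentz_dual: "lorentz (lorentz_dual a) x = blinfun_apply a x"
proof -
  let ?w = "(- blinfun_apply a (1, 0), \<Sum>b\<in>Basis. blinfun_apply a (0, b) *\<^sub>R b)"
  have ex: "lorentz ?w x = blinfun_apply a x" for x
  proof -
    have "(\<Sum>b\<in>Basis. (snd x \<bullet> b) *\<^sub>R (0 :: real, b)) = (0, snd x)"
      by (simp add: prod_eq_iff fst_sum snd_sum euclidean_representation)
    then have "blinfun_apply a x = blinfun_apply a (fst x *\<^sub>R (1, 0) + (\<Sum>b\<in>Basis. (snd x \<bullet> b) *\<^sub>R (0, b)))"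
      by simp
    also have "\<dots> = fst x * blinfun_apply a (1, 0) + (\<Sum>b\<in>Basis. (snd x \<bullet> b) * blinfun_apply a (0, b))"
      by (simp only: blinfun.add_right blinfun.scaleR_right blinfun.sum_right real_scaleR_def)
    also have "\<dots> = lorentz ?w x"
      by (simp add: lorentz_def inner_sum_left inner_commute[of "snd x"] mult.commute)
    finally show ?thesis by simp
  qed
  have "\<exists>!w. \<forall>x. lorentz w x = blinfun_apply a x"
  proof (intro ex1I allI)
    fix w assume w: "\<forall>x. lorentz w x = blinfun_apply a x"
    then have "lorentz w x = lorentz ?w x" for x by (simp only: ex)
    from this[of "(1, 0)"] this[of "(0, y)" for y]
    have "fst w = fst ?w" and y: "snd w \<bullet> y = snd ?w \<bullet> y" for y by (simp_all add: lorentz_def)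
    moreover have "snd w = snd ?w" by (rule iffD1[OF vector_eq_rdot], rule allI[OF y])
    ultimately show "w = ?w" by (intro prod_eqI)
  qed (rule ex)
  then show ?thesis unfolding lorentz_dual_def by (rule theI'[THEN spec])
qed

lemma lorentz_dual_eq:
  "fst (lorentz_dual a) = - blinfun_apply a (1, 0)" "snd (lorentz_dual a) \<bullet> y = blinfun_apply a (0, y)"
  using lorentz_dual[of a "(1, 0)"] lorentz_dual[of a "(0, y)"] by (simp_all add: lorentz_def)

lemma lightlike_iff:
  "lightlike w \<longleftrightarrow> fst w \<noteq> 0 \<and> norm (snd w) = \<bar>fst w\<bar>"
proof -
  have "lorentz w w = (norm (snd w))\<^sup>2 - \<bar>fst w\<bar>\<^sup>2"
    by (simp add: lorentz_def dot_square_norm power2_eq_square)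
  then have "lorentz w w = 0 \<longleftrightarrow> norm (snd w) = \<bar>fst w\<bar>"
    using power2_eq_iff_nonneg[of "norm (snd w)" "\<bar>fst w\<bar>"] by simp
  moreover have "w \<noteq> 0 \<longleftrightarrow> fst w \<noteq> 0 \<or> snd w \<noteq> 0" by (auto simp: prod_eq_iff)
  ultimately show ?thesis unfolding lightlike_def by auto
qed

text \<open>For a light-like vector time part and space part have equal norm, so Euclidean norm
  \<surd>2 and future direction together mean that the time component is 1.\<close>

lemma E_normalized_lightlike:
  assumes "lightlike w"
  shows "E_normalized w = (1, snd w /\<^sub>R fst w)"
  unfolding E_normalized_def
proof (rule the_equality)
  have w: "fst w \<noteq> 0" "norm (snd w) = \<bar>fst w\<bar>" using assms by (simp_all add: lightlike_iff)
  have "(1, snd w /\<^sub>R fst w) = inverse (fst w) *\<^sub>R w" using w by (simp add: prod_eq_iff)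
  moreover have "norm (1 :: real, snd w /\<^sub>R fst w) = sqrt 2" using w by (simp add: norm_Pair)
  ultimately show "(\<exists>k. (1, snd w /\<^sub>R fst w) = k *\<^sub>R w) \<and> future_directed (1, snd w /\<^sub>R fst w) \<and>
      norm (1 :: real, snd w /\<^sub>R fst w) = sqrt 2"
    by (intro conjI exI[of _ "inverse (fst w)"]) (simp_all add: future_directed_def w(1))
  fix v assume v: "(\<exists>k. v = k *\<^sub>R w) \<and> future_directed v \<and> norm v = sqrt 2"
  then obtain k where kv: "v = k *\<^sub>R w" by blast
  then have k: "v = k *\<^sub>R w" "k * fst w > 0" using v by (simp_all add: future_directed_def)
  have "2 = (norm v)\<^sup>2" using v by simp
  also have "\<dots> = (k * fst w)\<^sup>2 + (k * fst w)\<^sup>2"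
    using w by (simp add: k norm_prod_def power_mult_distrib)
  finally have "(k * fst w)\<^sup>2 = 1" by simp
  then have "k * fst w = 1" using k(2) power2_eq_1_iff[of "k * fst w"] by auto
  then have "k = inverse (fst w)" using w by (simp add: field_simps)
  then show "v = (1, snd w /\<^sub>R fst w)" using w by (simp add: k prod_eq_iff)
qed

text \<open>The chart picks an arbitrary nonzero representative; the quotients are invariant under
  scaling.\<close>

lemma proj_chart_proj_class:
  assumes "blinfun_apply a e \<noteq> 0"
  shows "snd (proj_chart e b) (proj_class a) = (\<chi> j. blinfun_apply a (b j) / blinfun_apply a e)"
proof -
  define a' where "a' = (SOME a'. a' \<in> proj_class a \<and> a' \<noteq> 0)"
  have "a \<in> proj_class a \<and> a \<noteq> 0" using assms by (auto simp: proj_class_def span_base)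
  then have "a' \<in> proj_class a \<and> a' \<noteq> 0" unfolding a'_def by (rule someI)
  then obtain k where "a' = k *\<^sub>R a" "k \<noteq> 0"
    by (auto simp: proj_class_def span_singleton)
  then have "blinfun_apply a' (b j) / blinfun_apply a' e = blinfun_apply a (b j) / blinfun_apply a e" for j
    by (simp add: blinfun.scaleR_left)
  then show ?thesis by (simp add: proj_chart_def Let_def a'_def[symmetric])
qed

lemma proj_class_in_proj_chart:
  assumes "proj_class a \<in> fst (proj_chart e b)" "a \<noteq> 0"
  shows "blinfun_apply a e \<noteq> 0"
proof -
  obtain a' where a': "proj_class a = proj_class a'" "blinfun_apply a' e \<noteq> 0"
    using assms(1) by (auto simp: proj_chart_def)
  then have "a \<in> span {a'}" using span_base[of a "{a}"] by (auto simp: proj_class_def)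
  then obtain k where "a = k *\<^sub>R a'" by (auto simp: span_singleton)
  then show ?thesis using assms(2) a'(2) by (auto simp: blinfun.scaleR_left)
qed

locale complete_null_front = Cr_mfd r M
  for r and M :: "('a, real ^ 'n) mfd" +
  fixes F :: "'a \<Rightarrow> 'n spacetime" and \<alpha> :: "'a \<Rightarrow> 'n codual"
    and \<xi> :: "'a \<Rightarrow> ('a, real ^ 'n) chart \<Rightarrow> real ^ 'n"
  assumes front: "null_wave_front r M F \<alpha>"
    and field: "E_normalized_null_field r M F \<alpha> \<xi>"
    and complete: "\<And>p. p \<in> carrier_of M \<Longrightarrow>
      \<exists>\<gamma>. integral_curve M \<xi> UNIV \<gamma> \<and> p \<in> range \<gamma> \<and> lightlike_line (range (F \<circ> \<gamma>))"
begin

section \<open>Time, direction and base point of the rays\<close>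

definition time :: "'a \<Rightarrow> real" where
  "time p = fst (F p)"

definition dir :: "'a \<Rightarrow> real ^ 'n" where
  "dir p = snd (lorentz_dual (\<alpha> p)) /\<^sub>R fst (lorentz_dual (\<alpha> p))"

definition base :: "'a \<Rightarrow> real ^ 'n" where
  "base p = snd (F p) - time p *\<^sub>R dir p"

text \<open>The light ray through \<open>F p\<close>, encoded by its position at time 0 and its direction.\<close>

definition ray :: "'a \<Rightarrow> (real ^ 'n) \<times> (real ^ 'n)" where
  "ray p = (base p, dir p)"

lemma F_eq: "F p = (time p, base p + time p *\<^sub>R dir p)"
  by (simp add: base_def time_def prod_eq_iff)

lemma dual_lightlike: "p \<in> carrier_of M \<Longrightarrow> lightlike (lorentz_dual (\<alpha> p))"
  using front unfolding null_wave_front_def by blast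

lemma dual_nonzero: "p \<in> carrier_of M \<Longrightarrow> fst (lorentz_dual (\<alpha> p)) \<noteq> 0"
  using dual_lightlike lightlike_iff by blast

lemma norm_dir: "p \<in> carrier_of M \<Longrightarrow> norm (dir p) = 1"
  using dual_lightlike[of p] by (simp add: dir_def lightlike_iff)

text \<open>Up to a nonzero factor \<alpha> is determined by \<open>dir\<close>; hence its
  projective class is a function of \<open>dir\<close> alone.\<close>

lemma \<alpha>_apply:
  assumes "p \<in> carrier_of M"
  shows "blinfun_apply (\<alpha> p) x = fst (lorentz_dual (\<alpha> p)) * (dir p \<bullet> snd x - fst x)"
  using dual_nonzero[OF assms] lorentz_dual[of "\<alpha> p" x]
  by (simp add: lorentz_def dir_def field_simps)

lemma E_normalized_dual: "p \<in> carrier_of M \<Longrightarrow> E_normalized (lorentz_dual (\<alpha> p)) = (1, dir p)"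
  using E_normalized_lightlike[OF dual_lightlike] by (simp add: dir_def)

lemma F_Cr: "Cr_vec_map r M F" and \<alpha>_Cr: "Cr_vec_map r M \<alpha>"
  using front by (simp_all add: null_wave_front_def wave_front_def)

lemma time_Cr: "Cr_vec_map r M time"
  unfolding Cr_vec_map_iff
proof
  fix c assume c: "c \<in> atlas M"
  have "Cr_on r (snd c ` fst c) (\<lambda>x. fst (F (chart_inv c x)))"
    by (rule Cr_on_bounded_linear[OF chart_open_range[OF c] bounded_linear_fst Cr_vec_mapD[OF F_Cr c]])
  then show "Cr_on r (snd c ` fst c) (\<lambda>x. time (chart_inv c x))" by (simp only: time_def)
qed

lemma dir_Cr: "Cr_vec_map r M dir"
  unfolding Cr_vec_map_iff
proof
  fix c assume c: "c \<in> atlas M"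
  let ?X = "snd c ` fst c"
  note X = chart_open_range[OF c]
  have \<alpha>: "Cr_on r ?X (\<lambda>x. blinfun_apply (\<alpha> (chart_inv c x)) v)" for v
    by (rule Cr_on_bounded_linear[OF X blinfun.bounded_linear_left Cr_vec_mapD[OF \<alpha>_Cr c]])
  have "Cr_on r ?X (\<lambda>x. blinfun_apply (\<alpha> (chart_inv c x)) (0, b) *
      inverse (blinfun_apply (\<alpha> (chart_inv c x)) (- 1, 0)))" for b
  proof (rule Cr_on_mult[OF X \<alpha> Cr_on_inverse[OF X \<alpha>]])
    fix x assume x: "x \<in> ?X"
    then have "chart_inv c x \<in> carrier_of M" by (rule chart_inv_carrier[OF c])
    then show "blinfun_apply (\<alpha> (chart_inv c x)) (- 1, 0) \<noteq> 0"
      using dual_nonzero by (simp add: \<alpha>_apply)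
  qed
  moreover have "blinfun_apply (\<alpha> p) (- 1, 0) = fst (lorentz_dual (\<alpha> p))" for p
    using lorentz_dual[of "\<alpha> p" "(- 1, 0)"] by (simp add: lorentz_def)
  ultimately have "Cr_on r ?X (\<lambda>x. dir (chart_inv c x) \<bullet> b)" for b
    by (simp add: dir_def lorentz_dual_eq mult.commute)
  then show "Cr_on r ?X (\<lambda>x. dir (chart_inv c x))" by (rule Cr_on_componentwise[OF X])
qed

lemma base_Cr: "Cr_vec_map r M base"
  unfolding Cr_vec_map_iff
proof
  fix c assume c: "c \<in> atlas M"
  let ?X = "snd c ` fst c"
  note X = chart_open_range[OF c]
  have "Cr_on r ?X (\<lambda>x. snd (F (chart_inv c x)) \<bullet> b)" for b
    by (rule Cr_on_bounded_linear[OF X bounded_linear_inner_left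
          Cr_on_bounded_linear[OF X bounded_linear_snd Cr_vec_mapD[OF F_Cr c]]])
  moreover have "Cr_on r ?X (\<lambda>x. dir (chart_inv c x) \<bullet> b)" for b
    by (rule Cr_on_bounded_linear[OF X bounded_linear_inner_left Cr_vec_mapD[OF dir_Cr c]])
  moreover have "Cr_on r ?X (\<lambda>x. - time (chart_inv c x))"
    by (rule Cr_on_bounded_linear[OF X bounded_linear_minus[OF bounded_linear_ident] Cr_vec_mapD[OF time_Cr c]])
  ultimately have "Cr_on r ?X (\<lambda>x. snd (F (chart_inv c x)) \<bullet> b +
      (- time (chart_inv c x)) * (dir (chart_inv c x) \<bullet> b))" for b
    by (intro Cr_on_add[OF X] Cr_on_mult[OF X])
  then have "Cr_on r ?X (\<lambda>x. base (chart_inv c x) \<bullet> b)" for b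
    by (simp add: base_def inner_diff_left)
  then show "Cr_on r ?X (\<lambda>x. base (chart_inv c x))" by (rule Cr_on_componentwise[OF X])
qed

lemma ray_Cr: "Cr_vec_map r M ray"
  unfolding Cr_vec_map_iff ray_def
  by (intro ballI Cr_on_Pair chart_open_range Cr_vec_mapD[OF base_Cr] Cr_vec_mapD[OF dir_Cr])

lemma coord_deriv_ray:
  assumes p: "p \<in> carrier_of M"
  shows "coord_deriv ray p w = (coord_deriv base p w, coord_deriv dir p w)"
proof -
  let ?c = "chart_around M p"
  have "((\<lambda>x. (base (chart_inv ?c x), dir (chart_inv ?c x))) has_derivative
      (\<lambda>w. (coord_deriv base p w, coord_deriv dir p w))) (at (snd ?c p))"
    by (intro has_derivative_Pair coord_deriv_has_derivative base_Cr dir_Cr p)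
  from has_derivative_unique[OF coord_deriv_has_derivative[OF ray_Cr p] this[folded ray_def]]
  show ?thesis by simp
qed

lemma coord_deriv_F:
  assumes p: "p \<in> carrier_of M"
  shows "coord_deriv F p w =
    (coord_deriv time p w, coord_deriv base p w + (time p *\<^sub>R coord_deriv dir p w + coord_deriv time p w *\<^sub>R dir p))"
proof -
  let ?c = "chart_around M p"
  let ?b = "\<lambda>x. base (chart_inv ?c x)" and ?t = "\<lambda>x. time (chart_inv ?c x)" and ?d = "\<lambda>x. dir (chart_inv ?c x)"
  have "((\<lambda>x. (?t x, ?b x + ?t x *\<^sub>R ?d x)) has_derivative
      (\<lambda>w. (coord_deriv time p w, coord_deriv base p w +
        (?t (snd ?c p) *\<^sub>R coord_deriv dir p w + coord_deriv time p w *\<^sub>R ?d (snd ?c p))))) (at (snd ?c p))"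
    by (intro has_derivative_Pair has_derivative_add has_derivative_scaleR coord_deriv_has_derivative
        base_Cr dir_Cr time_Cr p)
  from has_derivative_unique[OF coord_deriv_has_derivative[OF F_Cr p] this[folded F_eq]]
  have "coord_deriv F p = (\<lambda>w. (coord_deriv time p w, coord_deriv base p w +
        (?t (snd ?c p) *\<^sub>R coord_deriv dir p w + coord_deriv time p w *\<^sub>R ?d (snd ?c p))))"
    .
  then show ?thesis using chart_inv_left[OF chart_around[OF p]] by simp
qed

text \<open>This is where the immersion property of the front enters.\<close>

lemma coord_deriv_time_ray_inj:
  assumes p: "p \<in> carrier_of M" and w: "coord_deriv time p w = 0" "coord_deriv ray p w = 0"
  shows "w = 0"
proof -
  let ?c = "chart_around M p" and ?N = "prod_mfd euclidean_mfd proj_mfd :: (('n spacetime \<times> 'n codual set), _) mfd"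
  let ?L = "\<lambda>p. (F p, proj_class (\<alpha> p))"
  note c = chart_around[OF p]
  \<comment> \<open>\<open>F\<close> is an expression in time, base and direction, so its derivative
    along w vanishes too.\<close>
  have dir0: "coord_deriv dir p w = 0" and F0: "coord_deriv F p w = 0"
    using w by (simp_all add: coord_deriv_ray[OF p] coord_deriv_F[OF p] zero_prod_def)
  have zero: "frechet_derivative (snd d \<circ> ?L \<circ> chart_inv ?c) (at (snd ?c p)) w = 0 \<and>
      frechet_derivative (snd d \<circ> ?L \<circ> chart_inv ?c) (at (snd ?c p)) 0 = 0" if d: "d \<in> charts_at ?N (?L p)" for d
  proof -
    have "\<exists>d0\<in>atlas proj_mfd. d = (UNIV \<times> fst d0, map_prod id (snd d0)) \<and> proj_class (\<alpha> p) \<in> fst d0"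
      using d unfolding charts_at_def prod_mfd_def euclidean_mfd_def by force
    then obtain e b where e: "d = (UNIV \<times> fst (proj_chart e b), map_prod id (snd (proj_chart e b)))"
      and pe: "proj_class (\<alpha> p) \<in> fst (proj_chart e b)"
      unfolding proj_mfd_def mfd.simps by blast
    have "\<alpha> p \<noteq> 0" using front p by (auto simp: null_wave_front_def wave_front_def)
    then have \<alpha>e: "blinfun_apply (\<alpha> p) e \<noteq> 0" by (rule proj_class_in_proj_chart[OF pe])
    \<comment> \<open>The covector without its scalar factor. In a projective chart the factor
      cancels, so the coordinates are quotients of N; by the quotient rule (\<open>Q\<close> below)
      their derivative is linear in that of \<open>dir\<close> and vanishes along w.\<close>
    define N where "N v x = dir (chart_inv ?c x) \<bullet> snd v - fst v" for v :: "'n spacetime" and x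
    let ?X = "snd ?c ` fst ?c"
    have px: "snd ?c p \<in> ?X" using c by blast
    have \<alpha>N: "blinfun_apply (\<alpha> (chart_inv ?c x)) v = fst (lorentz_dual (\<alpha> (chart_inv ?c x))) * N v x"
      "fst (lorentz_dual (\<alpha> (chart_inv ?c x))) \<noteq> 0" if "x \<in> ?X" for x v
    proof -
      have "chart_inv ?c x \<in> carrier_of M" by (rule chart_inv_carrier[OF c(1) that])
      then show "blinfun_apply (\<alpha> (chart_inv ?c x)) v = fst (lorentz_dual (\<alpha> (chart_inv ?c x))) * N v x"
        "fst (lorentz_dual (\<alpha> (chart_inv ?c x))) \<noteq> 0"
        using \<alpha>_apply dual_nonzero by (auto simp: N_def)
    qed
    have Np: "N e (snd ?c p) \<noteq> 0"
      using \<alpha>e \<alpha>N(1)[OF px, of e] chart_inv_left[OF c] by auto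
    have ND: "(N v has_derivative (\<lambda>h. coord_deriv dir p h \<bullet> snd v)) (at (snd ?c p))" for v
      unfolding N_def
      using has_derivative_diff[OF bounded_linear.has_derivative[OF bounded_linear_inner_left
            coord_deriv_has_derivative[OF dir_Cr p]] has_derivative_const] by fastforce
    define Q where "Q j h = (coord_deriv dir p h \<bullet> snd (b j) * N e (snd ?c p)
        - N (b j) (snd ?c p) * (coord_deriv dir p h \<bullet> snd e)) / (N e (snd ?c p) * N e (snd ?c p))" for j h
    have D: "((\<lambda>x. (F (chart_inv ?c x), \<Sum>j\<in>UNIV. (N (b j) x / N e x) *\<^sub>R axis j 1)) has_derivative
        (\<lambda>h. (coord_deriv F p h, \<Sum>j\<in>UNIV. Q j h *\<^sub>R axis j 1))) (at (snd ?c p))"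
      unfolding Q_def
      by (intro has_derivative_Pair coord_deriv_has_derivative F_Cr p has_derivative_sum
          bounded_linear.has_derivative[OF bounded_linear_scaleR_left] has_derivative_divide' ND Np)
    have cont: "continuous_on ?X (N e)"
    proof -
      have "continuous_on ?X (\<lambda>x. dir (chart_inv ?c x))"
        by (rule Cr_on_continuous[OF Cr_vec_mapD[OF dir_Cr c(1)]])
      then show ?thesis unfolding N_def by (intro continuous_intros)
    qed
    have op: "open (?X \<inter> N e -` (- {0}))"
      by (rule continuous_open_preimage[OF cont chart_open_range[OF c(1)]]) auto
    have eq: "(F (chart_inv ?c x), \<Sum>j\<in>UNIV. (N (b j) x / N e x) *\<^sub>R axis j 1) = (snd d \<circ> ?L \<circ> chart_inv ?c) x"
      if "x \<in> ?X \<inter> N e -` (- {0})" for x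
    proof -
      have x: "x \<in> ?X" "N e x \<noteq> 0" using that by auto
      have "(\<Sum>j\<in>UNIV. (N (b j) x / N e x) *\<^sub>R axis j 1) = (\<chi> j. N (b j) x / N e x)"
        by (simp add: vec_eq_iff axis_def if_distrib sum.delta cong: if_cong)
      also have "\<dots> = (\<chi> j. blinfun_apply (\<alpha> (chart_inv ?c x)) (b j) / blinfun_apply (\<alpha> (chart_inv ?c x)) e)"
        using \<alpha>N[OF x(1)] by (simp add: vec_eq_iff)
      also have "\<dots> = snd (proj_chart e b) (proj_class (\<alpha> (chart_inv ?c x)))"
        using \<alpha>N[OF x(1)] x(2) by (intro proj_chart_proj_class[symmetric]) simp
      finally show ?thesis by (simp add: e)
    qed
    have "((snd d \<circ> ?L \<circ> chart_inv ?c) has_derivative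
        (\<lambda>h. (coord_deriv F p h, \<Sum>j\<in>UNIV. Q j h *\<^sub>R axis j 1))) (at (snd ?c p))"
      by (rule has_derivative_transform_within_open[OF D op _ eq]) (use px Np in auto)
    moreover have "coord_deriv F p 0 = 0" "coord_deriv dir p 0 = 0"
      using has_derivative_linear[OF coord_deriv_has_derivative[OF F_Cr p]]
        has_derivative_linear[OF coord_deriv_has_derivative[OF dir_Cr p]] by (simp_all add: linear_0)
    ultimately show ?thesis using dir0 F0 by (simp add: frechet_derivativeI Q_def zero_prod_def)
  qed
  \<comment> \<open>The immersion hypothesis concerns tangent vectors: w is extended to one, which
    is then compared with the zero vector.\<close>
  obtain v where v: "v \<in> tangent_space M p" "v ?c = w"
    using tangent_space_ex[OF chart_around_charts_at[OF p]] by blast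
  have z: "(\<lambda>_. 0) \<in> tangent_space M p"
    unfolding tangent_space_def
    using linear_0[OF has_derivative_linear[OF transition_has_derivative]] by force
  have "differential M ?N ?L p v = differential M ?N ?L p (\<lambda>_. 0)"
  proof
    fix d
    show "differential M ?N ?L p v d = differential M ?N ?L p (\<lambda>_. 0) d"
    proof (cases "d \<in> charts_at ?N (?L p)")
      case True
      then show ?thesis
        by (simp only: differential_def Let_def if_True v(2) zero[OF True, THEN conjunct1] zero[OF True, THEN conjunct2])
    next
      case False
      then show ?thesis by (simp only: differential_def if_False)
    qed
  qed
  moreover have "inj_on (differential M ?N ?L p) (tangent_space M p)"
    using front p unfolding null_wave_front_def wave_front_def Cr_immersion_def by blast
  ultimately have "v = (\<lambda>_. 0)" using v(1) z by (simp only: inj_onD)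
  then show ?thesis using v(2) by simp
qed

text \<open>A curve through p parametrized by time and staying on one light ray. The null field is
  not mentioned: these properties already determine the curve.\<close>

definition is_ray :: "'a \<Rightarrow> (real \<Rightarrow> 'a) \<Rightarrow> bool" where
  "is_ray p \<sigma> \<longleftrightarrow> continuous_map euclidean (mtop M) \<sigma> \<and> (\<forall>s. time (\<sigma> s) = s) \<and>
     (\<forall>s. ray (\<sigma> s) = ray p) \<and> \<sigma> (time p) = p"

text \<open>On the integral curve supplied by completeness time is the parameter plus a constant,
  and the image lies on a straight line, so the velocity (1, dir) cannot change. Hence direction and
  base point are constant, and differentiating this at p gives the last claim.\<close>

lemma along_null_field:
  assumes p: "p \<in> carrier_of M"
  shows "\<exists>\<sigma>. is_ray p \<sigma>" "coord_deriv time p (\<xi> p (chart_around M p)) = 1"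
    "coord_deriv ray p (\<xi> p (chart_around M p)) = 0"
proof -
  obtain \<gamma> t1 where \<gamma>: "integral_curve M \<xi> UNIV \<gamma>" and t1: "\<gamma> t1 = p" and line: "lightlike_line (range (F \<circ> \<gamma>))"
    using complete[OF p] by blast
  have cont: "continuous_map euclidean (mtop M) \<gamma>" using \<gamma> by (simp add: integral_curve_def)
  have car: "\<gamma> t \<in> carrier_of M" for t
    using continuous_map_funspace[OF cont] by auto
  have along: "((\<lambda>s. f (\<gamma> s)) has_derivative (\<lambda>h. h *\<^sub>R coord_deriv f (\<gamma> t) (\<xi> (\<gamma> t) (chart_around M (\<gamma> t))))) (at t)"
    if f: "Cr_vec_map r M f" for f :: "'a \<Rightarrow> 'v::euclidean_space" and t
  proof -
    let ?c = "chart_around M (\<gamma> t)"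
    have "((snd ?c \<circ> \<gamma>) has_vector_derivative \<xi> (\<gamma> t) ?c) (at t)"
      using \<gamma> chart_around_charts_at[OF car] unfolding integral_curve_def by blast
    then have D: "((\<lambda>s. snd ?c (\<gamma> s)) has_derivative (\<lambda>h. h *\<^sub>R \<xi> (\<gamma> t) ?c)) (at t)"
      by (simp add: has_vector_derivative_def o_def)
    have "open {s. \<gamma> s \<in> fst ?c}"
      using openin_continuous_map_preimage[OF cont chart_openin[OF chart_around(1)[OF car]]] by simp
    then have "((\<lambda>s. f (\<gamma> s)) has_derivative (\<lambda>h. coord_deriv f (\<gamma> t) (h *\<^sub>R \<xi> (\<gamma> t) ?c))) (at t)"
      by (rule has_derivative_along[OF f car D]) (use chart_around(2)[OF car] in auto)
    then show ?thesis
      using linear_scale[OF has_derivative_linear[OF coord_deriv_has_derivative[OF f car]]] by simp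
  qed
  have F\<xi>: "coord_deriv F q (\<xi> q (chart_around M q)) = (1, dir q)" if q: "q \<in> carrier_of M" for q
    using field q E_normalized_dual[OF q] unfolding E_normalized_null_field_def by (simp add: vec_differential_eq)
  show time\<xi>: "coord_deriv time p (\<xi> p (chart_around M p)) = 1"
    using F\<xi>[OF p] by (simp add: coord_deriv_F[OF p])
  have FD: "((\<lambda>s. F (\<gamma> s)) has_vector_derivative (1, dir (\<gamma> t))) (at t)" for t
    using along[OF F_Cr, of t] F\<xi>[OF car] by (simp add: has_vector_derivative_def)
  have "((\<lambda>s. time (\<gamma> s) - s) has_derivative (\<lambda>h. 0)) (at t)" for t
  proof -
    have "((\<lambda>s. fst (F (\<gamma> s)) - s) has_derivative (\<lambda>h. fst (h *\<^sub>R (1 :: real, dir (\<gamma> t))) - h)) (at t)"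
      using FD[of t] by (intro has_derivative_diff has_derivative_fst has_derivative_ident)
        (simp add: has_vector_derivative_def)
    then show ?thesis by (simp add: time_def)
  qed
  then have "\<exists>c. \<forall>s. time (\<gamma> s) - s = c"
    using has_derivative_zero_constant[of UNIV "\<lambda>s. time (\<gamma> s) - s"] by auto
  then obtain c0 where "\<And>s. time (\<gamma> s) - s = c0" by blast
  then have time\<gamma>: "time (\<gamma> s) = s + c0" for s by (metis add.commute diff_add_cancel)
  obtain q v where v: "lightlike v" and q: "range (F \<circ> \<gamma>) = range (\<lambda>s. q + s *\<^sub>R v)"
    using line unfolding lightlike_line_def by blast
  have v0: "fst v \<noteq> 0" using v lightlike_iff by blast
  \<comment> \<open>The line is reparametrized so that its time component is s + c0; on a light-like
    line time determines the point, so F \<circ> \<gamma> must be this affine curve.\<close>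
  define b where "b = v /\<^sub>R fst v"
  define a where "a = q + (c0 - fst q) *\<^sub>R b"
  have line_eq: "F (\<gamma> s) = a + s *\<^sub>R b" for s
  proof -
    have "F (\<gamma> s) \<in> range (\<lambda>s. q + s *\<^sub>R v)" using q by (metis comp_apply rangeI)
    then obtain k where k: "F (\<gamma> s) = q + k *\<^sub>R v" by blast
    then have "s + c0 = fst q + k * fst v" using time\<gamma>[of s] by (simp add: time_def)
    then have "k *\<^sub>R v = (s + c0 - fst q) *\<^sub>R b" using v0 by (simp add: b_def)
    then show ?thesis using k by (simp add: a_def algebra_simps)
  qed
  have "((\<lambda>s. F (\<gamma> s)) has_vector_derivative b) (at t)" for t
    unfolding line_eq by (auto intro!: derivative_eq_intros)
  then have b: "b = (1, dir (\<gamma> t))" for t using vector_derivative_unique_at[OF FD] by metis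
  then have dir\<gamma>: "dir (\<gamma> t) = snd b" for t by (metis snd_conv)
  have "base (\<gamma> t) = snd a - c0 *\<^sub>R snd b" for t
    by (simp add: base_def time\<gamma> dir\<gamma> line_eq algebra_simps)
  then have ray\<gamma>: "ray (\<gamma> t) = ray p" for t by (simp add: ray_def dir\<gamma> flip: t1)
  have "((\<lambda>s. ray p) has_derivative (\<lambda>h. h *\<^sub>R coord_deriv ray p (\<xi> p (chart_around M p)))) (at t1)"
    using along[OF ray_Cr, of t1] by (simp add: ray\<gamma> t1)
  from has_derivative_unique[OF this has_derivative_const]
  show "coord_deriv ray p (\<xi> p (chart_around M p)) = 0" by (metis scaleR_one)
  \<comment> \<open>The shift by c0 turns the parameter of the curve into its time.\<close>
  have "is_ray p (\<lambda>s. \<gamma> (s - c0))"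
    unfolding is_ray_def
  proof (intro conjI allI)
    have "continuous_map euclidean euclidean (\<lambda>s::real. s - c0)" by (simp add: continuous_intros)
    from continuous_map_compose[OF this cont] show "continuous_map euclidean (mtop M) (\<lambda>s. \<gamma> (s - c0))"
      by (simp add: o_def)
    have "time p = t1 + c0" using time\<gamma>[of t1] t1 by simp
    then show "\<gamma> (time p - c0) = p" using t1 by simp
  qed (simp_all add: time\<gamma> ray\<gamma>)
  then show "\<exists>\<sigma>. is_ray p \<sigma>" by blast
qed

end

section \<open>Flow boxes and the flow along the rays\<close>

text \<open>The last parameter only fixes the model space of the time slice.\<close>

locale complete_null_front_flow = complete_null_front r M F \<alpha> \<xi>
  for r and M :: "('a, real ^ 'n) mfd" and F and \<alpha> :: "'a \<Rightarrow> 'n codual" and \<xi> +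
  fixes model :: "'m::finite itself"
  assumes dims: "CARD('n) \<ge> 2" "CARD('m) = CARD('n) - 1"
begin

text \<open>In a flow box around \<open>p\<close>, the map \<open>\<theta>\<close> inverts the coordinates given by time and by a linear
  function of the ray.\<close>

definition flow_box ::
  "'a \<Rightarrow> ((real ^ 'n) \<times> (real ^ 'n) \<Rightarrow> real ^ 'm) \<Rightarrow> real \<Rightarrow> (real ^ 'm) set \<Rightarrow> 'a set \<Rightarrow>
    (real \<times> (real ^ 'm) \<Rightarrow> 'a) \<Rightarrow> bool" where
  "flow_box p A \<epsilon> B W \<theta> \<longleftrightarrow> bounded_linear A \<and> \<epsilon> > 0 \<and> open B \<and> openin (mtop M) W \<and> p \<in> W \<and>
     Cr_param ({time p - \<epsilon><..<time p + \<epsilon>} \<times> B) \<theta> \<and>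
     (\<forall>q\<in>W. time q \<in> {time p - \<epsilon><..<time p + \<epsilon>} \<and> A (ray q) \<in> B \<and> \<theta> (time q, A (ray q)) = q) \<and>
     (\<forall>t\<in>{time p - \<epsilon><..<time p + \<epsilon>}. \<forall>y\<in>B.
        \<theta> (t, y) \<in> W \<and> time (\<theta> (t, y)) = t \<and> A (ray (\<theta> (t, y))) = y)"

lemma flow_boxD:
  assumes "flow_box p A \<epsilon> B W \<theta>"
  shows "bounded_linear A" "\<epsilon> > 0" "open B" "openin (mtop M) W" "p \<in> W"
    "Cr_param ({time p - \<epsilon><..<time p + \<epsilon>} \<times> B) \<theta>"
    "q \<in> W \<Longrightarrow> time q \<in> {time p - \<epsilon><..<time p + \<epsilon>}"
    "q \<in> W \<Longrightarrow> A (ray q) \<in> B"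
    "q \<in> W \<Longrightarrow> \<theta> (time q, A (ray q)) = q"
    "t \<in> {time p - \<epsilon><..<time p + \<epsilon>} \<Longrightarrow> y \<in> B \<Longrightarrow> \<theta> (t, y) \<in> W"
    "t \<in> {time p - \<epsilon><..<time p + \<epsilon>} \<Longrightarrow> y \<in> B \<Longrightarrow> time (\<theta> (t, y)) = t"
    "t \<in> {time p - \<epsilon><..<time p + \<epsilon>} \<Longrightarrow> y \<in> B \<Longrightarrow> A (ray (\<theta> (t, y))) = y"
  using assms unfolding flow_box_def by simp_all

text \<open>The null field spans a complement to the kernel of the differential of time and is
  killed by the differential of the ray. So the range of the latter is the image of a hyperplane, of
  dimension at most m, and some linear A is isometric on it. Injectivity then reduces to that of
  time and ray together, and bijectivity follows by counting dimensions.\<close>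

lemma ray_projection_ex:
  assumes p: "p \<in> carrier_of M"
  shows "\<exists>A :: (real ^ 'n) \<times> (real ^ 'n) \<Rightarrow> real ^ 'm. bounded_linear A \<and>
    bij (\<lambda>v. (coord_deriv time p v, A (coord_deriv ray p v)))"
proof -
  let ?Dt = "coord_deriv time p" and ?Dr = "coord_deriv ray p" and ?w = "\<xi> p (chart_around M p)"
  have Dt: "linear ?Dt" and Dr: "linear ?Dr"
    using has_derivative_linear[OF coord_deriv_has_derivative[OF time_Cr p]]
      has_derivative_linear[OF coord_deriv_has_derivative[OF ray_Cr p]] by simp_all
  note w = along_null_field(2,3)[OF p]
  \<comment> \<open>The gradient of time in coordinates, which presents the kernel as a
    hyperplane.\<close>
  define a where "a = (\<Sum>b\<in>Basis. ?Dt b *\<^sub>R b)"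
  have a: "?Dt v = a \<bullet> v" for v
    using linear_expand[OF Dt, of v] by (simp add: a_def inner_sum_left inner_commute[of v] mult.commute)
  have "a \<noteq> 0" using w(1) a by auto
  then have dimK: "dim {v. a \<bullet> v = 0} = CARD('m)"
    using dim_hyperplane[of a] dims by simp
  \<comment> \<open>Subtracting a multiple of the null field moves v into the kernel without
    changing its image.\<close>
  have "range ?Dr \<subseteq> ?Dr ` {v. a \<bullet> v = 0}"
  proof (rule image_subsetI)
    fix v
    have "?Dr v = ?Dr (v - ?Dt v *\<^sub>R ?w)"
      by (simp add: linear_diff[OF Dr] linear_scale[OF Dr] w)
    moreover have "a \<bullet> (v - ?Dt v *\<^sub>R ?w) = 0"
      by (simp add: a[symmetric] linear_diff[OF Dt] linear_scale[OF Dt] w)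
    ultimately show "?Dr v \<in> ?Dr ` {v. a \<bullet> v = 0}" by blast
  qed
  then have "dim (range ?Dr) \<le> dim (?Dr ` {v. a \<bullet> v = 0})" by (rule dim_subset)
  also have "\<dots> \<le> CARD('m)" using dim_image_le[OF Dr, of "{v. a \<bullet> v = 0}"] by (simp add: dimK)
  finally have dimr: "dim (range ?Dr) \<le> dim (UNIV :: (real ^ 'm) set)" by simp
  have sub: "subspace (range ?Dr)" by (rule linear_subspace_image[OF Dr subspace_UNIV])
  obtain A :: "(real ^ 'n) \<times> (real ^ 'n) \<Rightarrow> real ^ 'm"
    where A: "linear A" "\<And>x. x \<in> range ?Dr \<Longrightarrow> norm (A x) = norm x"
    by (rule isometry_subset_subspace[OF sub subspace_UNIV dimr]) blast
  let ?L = "\<lambda>v. (?Dt v, A (?Dr v))"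
  have L: "linear ?L"
    by (rule linearI) (simp_all add: linear_add[OF Dt] linear_add[OF Dr] linear_add[OF A(1)]
        linear_scale[OF Dt] linear_scale[OF Dr] linear_scale[OF A(1)])
  have inj: "inj ?L"
    unfolding linear_injective_0[OF L]
  proof (intro allI impI)
    fix v assume "?L v = 0"
    then have "?Dt v = 0" "A (?Dr v) = 0" by (simp_all add: prod_eq_iff)
    then show "v = 0" using coord_deriv_time_ray_inj[OF p, of v] A(2)[of "?Dr v"] by simp
  qed
  have "dim (range ?L) = DIM(real ^ 'n)"
    using dim_image_eq[OF L, of UNIV] inj by (simp add: dim_UNIV)
  then have "dim (range ?L) = DIM(real \<times> (real ^ 'm))" using dims by simp
  then have "span (range ?L) = UNIV" by (simp only: dim_eq_full)
  moreover have "span (range ?L) = range ?L"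
    by (rule iffD2[OF span_eq_iff linear_subspace_image[OF L subspace_UNIV]])
  ultimately have "range ?L = UNIV" by simp
  then have "bij ?L" using inj by (simp add: bij_def)
  then show ?thesis using A(1) linear_conv_bounded_linear by blast
qed

text \<open>The inverse function theorem for time together with the projected ray.\<close>

lemma flow_box_ex:
  assumes p: "p \<in> carrier_of M"
  shows "\<exists>A \<epsilon> B W \<theta>. flow_box p A \<epsilon> B W \<theta>"
proof -
  obtain A :: "(real ^ 'n) \<times> (real ^ 'n) \<Rightarrow> real ^ 'm" where A: "bounded_linear A"
    and bij: "bij (\<lambda>v. (coord_deriv time p v, A (coord_deriv ray p v)))"
    using ray_projection_ex[OF p] by blast
  let ?c = "chart_around M p"
  note c = chart_around[OF p]
  let ?X = "snd ?c ` fst ?c" and ?x = "snd ?c p"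
  note X = chart_open_range[OF c(1)]
  define f where "f x = (time (chart_inv ?c x), A (ray (chart_inv ?c x)))" for x
  have f: "Cr_on r ?X f"
    unfolding f_def by (rule Cr_on_Pair[OF X Cr_vec_mapD[OF time_Cr c(1)]
          Cr_on_bounded_linear[OF X A Cr_vec_mapD[OF ray_Cr c(1)]]])
  have "(f has_derivative (\<lambda>v. (coord_deriv time p v, A (coord_deriv ray p v)))) (at ?x)"
    unfolding f_def
    by (intro has_derivative_Pair bounded_linear.has_derivative[OF A] coord_deriv_has_derivative time_Cr ray_Cr p)
  then have bij': "bij (frechet_derivative f (at ?x))" using bij by (simp only: frechet_derivativeI)
  have x: "?x \<in> ?X" using c(2) by (rule imageI)
  obtain U V g where g: "open U" "U \<subseteq> ?X" "?x \<in> U" "open V" "f ?x \<in> V" "homeomorphism U V f g" "Cr_on r V g"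
    by (rule Cr_inverse_function[OF X f x bij'])
  have fchart: "f (snd ?c q) = (time q, A (ray q))" if "q \<in> fst ?c" for q
    by (simp add: f_def chart_inv_left[OF c(1) that])
  have "(time p, A (ray p)) \<in> V" using g(5) fchart[OF c(2)] by simp
  \<comment> \<open>A product neighbourhood: with the ray fixed, the whole time interval can then be
    traversed inside the box.\<close>
  then obtain T B where T: "open T" "open B" "(time p, A (ray p)) \<in> T \<times> B" "T \<times> B \<subseteq> V"
    by (rule open_prod_elim[OF g(4)])
  have "time p \<in> T" using T(3) by simp
  then obtain \<epsilon> where \<epsilon>: "\<epsilon> > 0" "ball (time p) \<epsilon> \<subseteq> T"
    by (rule openE[OF T(1)])
  define I where "I = {time p - \<epsilon><..<time p + \<epsilon>}"
  have I: "open I" "time p \<in> I" "I \<subseteq> T" using \<epsilon> by (auto simp: I_def ball_eq_greaterThanLessThan)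
  have IB: "open (I \<times> B)" "I \<times> B \<subseteq> V" using I T by (auto intro: open_Times)
  define \<theta> where "\<theta> z = chart_inv ?c (g z)" for z
  define W where "W = {q \<in> fst ?c. snd ?c q \<in> U \<inter> f -` (I \<times> B)}"
  have gf: "g (f x) = x" if "x \<in> U" for x using g(6) that by (simp add: homeomorphism_def)
  have fg: "g z \<in> U" "f (g z) = z" if "z \<in> V" for z using g(6) that by (auto simp: homeomorphism_def)
  have "flow_box p A \<epsilon> B W \<theta>"
    unfolding flow_box_def I_def[symmetric]
  proof (intro conjI ballI)
    have "open (U \<inter> f -` (I \<times> B))"
      by (rule continuous_open_preimage[OF continuous_on_subset[OF Cr_on_continuous[OF f] g(2)] g(1) IB(1)])
    then show "openin (mtop M) W" unfolding W_def by (rule chart_preimage_openin[OF c(1)])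
    show "p \<in> W" using c(2) g(3) fchart[OF c(2)] I(2) T(3) by (simp add: W_def)
    have gU: "g ` (I \<times> B) \<subseteq> ?X" using fg(1) IB(2) g(2) by blast
    show "Cr_param (I \<times> B) \<theta>"
      unfolding \<theta>_def
      by (rule Cr_param_compose[OF Cr_param_chart_inv[OF c(1)] IB(1) Cr_on_subset[OF g(7) IB] gU])
    fix q assume "q \<in> W"
    then have q: "q \<in> fst ?c" "snd ?c q \<in> U" "f (snd ?c q) \<in> I \<times> B" by (auto simp: W_def)
    then show "time q \<in> I" "A (ray q) \<in> B" by (simp_all add: fchart)
    show "\<theta> (time q, A (ray q)) = q"
      using gf[OF q(2)] by (simp add: \<theta>_def fchart[OF q(1)] chart_inv_left[OF c(1) q(1)])
  next
    fix t y assume ty: "t \<in> I" "y \<in> B"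
    then have z: "(t, y) \<in> V" using IB(2) by blast
    then have gX: "g (t, y) \<in> ?X" using fg(1)[OF z] g(2) by blast
    note \<theta> = chart_inv_right[OF gX]
    show "\<theta> (t, y) \<in> W" using \<theta> fg[OF z] ty by (simp add: W_def \<theta>_def)
    have "f (g (t, y)) = (time (\<theta> (t, y)), A (ray (\<theta> (t, y))))" by (simp add: f_def \<theta>_def)
    then show "time (\<theta> (t, y)) = t" "A (ray (\<theta> (t, y))) = y" using fg(2)[OF z] by simp_all
  qed (use A \<epsilon>(1) T(2) in auto)
  then show ?thesis by blast
qed

section \<open>Rays inside flow boxes and their uniqueness\<close>

lemma separate_points:
  assumes "p \<in> carrier_of M" "q \<in> carrier_of M" "p \<noteq> q"
  obtains O1 O2 where "openin (mtop M) O1" "openin (mtop M) O2" "p \<in> O1" "q \<in> O2" "O1 \<inter> O2 = {}"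
proof -
  have "Hausdorff_space (mtop M)" using mfd by (simp add: Cr_manifold_def)
  then have "\<exists>O1 O2. openin (mtop M) O1 \<and> openin (mtop M) O2 \<and> p \<in> O1 \<and> q \<in> O2 \<and> disjnt O1 O2"
    using assms unfolding Hausdorff_space_def by simp
  then show thesis using that unfolding disjnt_def by blast
qed

lemma open_curve_preimage:
  assumes "continuous_map euclidean (mtop M) \<sigma>" "openin (mtop M) V"
  shows "open {s :: real. \<sigma> s \<in> V}"
  using openin_continuous_map_preimage[OF assms] by simp

text \<open>Inside W a point is determined by time and ray, so the curve can differ from the
  coordinate line only by leaving W. The times spent in W form an open set; the times at which the
  two curves differ form an open set by the Hausdorff property. In the interval these sets are
  disjoint and cover everything, so connectedness excludes leaving.\<close>

lemma ray_in_flow_box: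
  assumes box: "flow_box p A \<epsilon> B W \<theta>"
    and \<sigma>: "continuous_map euclidean (mtop M) \<sigma>" "\<And>s. time (\<sigma> s) = s" "\<And>s. ray (\<sigma> s) = \<rho>"
    and s0: "\<sigma> s0 \<in> W"
    and s: "s \<in> {time p - \<epsilon><..<time p + \<epsilon>}"
  shows "\<sigma> s = \<theta> (s, A \<rho>)" "A \<rho> \<in> B"
proof -
  let ?I = "{time p - \<epsilon><..<time p + \<epsilon>}"
  note D = flow_boxD[OF box]
  show B: "A \<rho> \<in> B" using D(8)[OF s0] \<sigma>(3) by simp
  have inW: "\<sigma> s = \<theta> (s, A \<rho>)" if "\<sigma> s \<in> W" for s
    using D(9)[OF that] \<sigma>(2,3) by simp
  have car: "\<sigma> s \<in> carrier_of M" for s using continuous_map_funspace[OF \<sigma>(1)] by auto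
  have par: "Cr_param ?I (\<lambda>s. \<theta> (s, A \<rho>))"
  proof (rule Cr_param_compose[OF D(6)])
    have "open ?I" by simp
    then show "Cr_on r ?I (\<lambda>s. (s, A \<rho>))"
      by (intro Cr_on_Pair Cr_on_const Cr_on_linear[OF _ bounded_linear_ident])
  qed (use B in auto)
  let ?T = "{s. \<sigma> s \<in> W}" and ?T' = "{s \<in> ?I. \<sigma> s \<noteq> \<theta> (s, A \<rho>)}"
  have "open ?T" by (rule open_curve_preimage[OF \<sigma>(1) D(4)])
  moreover have "open ?T'"
  proof (subst open_subopen, intro ballI)
    fix s1 assume s1: "s1 \<in> ?T'"
    then obtain O1 O2 where O: "openin (mtop M) O1" "openin (mtop M) O2" "\<sigma> s1 \<in> O1"
      "\<theta> (s1, A \<rho>) \<in> O2" "O1 \<inter> O2 = {}"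
      using separate_points[OF car Cr_paramD(2)[OF par], of s1 s1] by blast
    let ?N = "{s. \<sigma> s \<in> O1} \<inter> {s \<in> ?I. \<theta> (s, A \<rho>) \<in> O2}"
    have "open ?N"
      by (rule open_Int[OF open_curve_preimage[OF \<sigma>(1) O(1)] Cr_param_open_preimage[OF par O(2)]])
    then show "\<exists>N. open N \<and> s1 \<in> N \<and> N \<subseteq> ?T'"
      using s1 O(3-5) by (intro exI[of _ ?N]) auto
  qed
  moreover have "connected ?I" by (rule connected_Ioo)
  moreover have "?T \<inter> ?T' \<inter> ?I = {}" using inW by auto
  moreover have "?I \<subseteq> ?T \<union> ?T'"
  proof
    fix s assume s: "s \<in> ?I"
    show "s \<in> ?T \<union> ?T'"
      using D(10)[OF s B] s by (cases "\<sigma> s = \<theta> (s, A \<rho>)") auto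
  qed
  moreover have "s0 \<in> ?T \<inter> ?I" using s0 D(7)[OF s0] \<sigma>(2) by simp
  ultimately have "?T' \<inter> ?I = {}" using connectedD[of ?I ?T ?T'] by blast
  then show "\<sigma> s = \<theta> (s, A \<rho>)" using s by auto
qed

text \<open>The set of times of agreement is open by flow boxes and closed by the Hausdorff
  property.\<close>

lemma ray_unique:
  assumes \<sigma>: "continuous_map euclidean (mtop M) \<sigma>" "\<And>s. time (\<sigma> s) = s" "\<And>s. ray (\<sigma> s) = \<rho>"
    and \<tau>: "continuous_map euclidean (mtop M) \<tau>" "\<And>s. time (\<tau> s) = s" "\<And>s. ray (\<tau> s) = \<rho>"
    and s0: "\<sigma> s0 = \<tau> s0"
  shows "\<sigma> = \<tau>"
proof -
  have car: "\<sigma> s \<in> carrier_of M" "\<tau> s \<in> carrier_of M" for s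
    using continuous_map_funspace[OF \<sigma>(1)] continuous_map_funspace[OF \<tau>(1)] by auto
  let ?T = "{s. \<sigma> s = \<tau> s}" and ?T' = "{s. \<sigma> s \<noteq> \<tau> s}"
  have "open ?T"
  proof (subst open_subopen, intro ballI)
    fix s1 assume s1: "s1 \<in> ?T"
    obtain A \<epsilon> B W \<theta> where box: "flow_box (\<sigma> s1) A \<epsilon> B W \<theta>" using flow_box_ex[OF car(1)] by blast
    note D = flow_boxD[OF box]
    let ?I = "{time (\<sigma> s1) - \<epsilon><..<time (\<sigma> s1) + \<epsilon>}"
    have \<tau>W: "\<tau> s1 \<in> W" using D(5) s1 by simp
    have "?I \<subseteq> ?T"
    proof
      fix s assume s: "s \<in> ?I"
      show "s \<in> ?T"
        using ray_in_flow_box(1)[OF box \<sigma> D(5) s] ray_in_flow_box(1)[OF box \<tau> \<tau>W s] by simp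
    qed
    moreover have "s1 \<in> ?I" using D(2) \<sigma>(2) by simp
    ultimately show "\<exists>N. open N \<and> s1 \<in> N \<and> N \<subseteq> ?T" by (intro exI[of _ ?I]) auto
  qed
  moreover have "open ?T'"
  proof (subst open_subopen, intro ballI)
    fix s1 assume s1: "s1 \<in> ?T'"
    then obtain O1 O2 where O: "openin (mtop M) O1" "openin (mtop M) O2" "\<sigma> s1 \<in> O1"
      "\<tau> s1 \<in> O2" "O1 \<inter> O2 = {}"
      using separate_points[OF car(1,2), of s1 s1] by blast
    let ?N = "{s. \<sigma> s \<in> O1} \<inter> {s. \<tau> s \<in> O2}"
    have "open ?N"
      by (rule open_Int[OF open_curve_preimage[OF \<sigma>(1) O(1)] open_curve_preimage[OF \<tau>(1) O(2)]])
    then show "\<exists>N. open N \<and> s1 \<in> N \<and> N \<subseteq> ?T'"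
      using s1 O(3-5) by (intro exI[of _ ?N]) auto
  qed
  ultimately have "?T' = {}"
    using connectedD[of "UNIV :: real set" ?T ?T'] connected_UNIV s0 by blast
  then show ?thesis by auto
qed

text \<open>The parameter is the absolute time reached, not the time elapsed.\<close>

definition flow :: "real \<Rightarrow> 'a \<Rightarrow> 'a" where
  "flow t p = (SOME \<sigma>. is_ray p \<sigma>) t"

lemma flow_is_ray: "p \<in> carrier_of M \<Longrightarrow> is_ray p (\<lambda>t. flow t p)"
  unfolding flow_def using someI_ex[OF along_null_field(1)] by simp

lemma flow:
  assumes "p \<in> carrier_of M"
  shows "continuous_map euclidean (mtop M) (\<lambda>t. flow t p)" "time (flow t p) = t"
    "ray (flow t p) = ray p" "flow (time p) p = p" "flow t p \<in> carrier_of M"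
proof -
  show cont: "continuous_map euclidean (mtop M) (\<lambda>t. flow t p)"
    and "time (flow t p) = t" "ray (flow t p) = ray p" "flow (time p) p = p"
    using flow_is_ray[OF assms] unfolding is_ray_def by blast+
  show "flow t p \<in> carrier_of M" using continuous_map_funspace[OF cont] by auto
qed

text \<open>With absolute time the intermediate stop leaves no trace, in place of the usual additive
  group law.\<close>

lemma flow_flow:
  assumes "p \<in> carrier_of M"
  shows "flow t (flow s p) = flow t p"
proof -
  let ?q = "flow s p"
  note q = flow[OF flow(5)[OF assms, of s]] and p = flow[OF assms]
  have "flow s ?q = ?q" using q(4) by (simp only: p(2))
  moreover have "ray (flow t ?q) = ray p" for t by (simp only: q(3) p(3))
  ultimately have "(\<lambda>t. flow t ?q) = (\<lambda>t. flow t p)"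
    by (intro ray_unique[OF q(1,2) _ p(1,2,3)])
  then show ?thesis by (rule fun_cong)
qed

lemma flow_in_flow_box:
  assumes "flow_box z A \<epsilon> B W \<theta>" "q \<in> carrier_of M" "flow s0 q \<in> W"
    "s \<in> {time z - \<epsilon><..<time z + \<epsilon>}"
  shows "flow s q = \<theta> (s, A (ray q))" "A (ray q) \<in> B"
  using ray_in_flow_box[OF assms(1) flow(1-3)[OF assms(2)] assms(3,4)] by simp_all

text \<open>Continuity in the point, for a fixed time, is localized at p so that it can be
  propagated in t along a single ray.\<close>

definition flow_cont_at :: "'a \<Rightarrow> real \<Rightarrow> bool" where
  "flow_cont_at p t \<longleftrightarrow> (\<forall>V. openin (mtop M) V \<longrightarrow> flow t p \<in> V \<longrightarrow>
     (\<exists>N. openin (mtop M) N \<and> p \<in> N \<and> (\<forall>q\<in>N. flow t q \<in> V)))"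

text \<open>If the rays of all points near p meet one box, then at the times of that box the flow is
  \<theta> (t, A (ray q)), visibly continuous in q.\<close>

lemma flow_cont_at_box:
  assumes box: "flow_box z A \<epsilon> B W \<theta>"
    and N: "openin (mtop M) N" "p \<in> N" "\<And>q. q \<in> N \<Longrightarrow> \<exists>s. flow s q \<in> W"
    and t: "t \<in> {time z - \<epsilon><..<time z + \<epsilon>}"
  shows "flow_cont_at p t"
  unfolding flow_cont_at_def
proof (intro allI impI)
  fix V assume V: "openin (mtop M) V" "flow t p \<in> V"
  note D = flow_boxD[OF box]
  have car: "q \<in> carrier_of M" if "q \<in> N" for q using openin_subset[OF N(1)] that by blast
  have eq: "flow t q = \<theta> (t, A (ray q))" "A (ray q) \<in> B" if "q \<in> N" for q
    using N(3)[OF that] flow_in_flow_box[OF box car[OF that] _ t] by blast+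
  have par: "Cr_param B (\<lambda>y. \<theta> (t, y))"
  proof (rule Cr_param_compose[OF D(6) D(3)])
    show "Cr_on r B (\<lambda>y. (t, y))"
      by (intro Cr_on_Pair Cr_on_const Cr_on_linear[OF _ bounded_linear_ident] D(3))
  qed (use t in auto)
  let ?Y = "{y \<in> B. \<theta> (t, y) \<in> V}"
  have "open (A -` ?Y)"
    by (rule open_vimage[OF Cr_param_open_preimage[OF par V(1)] linear_continuous_on[OF D(1)]])
  then have "openin (mtop M) {q \<in> carrier_of M. ray q \<in> A -` ?Y}"
    by (rule Cr_vec_map_openin_preimage[OF ray_Cr])
  then have "openin (mtop M) (N \<inter> {q \<in> carrier_of M. ray q \<in> A -` ?Y})" by (rule openin_Int[OF N(1)])
  moreover have "p \<in> N \<inter> {q \<in> carrier_of M. ray q \<in> A -` ?Y}" using N(2) eq[OF N(2)] V(2) car by simp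
  moreover have "\<forall>q \<in> N \<inter> {q \<in> carrier_of M. ray q \<in> A -` ?Y}. flow t q \<in> V" using eq by simp
  ultimately show "\<exists>N. openin (mtop M) N \<and> p \<in> N \<and> (\<forall>q\<in>N. flow t q \<in> V)" by blast
qed

text \<open>The set of times at which the flow is continuous at \<open>p\<close> is open and closed.\<close>

lemma flow_cont_at_all:
  assumes p: "p \<in> carrier_of M"
  shows "flow_cont_at p t"
proof -
  let ?J = "{t. flow_cont_at p t}" and ?J' = "{t. \<not> flow_cont_at p t}"
  \<comment> \<open>Around every time continuity at one time implies continuity at all neighbouring
    times; this makes both the set and its complement open.\<close>
  have loc: "\<exists>N. open N \<and> t0 \<in> N \<and> (\<forall>s\<in>N. \<forall>t\<in>N. flow_cont_at p s \<longrightarrow> flow_cont_at p t)" for t0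
  proof -
    let ?z = "flow t0 p"
    obtain A \<epsilon> B W \<theta> where box: "flow_box ?z A \<epsilon> B W \<theta>" using flow_box_ex[OF flow(5)[OF p]] by blast
    note D = flow_boxD[OF box]
    let ?I = "{time ?z - \<epsilon><..<time ?z + \<epsilon>}"
    have step: "flow_cont_at p t" if s: "s \<in> ?I" and t: "t \<in> ?I" and cs: "flow_cont_at p s" for s t
    proof -
      have "flow s p \<in> W"
        using flow_in_flow_box[OF box p D(5) s] D(10)[OF s] by simp
      then obtain N where N: "openin (mtop M) N" "p \<in> N" "\<forall>q\<in>N. flow s q \<in> W"
        using cs D(4) unfolding flow_cont_at_def by blast
      show ?thesis by (rule flow_cont_at_box[OF box N(1,2) _ t]) (use N(3) in blast)
    qed
    have "t0 \<in> ?I" using D(2) flow(2)[OF p] by simp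
    then show ?thesis
      by (intro exI[of _ ?I] conjI ballI impI) (simp, assumption, rule step)
  qed
  have "open ?J"
  proof (subst open_subopen, intro ballI)
    fix t0 assume "t0 \<in> ?J"
    then show "\<exists>N. open N \<and> t0 \<in> N \<and> N \<subseteq> ?J" using loc[of t0] by blast
  qed
  moreover have "open ?J'"
  proof (subst open_subopen, intro ballI)
    fix t0 assume "t0 \<in> ?J'"
    then show "\<exists>N. open N \<and> t0 \<in> N \<and> N \<subseteq> ?J'" using loc[of t0] by blast
  qed
  moreover have "flow_cont_at p (time p)"
  proof -
    obtain A \<epsilon> B W \<theta> where box: "flow_box p A \<epsilon> B W \<theta>" using flow_box_ex[OF p] by blast
    note D = flow_boxD[OF box]
    have "\<exists>s. flow s q \<in> W" if "q \<in> W" for q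
    proof -
      have "q \<in> carrier_of M" using openin_subset[OF D(4)] that by blast
      then have "flow (time q) q \<in> W" using flow(4) that by simp
      then show ?thesis by blast
    qed
    then show ?thesis using flow_cont_at_box[OF box D(4,5) _ D(7)[OF D(5)]] by blast
  qed
  ultimately have "?J' = {}"
    using connectedD[of "UNIV :: real set" ?J ?J'] connected_UNIV by blast
  then show ?thesis by blast
qed

lemma flow_openin:
  assumes "openin (mtop M) V"
  shows "openin (mtop M) {q \<in> carrier_of M. flow t q \<in> V}"
proof (subst openin_subopen, intro ballI)
  fix p assume p: "p \<in> {q \<in> carrier_of M. flow t q \<in> V}"
  then obtain N where N: "openin (mtop M) N" "p \<in> N" "\<forall>q\<in>N. flow t q \<in> V"
    using flow_cont_at_all[of p t] assms unfolding flow_cont_at_def by blast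
  then show "\<exists>N. openin (mtop M) N \<and> p \<in> N \<and> N \<subseteq> {q \<in> carrier_of M. flow t q \<in> V}"
    using openin_subset[OF N(1)] by (intro exI[of _ N]) auto
qed

text \<open>Near a given time and point the flow is \<open>\<theta> (t, A (ray q))\<close> for a flow box.\<close>

lemma Cr_param_flow:
  fixes \<kappa> :: "'k::euclidean_space \<Rightarrow> 'a"
  assumes \<kappa>: "Cr_param X \<kappa>" and T: "Cr_on r X T"
  shows "Cr_param X (\<lambda>x. flow (T x) (\<kappa> x))"
proof (rule Cr_param_localI[OF Cr_paramD(1)[OF \<kappa>]])
  fix x0 assume x0: "x0 \<in> X"
  note X = Cr_paramD(1)[OF \<kappa>] and car = Cr_paramD(2)[OF \<kappa>]
  let ?z = "flow (T x0) (\<kappa> x0)"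
  obtain A \<epsilon> B W \<theta> where box: "flow_box ?z A \<epsilon> B W \<theta>" using flow_box_ex[OF flow(5)[OF car[OF x0]]] by blast
  note D = flow_boxD[OF box]
  let ?I = "{time ?z - \<epsilon><..<time ?z + \<epsilon>}" and ?N = "{q \<in> carrier_of M. flow (T x0) q \<in> W}"
  let ?Y = "{x \<in> X. \<kappa> x \<in> ?N} \<inter> (X \<inter> T -` ?I)"
  have Y: "open ?Y"
    by (rule open_Int[OF Cr_param_open_preimage[OF \<kappa> flow_openin[OF D(4)]]
          continuous_open_preimage[OF Cr_on_continuous[OF T] X]]) simp
  have eq: "flow (T x) (\<kappa> x) = \<theta> (T x, A (ray (\<kappa> x)))" "A (ray (\<kappa> x)) \<in> B" if "x \<in> ?Y" for x
  proof -
    have "\<kappa> x \<in> carrier_of M" "flow (T x0) (\<kappa> x) \<in> W" "T x \<in> ?I" using that by auto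
    then show "flow (T x) (\<kappa> x) = \<theta> (T x, A (ray (\<kappa> x)))" "A (ray (\<kappa> x)) \<in> B"
      using flow_in_flow_box[OF box] by blast+
  qed
  have YX: "?Y \<subseteq> X" by blast
  have P: "Cr_param ?Y (\<lambda>x. \<theta> (T x, A (ray (\<kappa> x))))"
  proof (rule Cr_param_compose[OF D(6) Y])
    show "Cr_on r ?Y (\<lambda>x. (T x, A (ray (\<kappa> x))))"
      by (rule Cr_on_Pair[OF Y Cr_on_subset[OF T Y YX] Cr_on_bounded_linear[OF Y D(1)
              Cr_on_subset[OF Cr_vec_map_param[OF ray_Cr \<kappa>] Y YX]]])
    show "(\<lambda>x. (T x, A (ray (\<kappa> x)))) ` ?Y \<subseteq> ?I \<times> B" using eq(2) by auto
  qed
  have x0Y: "x0 \<in> ?Y" using x0 car[OF x0] D(2,5) flow(2)[OF car[OF x0]] by simp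
  show "\<exists>Y \<kappa>'. x0 \<in> Y \<and> Cr_param Y \<kappa>' \<and> (\<forall>y\<in>Y. \<kappa>' y = flow (T y) (\<kappa> y))"
    by (intro exI[of _ ?Y] exI[of _ "\<lambda>x. \<theta> (T x, A (ray (\<kappa> x)))"] conjI ballI x0Y P) (rule eq(1)[symmetric])
qed

section \<open>The time slice as a manifold\<close>

text \<open>This replaces the space of integral curves: each meets the slice exactly once, so no
  quotient has to be formed.\<close>

definition slice_set :: "'a set" where
  "slice_set = {p \<in> carrier_of M. time p = 0}"

text \<open>One choice of the whole tuple, so that its five components belong to the same
  box.\<close>

definition box_at :: "'a \<Rightarrow> ((real ^ 'n) \<times> (real ^ 'n) \<Rightarrow> real ^ 'm) \<times> real \<times> (real ^ 'm) set \<times> 'a set \<times>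
    (real \<times> (real ^ 'm) \<Rightarrow> 'a)" where
  "box_at p = (SOME (A, \<epsilon>, B, W, \<theta>). flow_box p A \<epsilon> B W \<theta>)"

definition proj_at :: "'a \<Rightarrow> (real ^ 'n) \<times> (real ^ 'n) \<Rightarrow> real ^ 'm" where
  "proj_at p = fst (box_at p)"

definition radius_at :: "'a \<Rightarrow> real" where
  "radius_at p = fst (snd (box_at p))"

definition range_at :: "'a \<Rightarrow> (real ^ 'm) set" where
  "range_at p = fst (snd (snd (box_at p)))"

definition nbhd_at :: "'a \<Rightarrow> 'a set" where
  "nbhd_at p = fst (snd (snd (snd (box_at p))))"

definition param_at :: "'a \<Rightarrow> real \<times> (real ^ 'm) \<Rightarrow> 'a" where
  "param_at p = snd (snd (snd (snd (box_at p))))"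

lemma box_at:
  assumes "p \<in> carrier_of M"
  shows "flow_box p (proj_at p) (radius_at p) (range_at p) (nbhd_at p) (param_at p)"
proof -
  have "\<exists>x. case x of (A, \<epsilon>, B, W, \<theta>) \<Rightarrow> flow_box p A \<epsilon> B W \<theta>"
    using flow_box_ex[OF assms] by simp
  from someI_ex[OF this] show ?thesis
    by (simp add: box_at_def proj_at_def radius_at_def range_at_def nbhd_at_def param_at_def case_prod_unfold)
qed

definition slice_chart :: "'a \<Rightarrow> ('a, real ^ 'm) chart" where
  "slice_chart z = (nbhd_at z \<inter> slice_set, \<lambda>q. proj_at z (ray q))"

definition slice :: "('a, real ^ 'm) mfd" where
  "slice = \<lparr>mtop = subtopology (mtop M) slice_set, atlas = slice_chart ` slice_set\<rparr>"

definition slice_param :: "'a \<Rightarrow> real ^ 'm \<Rightarrow> 'a" where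
  "slice_param z y = param_at z (0, y)"

lemma slice_subset: "slice_set \<subseteq> carrier_of M"
  by (auto simp: slice_set_def)

lemma carrier_slice: "carrier_of slice = slice_set"
  using slice_subset by (auto simp: slice_def)

lemma atlas_slice: "atlas slice = slice_chart ` slice_set"
  by (simp add: slice_def)

lemma slice_time: "x \<in> slice_set \<Longrightarrow> time x = 0"
  by (simp add: slice_set_def)

text \<open>The flow box at z with its time coordinate set to 0, which lies in the time interval
  because z has time 0.\<close>

lemma slice_box:
  assumes z: "z \<in> slice_set"
  shows "bounded_linear (proj_at z)" "open (range_at z)" "openin (mtop M) (nbhd_at z)"
    "z \<in> nbhd_at z \<inter> slice_set"
    "Cr_param (range_at z) (slice_param z)"
    "q \<in> nbhd_at z \<inter> slice_set \<Longrightarrow> proj_at z (ray q) \<in> range_at z"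
    "q \<in> nbhd_at z \<inter> slice_set \<Longrightarrow> slice_param z (proj_at z (ray q)) = q"
    "y \<in> range_at z \<Longrightarrow> slice_param z y \<in> nbhd_at z \<inter> slice_set"
    "y \<in> range_at z \<Longrightarrow> proj_at z (ray (slice_param z y)) = y"
proof -
  have car: "z \<in> carrier_of M" using z slice_subset by blast
  note D = flow_boxD[OF box_at[OF car]]
  show "bounded_linear (proj_at z)" "open (range_at z)" "openin (mtop M) (nbhd_at z)"
    by (rule D(1), rule D(3), rule D(4))
  show "z \<in> nbhd_at z \<inter> slice_set" using D(5) z by simp
  have I: "0 \<in> {time z - radius_at z<..<time z + radius_at z}" using D(2) slice_time[OF z] by simp
  show "Cr_param (range_at z) (slice_param z)"
    unfolding slice_param_def
  proof (rule Cr_param_compose[OF D(6) D(3)])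
    show "Cr_on r (range_at z) (\<lambda>y. (0 :: real, y))"
      by (intro Cr_on_Pair Cr_on_const Cr_on_linear[OF _ bounded_linear_ident] D(3))
  qed (use I in auto)
  show "proj_at z (ray q) \<in> range_at z" if "q \<in> nbhd_at z \<inter> slice_set" using D(8) that by blast
  show "slice_param z (proj_at z (ray q)) = q" if "q \<in> nbhd_at z \<inter> slice_set"
    using D(9)[of q] that by (simp add: slice_param_def slice_time)
  show "proj_at z (ray (slice_param z y)) = y" if "y \<in> range_at z"
    using D(12)[OF I that] by (simp add: slice_param_def)
  show "slice_param z y \<in> nbhd_at z \<inter> slice_set" if "y \<in> range_at z"
    using D(10,11)[OF I that] openin_subset[OF D(4)] by (auto simp: slice_param_def slice_set_def)
qed

lemma slice_chart_simps:
  "fst (slice_chart z) = nbhd_at z \<inter> slice_set" "snd (slice_chart z) = (\<lambda>q. proj_at z (ray q))"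
  by (simp_all add: slice_chart_def)

lemma slice_chart_image:
  assumes "z \<in> slice_set"
  shows "snd (slice_chart z) ` fst (slice_chart z) = range_at z"
  unfolding slice_chart_simps
proof (intro subset_antisym image_subsetI subsetI)
  fix y assume "y \<in> range_at z"
  then show "y \<in> (\<lambda>q. proj_at z (ray q)) ` (nbhd_at z \<inter> slice_set)"
    using slice_box(8,9)[OF assms, of y] by (intro image_eqI[of _ _ "slice_param z y"]) simp_all
qed (rule slice_box(6)[OF assms])

lemma slice_chart_inv:
  assumes z: "z \<in> slice_set" and y: "y \<in> range_at z"
  shows "chart_inv (slice_chart z) y = slice_param z y"
proof -
  have "inj_on (\<lambda>q. proj_at z (ray q)) (nbhd_at z \<inter> slice_set)"
    by (rule inj_on_inverseI[where g = "slice_param z"]) (rule slice_box(7)[OF z])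
  then show ?thesis
    unfolding chart_inv_def slice_chart_simps
    by (rule inv_into_f_eq) (rule slice_box(8)[OF z y], rule slice_box(9)[OF z y])
qed

lemma slice_vec_map:
  fixes h :: "'a \<Rightarrow> 'v::euclidean_space"
  assumes h: "Cr_vec_map r M h"
  shows "Cr_vec_map r slice h"
  unfolding Cr_vec_map_def atlas_slice
proof
  fix c assume "c \<in> slice_chart ` slice_set"
  then obtain z where z: "z \<in> slice_set" and c: "c = slice_chart z" by blast
  have "Cr_on r (range_at z) (\<lambda>y. h (slice_param z y))"
    by (rule Cr_vec_map_param[OF h slice_box(5)[OF z]])
  then have "Cr_on r (range_at z) (h \<circ> chart_inv (slice_chart z))"
    by (rule Cr_on_cong[OF slice_box(2)[OF z], rotated]) (simp add: slice_chart_inv[OF z])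
  then show "Cr_on r (snd c ` fst c) (h \<circ> chart_inv c)" by (simp only: c slice_chart_image[OF z])
qed

lemma slice_chart_homeomorphic:
  assumes z: "z \<in> slice_set"
  shows "homeomorphic_map (subtopology (mtop slice) (fst (slice_chart z))) (top_of_set (range_at z))
    (snd (slice_chart z))"
proof -
  let ?U = "nbhd_at z \<inter> slice_set"
  have top: "subtopology (mtop slice) (fst (slice_chart z)) = subtopology (mtop M) ?U"
    by (simp add: slice_def slice_chart_simps subtopology_subtopology Int_absorb1)
  have space: "topspace (subtopology (mtop M) ?U) = ?U" using slice_subset by auto
  have "continuous_map (mtop M) euclidean (\<lambda>q. proj_at z (ray q))"
    using continuous_map_compose[OF Cr_vec_map_continuous_map[OF ray_Cr], of euclidean "proj_at z"]
      linear_continuous_on[OF slice_box(1)[OF z]] by (simp add: o_def)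
  then have "continuous_map (subtopology (mtop M) ?U) (top_of_set (range_at z)) (\<lambda>q. proj_at z (ray q))"
    unfolding continuous_map_in_subtopology
    using slice_box(6)[OF z] space by (auto intro: continuous_map_from_subtopology)
  moreover have "continuous_map (top_of_set (range_at z)) (subtopology (mtop M) ?U) (slice_param z)"
    unfolding continuous_map_in_subtopology
    using slice_box(8)[OF z] Cr_param_continuous_map[OF slice_box(5)[OF z]] by auto
  ultimately have "homeomorphic_maps (subtopology (mtop M) ?U) (top_of_set (range_at z))
      (\<lambda>q. proj_at z (ray q)) (slice_param z)"
    unfolding homeomorphic_maps_def space using slice_box(7,9)[OF z] by simp
  then show ?thesis unfolding homeomorphic_map_maps top slice_chart_simps(2) by (rule exI[of _ "slice_param z"])
qed

lemma slice_manifold: "Cr_manifold r slice"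
  unfolding Cr_manifold_def
proof (intro conjI ballI)
  show "Hausdorff_space (mtop slice)" "second_countable (mtop slice)"
    using mfd by (simp_all add: slice_def Cr_manifold_def Hausdorff_space_subtopology second_countable_subtopology)
  show "case c of (U, \<phi>) \<Rightarrow> openin (mtop slice) U \<and> open (\<phi> ` U) \<and>
      homeomorphic_map (subtopology (mtop slice) U) (top_of_set (\<phi> ` U)) \<phi>" if c_atlas: "c \<in> atlas slice" for c
  proof -
    obtain z where z: "z \<in> slice_set" and c: "c = slice_chart z" using c_atlas unfolding atlas_slice by blast
    have "openin (mtop slice) (fst (slice_chart z))"
      using slice_box(3)[OF z] by (auto simp: slice_def slice_chart_simps openin_subtopology)
    then show ?thesis
      unfolding case_prod_unfold c slice_chart_image[OF z]
      by (intro conjI slice_box(2)[OF z] slice_chart_homeomorphic[OF z])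
  qed
  show "(\<Union>c\<in>atlas slice. fst c) = carrier_of slice"
    unfolding carrier_slice atlas_slice using slice_box(4) by (auto simp: slice_chart_simps)
  fix c d assume "c \<in> atlas slice" "d \<in> atlas slice"
  then obtain z z' where z: "z \<in> slice_set" "z' \<in> slice_set" and cd: "c = slice_chart z" "d = slice_chart z'"
    unfolding atlas_slice by blast
  let ?Y = "{y \<in> range_at z. slice_param z y \<in> nbhd_at z'}"
  have img: "snd c ` (fst c \<inter> fst d) = ?Y"
  proof (intro subset_antisym image_subsetI subsetI)
    show "snd c q \<in> ?Y" if "q \<in> fst c \<inter> fst d" for q
      using that slice_box(6,7)[OF z(1), of q] by (simp add: cd slice_chart_simps)
    fix y assume y: "y \<in> ?Y"
    then show "y \<in> snd c ` (fst c \<inter> fst d)"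
      using slice_box(8,9)[OF z(1), of y]
      by (intro image_eqI[of _ _ "slice_param z y"]) (simp_all add: cd slice_chart_simps)
  qed
  have Y: "open ?Y" by (rule Cr_param_open_preimage[OF slice_box(5)[OF z(1)] slice_box(3)[OF z(2)]])
  have "Cr_on r ?Y (\<lambda>y. proj_at z' (ray (slice_param z y)))"
    by (rule Cr_on_bounded_linear[OF Y slice_box(1)[OF z(2)]
          Cr_vec_map_param[OF ray_Cr Cr_param_subset[OF slice_box(5)[OF z(1)] Y]]]) blast
  then show "Cr_on r (snd c ` (fst c \<inter> fst d)) (snd d \<circ> chart_inv c)"
    unfolding img by (rule Cr_on_cong[OF Y, rotated]) (simp add: cd slice_chart_simps slice_chart_inv[OF z(1)])
qed

sublocale slice: Cr_mfd r slice
  by (rule Cr_mfd.intro[OF slice_manifold])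

lemma slice_chart_around:
  assumes x: "x \<in> slice_set"
  obtains z where "z \<in> slice_set" "chart_around slice x = slice_chart z" "x \<in> nbhd_at z \<inter> slice_set"
    "proj_at z (ray x) \<in> range_at z" "slice_param z (proj_at z (ray x)) = x"
    "snd (chart_around slice x) x = proj_at z (ray x)"
proof -
  have x': "x \<in> carrier_of slice" using x by (simp only: carrier_slice)
  obtain z where z: "z \<in> slice_set" "chart_around slice x = slice_chart z"
    using slice.chart_around(1)[OF x'] unfolding atlas_slice by blast
  have xz: "x \<in> nbhd_at z \<inter> slice_set"
    using slice.chart_around(2)[OF x'] unfolding z(2) slice_chart_simps .
  show thesis
    by (rule that[OF z xz slice_box(6,7)[OF z(1) xz]]) (simp add: z(2) slice_chart_simps)
qed

section \<open>Derivatives along the slice\<close>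

definition slice_incl_deriv :: "'a \<Rightarrow> real ^ 'm \<Rightarrow> real ^ 'n" where
  "slice_incl_deriv x = frechet_derivative (\<lambda>y. snd (chart_around M x) (chart_inv (chart_around slice x) y))
     (at (snd (chart_around slice x) x))"

text \<open>Chain rule through the inclusion, which carries facts about differentials from M to the
  slice.\<close>

lemma slice_coord_deriv:
  fixes h :: "'a \<Rightarrow> 'v::euclidean_space"
  assumes x: "x \<in> slice_set" and h: "Cr_vec_map r M h"
  shows "slice.coord_deriv h x v = coord_deriv h x (slice_incl_deriv x v)"
proof -
  obtain z where z: "z \<in> slice_set" "chart_around slice x = slice_chart z"
    "proj_at z (ray x) \<in> range_at z" "slice_param z (proj_at z (ray x)) = x"
    "snd (chart_around slice x) x = proj_at z (ray x)"
    by (rule slice_chart_around[OF x]) blast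
  have xc: "x \<in> carrier_of M" using x slice_subset by blast
  have xc': "x \<in> carrier_of slice" using x by (simp only: carrier_slice)
  let ?y = "proj_at z (ray x)" and ?c = "chart_around M x" and ?\<kappa> = "chart_inv (slice_chart z)"
  note c = chart_around[OF xc]
  have par: "Cr_param (range_at z) ?\<kappa>"
  proof (rule Cr_param_localI[OF slice_box(2)[OF z(1)]])
    show "\<exists>Y \<kappa>'. y \<in> Y \<and> Cr_param Y \<kappa>' \<and> (\<forall>y\<in>Y. \<kappa>' y = ?\<kappa> y)" if "y \<in> range_at z" for y
      by (intro exI[of _ "range_at z"] exI[of _ "slice_param z"] conjI ballI that slice_box(5)[OF z(1)]
          slice_chart_inv[OF z(1), symmetric])
  qed
  have \<kappa>y: "?\<kappa> ?y = x" using slice_chart_inv[OF z(1,3)] z(4) by simp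
  let ?N = "{y \<in> range_at z. ?\<kappa> y \<in> fst ?c}"
  have yN: "?y \<in> ?N" using z(3) \<kappa>y c(2) by simp
  have "((\<lambda>y. snd ?c (?\<kappa> y)) has_derivative slice_incl_deriv x) (at ?y)"
    unfolding slice_incl_deriv_def z(2,5)
    using Cr_on_has_derivative[OF Cr_paramD(4)[OF par c(1)] yN] z(2,5) by simp
  then have "((\<lambda>y. h (?\<kappa> y)) has_derivative (\<lambda>v. coord_deriv h (?\<kappa> ?y) (slice_incl_deriv x v))) (at ?y)"
    by (intro has_derivative_along[OF h _ _ Cr_paramD(3)[OF par c(1)] yN]) (simp_all add: \<kappa>y xc)
  moreover have "((\<lambda>y. h (?\<kappa> y)) has_derivative slice.coord_deriv h x) (at ?y)"
    using slice.coord_deriv_has_derivative[OF slice_vec_map[OF h] xc'] by (simp only: z(2) slice_chart_simps)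
  ultimately show ?thesis using has_derivative_unique \<kappa>y by metis
qed

lemma slice_coord_deriv_time:
  assumes x: "x \<in> slice_set"
  shows "slice.coord_deriv time x v = 0"
proof -
  have xc': "x \<in> carrier_of slice" using x by (simp only: carrier_slice)
  let ?c = "chart_around slice x"
  note c = slice.chart_around[OF xc']
  have "((\<lambda>y. time (chart_inv ?c y)) has_derivative (\<lambda>_. 0)) (at (snd ?c x))"
  proof (rule has_derivative_transform_within_open[OF has_derivative_const slice.chart_open_range[OF c(1)]])
    show "snd ?c x \<in> snd ?c ` fst ?c" using c(2) by (rule imageI)
    show "0 = time (chart_inv ?c y)" if "y \<in> snd ?c ` fst ?c" for y
      using slice.chart_inv_carrier[OF c(1) that] slice_time by (simp add: carrier_slice)
  qed
  from has_derivative_unique[OF slice.coord_deriv_has_derivative[OF slice_vec_map[OF time_Cr] xc'] this]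
  show ?thesis by simp
qed

text \<open>The charts of the slice are themselves linear functions of the ray, so the ray cannot
  lose a direction there.\<close>

lemma slice_coord_deriv_inj:
  assumes x: "x \<in> slice_set" and w: "slice.coord_deriv ray x w = 0"
  shows "w = 0"
proof -
  obtain z where z: "z \<in> slice_set" "chart_around slice x = slice_chart z"
    "proj_at z (ray x) \<in> range_at z" "snd (chart_around slice x) x = proj_at z (ray x)"
    by (rule slice_chart_around[OF x]) blast
  have xc': "x \<in> carrier_of slice" using x by (simp only: carrier_slice)
  let ?y = "proj_at z (ray x)" and ?\<kappa> = "chart_inv (slice_chart z)"
  have "((\<lambda>y. ray (?\<kappa> y)) has_derivative slice.coord_deriv ray x) (at ?y)"
    using slice.coord_deriv_has_derivative[OF slice_vec_map[OF ray_Cr] xc'] by (simp only: z(2) slice_chart_simps)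
  then have "((\<lambda>y. proj_at z (ray (?\<kappa> y))) has_derivative (\<lambda>v. proj_at z (slice.coord_deriv ray x v))) (at ?y)"
    by (rule bounded_linear.has_derivative[OF slice_box(1)[OF z(1)]])
  moreover have "((\<lambda>y. proj_at z (ray (?\<kappa> y))) has_derivative (\<lambda>v. v)) (at ?y)"
    by (rule has_derivative_transform_within_open[OF has_derivative_ident slice_box(2)[OF z(1)] z(3)])
      (simp add: slice_chart_inv[OF z(1)] slice_box(9)[OF z(1)])
  ultimately have "proj_at z (slice.coord_deriv ray x w) = w" by (metis has_derivative_unique)
  then show ?thesis
    using w linear_0[OF bounded_linear.linear[OF slice_box(1)[OF z(1)]]] by simp
qed

section \<open>The front in the time slice and the diffeomorphism\<close>

text \<open>On the slice it coincides with \<open>base\<close>, and it is simpler to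
  differentiate.\<close>

definition foot :: "'a \<Rightarrow> real ^ 'n" where
  "foot p = snd (F p)"

lemma foot_Cr: "Cr_vec_map r M foot"
  unfolding Cr_vec_map_iff foot_def
  by (intro ballI Cr_on_bounded_linear[OF chart_open_range bounded_linear_snd Cr_vec_mapD[OF F_Cr]])

lemma coord_deriv_foot:
  assumes p: "p \<in> carrier_of M"
  shows "coord_deriv foot p w = snd (coord_deriv F p w)"
proof -
  have "((\<lambda>x. foot (chart_inv (chart_around M p) x)) has_derivative (\<lambda>w. snd (coord_deriv F p w)))
      (at (snd (chart_around M p) p))"
    unfolding foot_def by (intro has_derivative_snd coord_deriv_has_derivative F_Cr p)
  from has_derivative_unique[OF coord_deriv_has_derivative[OF foot_Cr p] this] show ?thesis by simp
qed

text \<open>\<alpha> annihilates the image of the differential of \<open>F\<close>; along the slice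
  the time part of that image is 0, and what remains of \<alpha> is a nonzero multiple of the
  product with \<open>dir\<close>.\<close>

lemma dir_orthogonal_foot:
  assumes x: "x \<in> slice_set"
  shows "dir x \<bullet> slice.coord_deriv foot x v = 0"
proof -
  have xc: "x \<in> carrier_of M" using x slice_subset by blast
  let ?w = "slice_incl_deriv x v"
  obtain v' where v': "v' \<in> tangent_space M x" "v' (chart_around M x) = ?w"
    using tangent_space_ex[OF chart_around_charts_at[OF xc]] by blast
  have "blinfun_apply (\<alpha> x) (vec_differential M F x v') = 0"
    using front xc v'(1) unfolding null_wave_front_def wave_front_def by blast
  then have "blinfun_apply (\<alpha> x) (coord_deriv F x ?w) = 0" by (simp add: vec_differential_eq v'(2))
  moreover have "fst (coord_deriv F x ?w) = 0"
    using slice_coord_deriv_time[OF x, of v] slice_coord_deriv[OF x time_Cr, of v]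
    by (simp add: coord_deriv_F[OF xc])
  ultimately have "dir x \<bullet> snd (coord_deriv F x ?w) = 0"
    using dual_nonzero[OF xc] by (simp add: \<alpha>_apply[OF xc])
  then show ?thesis by (simp only: slice_coord_deriv[OF x foot_Cr] coord_deriv_foot[OF xc])
qed

lemma slice_coord_deriv_ray:
  assumes x: "x \<in> slice_set"
  shows "slice.coord_deriv ray x v = (slice.coord_deriv foot x v, slice.coord_deriv dir x v)"
proof -
  have xc': "x \<in> carrier_of slice" using x by (simp only: carrier_slice)
  let ?c = "chart_around slice x"
  note c = slice.chart_around[OF xc']
  have "((\<lambda>y. (foot (chart_inv ?c y), dir (chart_inv ?c y))) has_derivative
      (\<lambda>v. (slice.coord_deriv foot x v, slice.coord_deriv dir x v))) (at (snd ?c x))"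
    by (intro has_derivative_Pair slice.coord_deriv_has_derivative slice_vec_map foot_Cr dir_Cr xc')
  then have "((\<lambda>y. ray (chart_inv ?c y)) has_derivative
      (\<lambda>v. (slice.coord_deriv foot x v, slice.coord_deriv dir x v))) (at (snd ?c x))"
  proof (rule has_derivative_transform_within_open[OF _ slice.chart_open_range[OF c(1)]])
    show "snd ?c x \<in> snd ?c ` fst ?c" using c(2) by (rule imageI)
    show "(foot (chart_inv ?c y), dir (chart_inv ?c y)) = ray (chart_inv ?c y)" if "y \<in> snd ?c ` fst ?c" for y
      using slice.chart_inv_carrier[OF c(1) that] slice_time
      by (simp add: carrier_slice ray_def base_def foot_def)
  qed
  from has_derivative_unique[OF slice.coord_deriv_has_derivative[OF slice_vec_map[OF ray_Cr] xc'] this]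
  show ?thesis by simp
qed

lemma dir_orthogonal_dir:
  assumes x: "x \<in> slice_set"
  shows "dir x \<bullet> slice.coord_deriv dir x v = 0"
proof -
  have xc': "x \<in> carrier_of slice" using x by (simp only: carrier_slice)
  let ?c = "chart_around slice x"
  note c = slice.chart_around[OF xc']
  let ?d = "\<lambda>y. dir (chart_inv ?c y)" and ?y = "snd ?c x"
  note D = slice.coord_deriv_has_derivative[OF slice_vec_map[OF dir_Cr] xc']
  have D1: "((\<lambda>y. ?d y \<bullet> ?d y) has_derivative (\<lambda>v. ?d ?y \<bullet> slice.coord_deriv dir x v + slice.coord_deriv dir x v \<bullet> ?d ?y)) (at ?y)"
    by (rule has_derivative_inner[OF D D])
  have D2: "((\<lambda>y. ?d y \<bullet> ?d y) has_derivative (\<lambda>_. 0)) (at ?y)"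
  proof (rule has_derivative_transform_within_open[OF has_derivative_const slice.chart_open_range[OF c(1)]])
    show "?y \<in> snd ?c ` fst ?c" using c(2) by (rule imageI)
    show "1 = ?d y \<bullet> ?d y" if "y \<in> snd ?c ` fst ?c" for y
    proof -
      have "chart_inv ?c y \<in> carrier_of M"
        using slice.chart_inv_carrier[OF c(1) that] slice_subset by (auto simp: carrier_slice)
      then show ?thesis using norm_dir by (simp add: dot_square_norm)
    qed
  qed
  have "?d ?y \<bullet> slice.coord_deriv dir x v + slice.coord_deriv dir x v \<bullet> ?d ?y = 0"
    by (rule fun_cong[OF has_derivative_unique[OF D1 D2]])
  then show ?thesis by (simp add: slice.chart_inv_left[OF c] inner_commute)
qed

text \<open>A sphere chart is injective on the tangent space at x: the kernel of P is spanned by u,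
  and a multiple of u orthogonal to x is 0 because x lies in the open hemisphere around u.\<close>

lemma sphere_chart_kernel:
  fixes P :: "real ^ 'n \<Rightarrow> real ^ 'm"
  assumes u: "norm u = 1" "linear P" "P u = 0" "\<And>x. x \<bullet> u = 0 \<Longrightarrow> norm (P x) = norm x"
    and x: "0 < x \<bullet> u" "x \<bullet> q = 0" and q: "P q = 0"
  shows "q = 0"
proof -
  define q' where "q' = q - (q \<bullet> u) *\<^sub>R u"
  have "q' \<bullet> u = 0" using u(1) by (simp add: q'_def inner_diff_left dot_square_norm)
  moreover have "P q' = 0" using u(3) q by (simp add: q'_def linear_diff[OF u(2)] linear_scale[OF u(2)])
  ultimately have "q' = 0" using u(4)[of q'] by simp
  then have qu: "q = (q \<bullet> u) *\<^sub>R u" by (simp add: q'_def)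
  then have "x \<bullet> q = x \<bullet> ((q \<bullet> u) *\<^sub>R u)" by (rule arg_cong)
  then have "(q \<bullet> u) * (x \<bullet> u) = 0" by (simp only: inner_scaleR_right x(2))
  then have "q \<bullet> u = 0" using x(1) by simp
  then show ?thesis using qu by simp
qed

abbreviation front_target :: "((real ^ 'n) \<times> (real ^ 'n), (real ^ 'n) \<times> (real ^ 'm)) mfd" where
  "front_target \<equiv> prod_mfd euclidean_mfd sphere_mfd"

lemma front_sphere_chart:
  assumes "d \<in> atlas front_target"
  shows "\<exists>u P. d = (UNIV \<times> {x \<in> sphere 0 1. 0 < x \<bullet> u}, map_prod id P) \<and>
    norm u = 1 \<and> linear P \<and> P u = 0 \<and> (\<forall>x. x \<bullet> u = 0 \<longrightarrow> norm (P x) = norm x)"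
  using assms unfolding prod_mfd_def euclidean_mfd_def sphere_mfd_def by auto

lemma front_in_chart_Cr:
  fixes P :: "real ^ 'n \<Rightarrow> real ^ 'm"
  assumes c: "c \<in> atlas slice" and P: "linear P"
  shows "Cr_on r (snd c ` fst c) (\<lambda>y. (foot (chart_inv c y), P (dir (chart_inv c y))))"
proof -
  have "bounded_linear P" using P by (simp add: linear_conv_bounded_linear)
  then show ?thesis
    by (intro Cr_on_Pair slice.chart_open_range[OF c] slice.Cr_vec_mapD[OF slice_vec_map[OF foot_Cr] c]
        Cr_on_bounded_linear[OF slice.chart_open_range[OF c] _ slice.Cr_vec_mapD[OF slice_vec_map[OF dir_Cr] c]])
qed

text \<open>Sphere charts are restrictions of linear maps P, so in coordinates the map is (foot, P
  \<circ> dir); as \<open>dir\<close> has norm 1, the chart domain reduces to an open half-space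
  condition on it.\<close>

lemma slice_front_Cr_map:
  "Cr_map r slice front_target (\<lambda>x. (foot x, dir x))"
  unfolding Cr_map_def
proof (intro conjI ballI)
  have "continuous_map (mtop slice) euclidean foot" "continuous_map (mtop slice) euclidean dir"
    by (intro slice.Cr_vec_map_continuous_map slice_vec_map foot_Cr dir_Cr)+
  moreover have "dir \<in> topspace (mtop slice) \<rightarrow> sphere 0 1"
    using norm_dir slice_subset by (auto simp: carrier_slice)
  ultimately show "continuous_map (mtop slice) (mtop front_target) (\<lambda>x. (foot x, dir x))"
    by (simp add: prod_mfd_def euclidean_mfd_def sphere_mfd_def continuous_map_pairwise o_def
        continuous_map_in_subtopology)
  fix c d assume c: "c \<in> atlas slice" and d: "d \<in> atlas front_target"
  from front_sphere_chart[OF d]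
  obtain u P where "d = (UNIV \<times> {x \<in> sphere 0 1. 0 < x \<bullet> u}, map_prod id P) \<and>
    norm u = 1 \<and> linear P \<and> P u = 0 \<and> (\<forall>x. x \<bullet> u = 0 \<longrightarrow> norm (P x) = norm x)"
    by (elim exE)
  then have d_eq: "d = (UNIV \<times> {x \<in> sphere 0 1. 0 < x \<bullet> u}, map_prod id P)" and P: "linear P"
    by simp_all
  let ?V = "{q \<in> carrier_of slice. dir q \<in> {x. 0 < x \<bullet> u}}"
  have "open {x. 0 < x \<bullet> u}" by (intro open_Collect_less continuous_intros)
  then have V: "openin (mtop slice) ?V"
    by (rule slice.Cr_vec_map_openin_preimage[OF slice_vec_map[OF dir_Cr]])
  have set: "fst c \<inter> (\<lambda>x. (foot x, dir x)) -` fst d = fst c \<inter> ?V"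
    using slice.chart_subset[OF c] norm_dir slice_subset by (auto simp: d_eq carrier_slice)
  have map_eq: "snd d \<circ> (\<lambda>x. (foot x, dir x)) \<circ> chart_inv c = (\<lambda>y. (foot (chart_inv c y), P (dir (chart_inv c y))))"
    by (simp add: d_eq o_def)
  show "Cr_on r (snd c ` (fst c \<inter> (\<lambda>x. (foot x, dir x)) -` fst d)) (snd d \<circ> (\<lambda>x. (foot x, dir x)) \<circ> chart_inv c)"
    unfolding set map_eq by (rule Cr_on_subset[OF front_in_chart_Cr[OF c P] slice.chart_image_open[OF c V]]) blast
qed

text \<open>One chart of the target suffices. There the difference of two vectors with equal image
  is killed by foot and by P \<circ> dir; the derivative of \<open>dir\<close> is tangent to the
  sphere, so it vanishes as well, and the ray separates directions on the slice.\<close>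

lemma slice_front_inj:
  assumes x: "x \<in> slice_set"
  shows "inj_on (differential slice front_target (\<lambda>x. (foot x, dir x)) x) (tangent_space slice x)"
proof (rule inj_onI)
  let ?N = "front_target" and ?L = "\<lambda>x. (foot x, dir x)" and ?c = "chart_around slice x"
  fix v1 v2 assume v: "v1 \<in> tangent_space slice x" "v2 \<in> tangent_space slice x"
    and eq: "differential slice ?N ?L x v1 = differential slice ?N ?L x v2"
  have xc: "x \<in> carrier_of M" and xc': "x \<in> carrier_of slice"
    using x slice_subset by (auto simp: carrier_slice)
  note c = slice.chart_around[OF xc']
  obtain d0 where d0: "d0 \<in> atlas (sphere_mfd :: (real ^ 'n, real ^ 'm) mfd)" "dir x \<in> fst d0"
    using sphere_charts_cover[OF dims(2) norm_dir[OF xc]] by (auto simp: charts_at_def)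
  obtain d where d: "d \<in> atlas front_target" and Lx: "?L x \<in> fst d"
  proof (rule that)
    have "(UNIV, id) \<in> atlas (euclidean_mfd :: (real ^ 'n, real ^ 'n) mfd)"
      by (simp add: euclidean_mfd_def)
    from prod_mfd_chart[OF this d0(1)]
    show "(UNIV \<times> fst d0, map_prod id (snd d0)) \<in> atlas front_target" by (simp only: fst_conv snd_conv)
    show "?L x \<in> fst (UNIV \<times> fst d0, map_prod id (snd d0))"
      using d0(2) by simp
  qed
  from front_sphere_chart[OF d]
  obtain u P where "d = (UNIV \<times> {x \<in> sphere 0 1. 0 < x \<bullet> u}, map_prod id P) \<and>
    norm u = 1 \<and> linear P \<and> P u = 0 \<and> (\<forall>x. x \<bullet> u = 0 \<longrightarrow> norm (P x) = norm x)"
    by (elim exE)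
  note uP = this
  have dP: "d = (UNIV \<times> {x \<in> sphere 0 1. 0 < x \<bullet> u}, map_prod id P)" by (rule conjunct1[OF uP])
  have P: "norm u = 1" "linear P" "P u = 0" "\<And>x. x \<bullet> u = 0 \<Longrightarrow> norm (P x) = norm x"
    using conjunct2[OF uP] by simp_all
  have d_at: "d \<in> charts_at ?N (?L x)" using d Lx by (simp add: charts_at_def)
  have "fst d = UNIV \<times> {x \<in> sphere 0 1. 0 < x \<bullet> u}" by (simp only: dP fst_conv)
  then have pos: "0 < dir x \<bullet> u" using Lx by auto
  have snd_d: "snd d = map_prod id P" by (simp only: dP snd_conv)
  have map_eq: "snd d \<circ> ?L \<circ> chart_inv ?c = (\<lambda>y. (foot (chart_inv ?c y), P (dir (chart_inv ?c y))))"
    unfolding snd_d by (simp add: o_def)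
  have bP: "bounded_linear P" using P(2) by (simp add: linear_conv_bounded_linear)
  let ?D = "\<lambda>v. (slice.coord_deriv foot x v, P (slice.coord_deriv dir x v))"
  have "((\<lambda>y. (foot (chart_inv ?c y), P (dir (chart_inv ?c y)))) has_derivative ?D) (at (snd ?c x))"
    by (intro has_derivative_Pair bounded_linear.has_derivative[OF bP] slice.coord_deriv_has_derivative
        slice_vec_map foot_Cr dir_Cr xc')
  then have fd: "frechet_derivative (snd d \<circ> ?L \<circ> chart_inv ?c) (at (snd ?c x)) = ?D"
    unfolding map_eq by (rule frechet_derivativeI)
  have diff_d: "differential slice ?N ?L x v d = ?D (v ?c)" for v
    unfolding differential_def Let_def fd by (simp only: d_at if_True)
  have "?D (v1 ?c) = ?D (v2 ?c)" using fun_cong[OF eq, of d] by (simp only: diff_d)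
  then have D: "slice.coord_deriv foot x (v1 ?c) = slice.coord_deriv foot x (v2 ?c)"
    "P (slice.coord_deriv dir x (v1 ?c)) = P (slice.coord_deriv dir x (v2 ?c))" by simp_all
  let ?w = "v1 ?c - v2 ?c"
  have lin: "linear (slice.coord_deriv foot x)" "linear (slice.coord_deriv dir x)"
    using has_derivative_linear[OF slice.coord_deriv_has_derivative[OF slice_vec_map[OF foot_Cr] xc']]
      has_derivative_linear[OF slice.coord_deriv_has_derivative[OF slice_vec_map[OF dir_Cr] xc']] by simp_all
  have w1: "slice.coord_deriv foot x ?w = 0" using D(1) by (simp add: linear_diff[OF lin(1)])
  have Pw: "P (slice.coord_deriv dir x ?w) = 0"
    using D(2) by (simp add: linear_diff[OF lin(2)] linear_diff[OF P(2)])
  have "slice.coord_deriv dir x ?w = 0"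
    by (rule sphere_chart_kernel[OF P(1-3) _ pos dir_orthogonal_dir[OF x] Pw]) (rule P(4))
  then have "slice.coord_deriv ray x ?w = 0"
    using w1 by (simp add: slice_coord_deriv_ray[OF x] zero_prod_def)
  then have "?w = 0" by (rule slice_coord_deriv_inj[OF x])
  then show "v1 = v2"
    by (intro slice.tangent_space_eqI[OF v slice.chart_around_charts_at[OF xc']]) simp
qed

lemma slice_front: "euclidean_wave_front r slice foot dir"
  unfolding euclidean_wave_front_def Cr_immersion_def
proof (intro conjI ballI)
  show "Cr_vec_map r slice foot" by (rule slice_vec_map[OF foot_Cr])
  show "Cr_map r slice front_target (\<lambda>x. (foot x, dir x))" by (rule slice_front_Cr_map)
  fix x assume "x \<in> carrier_of slice"
  then have x: "x \<in> slice_set" by (simp only: carrier_slice)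
  then show "norm (dir x) = 1" using norm_dir slice_subset by blast
  show "dir x \<bullet> vec_differential slice foot x v = 0" if "v \<in> tangent_space slice x" for v
    unfolding slice.vec_differential_eq by (rule dir_orthogonal_foot[OF x])
  show "inj_on (differential slice front_target (\<lambda>x. (foot x, dir x)) x) (tangent_space slice x)"
    by (rule slice_front_inj[OF x])
qed

section \<open>The splitting of M into time and slice\<close>

definition split :: "'a \<Rightarrow> real \<times> 'a" where
  "split p = (time p, flow 0 p)"

lemma flow_slice: "p \<in> carrier_of M \<Longrightarrow> flow 0 p \<in> slice_set"
  using flow(2,5) by (simp add: slice_set_def)

lemma flow_0_slice:
  assumes "x \<in> slice_set"
  shows "flow 0 x = x"
  using flow(4)[of x] slice_time[OF assms] slice_subset assms by auto

lemma carrier_prod_slice: "carrier_of (prod_mfd (euclidean_mfd :: (real, real) mfd) slice) = UNIV \<times> slice_set"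
  using carrier_slice by (simp add: prod_mfd_def euclidean_mfd_def)

lemma split_flow:
  assumes "x \<in> slice_set"
  shows "split (flow t x) = (t, x)"
proof -
  have x: "x \<in> carrier_of M" using assms slice_subset by blast
  show ?thesis by (simp add: split_def flow(2)[OF x] flow_flow[OF x] flow_0_slice[OF assms])
qed

lemma flow_split:
  assumes "p \<in> carrier_of M"
  shows "flow (time p) (flow 0 p) = p"
  using flow_flow[OF assms] flow(4)[OF assms] by simp

lemma bij_split: "bij_betw split (carrier_of M) (UNIV \<times> slice_set)"
proof (rule bij_betwI[where g = "\<lambda>(t, x). flow t x"])
  show "split \<in> carrier_of M \<rightarrow> UNIV \<times> slice_set" using flow_slice by (auto simp: split_def)
  show "(\<lambda>(t, x). flow t x) \<in> UNIV \<times> slice_set \<rightarrow> carrier_of M" using flow(5) slice_subset by auto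
  show "(\<lambda>(t, x). flow t x) (split p) = p" if "p \<in> carrier_of M" for p
    using flow_split[OF that] by (simp add: split_def)
  show "split ((\<lambda>(t, x). flow t x) z) = z" if "z \<in> UNIV \<times> slice_set" for z
    using that split_flow by auto
qed

lemma inv_split:
  assumes "x \<in> slice_set"
  shows "inv_into (carrier_of M) split (t, x) = flow t x"
  using bij_betw_imp_inj_on[OF bij_split] split_flow[OF assms] flow(5) slice_subset assms
  by (intro inv_into_f_eq) auto

lemma prod_slice_atlas:
  assumes "d \<in> atlas (prod_mfd (euclidean_mfd :: (real, real) mfd) slice)"
  obtains z where "z \<in> slice_set" "d = (UNIV \<times> fst (slice_chart z), map_prod id (snd (slice_chart z)))"
proof -
  have "\<exists>c\<in>atlas slice. d = (UNIV \<times> fst c, map_prod id (snd c))"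
    using assms unfolding prod_mfd_def euclidean_mfd_def mfd.simps by force
  then show thesis using that unfolding atlas_slice by blast
qed

text \<open>The inverse of \<open>split\<close> in a chart of the slice.\<close>

lemma flow_param: "z \<in> slice_set \<Longrightarrow> Cr_param (UNIV \<times> range_at z) (\<lambda>w. flow (fst w) (slice_param z (snd w)))"
proof (rule Cr_param_flow)
  assume z: "z \<in> slice_set"
  have op: "open (UNIV \<times> range_at z :: (real \<times> (real ^ 'm)) set)"
    by (intro open_Times open_UNIV slice_box(2)[OF z])
  show "Cr_on r (UNIV \<times> range_at z) (fst :: real \<times> (real ^ 'm) \<Rightarrow> real)" by (rule Cr_on_linear[OF op bounded_linear_fst])
  show "Cr_param (UNIV \<times> range_at z) (\<lambda>w :: real \<times> (real ^ 'm). slice_param z (snd w))"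
    by (rule Cr_param_compose[OF slice_box(5)[OF z] op Cr_on_linear[OF op bounded_linear_snd]]) auto
qed

lemma split_Cr_map: "Cr_map r M (prod_mfd euclidean_mfd slice) split"
  unfolding Cr_map_def
proof (intro conjI ballI)
  have "continuous_map (mtop M) (mtop M) (flow 0)"
    unfolding continuous_map_def using flow(5) flow_openin by auto
  then have "continuous_map (mtop M) (subtopology (mtop M) slice_set) (flow 0)"
    unfolding continuous_map_in_subtopology using flow_slice by blast
  moreover have "continuous_map (mtop M) euclidean time" by (rule Cr_vec_map_continuous_map[OF time_Cr])
  ultimately show "continuous_map (mtop M) (mtop (prod_mfd euclidean_mfd slice)) split"
    by (simp add: prod_mfd_def euclidean_mfd_def slice_def continuous_map_pairwise o_def split_def)
  fix c d assume c: "c \<in> atlas M" and "d \<in> atlas (prod_mfd (euclidean_mfd :: (real, real) mfd) slice)"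
  then obtain z where z: "z \<in> slice_set" and d: "d = (UNIV \<times> fst (slice_chart z), map_prod id (snd (slice_chart z)))"
    using prod_slice_atlas by blast
  let ?V = "{q \<in> carrier_of M. flow 0 q \<in> nbhd_at z}" and ?X = "snd c ` fst c"
  note X = chart_open_range[OF c]
  have set: "fst c \<inter> split -` fst d = fst c \<inter> ?V"
    using flow_slice chart_subset[OF c] by (auto simp: d split_def slice_chart_simps)
  have Y: "open (snd c ` (fst c \<inter> ?V))"
    by (rule chart_image_open[OF c flow_openin[OF slice_box(3)[OF z]]])
  \<comment> \<open>The flow preserves the ray, and slice coordinates are functions of the ray; so
    the coordinates of \<open>split p\<close> can be read off at p, without differentiating the
    flow.\<close>
  have "Cr_on r ?X (\<lambda>y. (time (chart_inv c y), proj_at z (ray (chart_inv c y))))"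
    by (intro Cr_on_Pair X Cr_vec_mapD[OF time_Cr c] Cr_on_bounded_linear[OF X slice_box(1)[OF z] Cr_vec_mapD[OF ray_Cr c]])
  then have "Cr_on r ?X (snd d \<circ> split \<circ> chart_inv c)"
    by (rule Cr_on_cong[OF X, rotated])
      (use chart_inv_carrier[OF c] flow(3) in \<open>simp add: d split_def slice_chart_simps\<close>)
  then show "Cr_on r (snd c ` (fst c \<inter> split -` fst d)) (snd d \<circ> split \<circ> chart_inv c)"
    unfolding set by (rule Cr_on_subset[OF _ Y]) blast
qed

lemma inv_split_continuous:
  "continuous_map (prod_topology euclidean (mtop slice)) (mtop M) (inv_into (carrier_of M) split)"
  unfolding continuous_map_def
proof (intro conjI allI impI)
  have space: "topspace (prod_topology (euclidean :: real topology) (mtop slice)) = UNIV \<times> slice_set"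
    by (simp add: carrier_slice)
  show "inv_into (carrier_of M) split \<in> topspace (prod_topology euclidean (mtop slice)) \<rightarrow> carrier_of M"
    unfolding space using inv_split flow(5) slice_subset by auto
  fix V assume V: "openin (mtop M) V"
  have "\<exists>U N. openin euclidean U \<and> openin (mtop slice) N \<and> t \<in> U \<and> x \<in> N \<and>
      U \<times> N \<subseteq> {z \<in> UNIV \<times> slice_set. inv_into (carrier_of M) split z \<in> V}"
    if "(t, x) \<in> {z \<in> UNIV \<times> slice_set. inv_into (carrier_of M) split z \<in> V}" for t x
  proof -
    have x: "x \<in> slice_set" and tx: "flow t x \<in> V" using that inv_split by auto
    note z = slice_box[OF x]
    \<comment> \<open>Joint continuity in t and x is obtained in the chart centred at x and carried
      back to the slice.\<close>
    let ?O = "{w \<in> UNIV \<times> range_at x. flow (fst w) (slice_param x (snd w)) \<in> V}"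
    have "open ?O" by (rule Cr_param_open_preimage[OF flow_param[OF x] V])
    moreover have "(t, proj_at x (ray x)) \<in> ?O" using z(6,7)[OF z(4)] tx by simp
    ultimately obtain U B where UB: "open U" "open B" "(t, proj_at x (ray x)) \<in> U \<times> B" "U \<times> B \<subseteq> ?O"
      by (rule open_prod_elim)
    let ?N = "{q \<in> fst (slice_chart x). snd (slice_chart x) q \<in> B}"
    have "slice_chart x \<in> atlas slice" using x by (simp add: atlas_slice)
    then have N: "openin (mtop slice) ?N" by (rule slice.chart_preimage_openin[OF _ UB(2)])
    have "U \<times> ?N \<subseteq> {z \<in> UNIV \<times> slice_set. inv_into (carrier_of M) split z \<in> V}"
    proof
      fix w assume w: "w \<in> U \<times> ?N"
      then obtain s q where sq: "w = (s, q)" "s \<in> U" "q \<in> nbhd_at x \<inter> slice_set" "proj_at x (ray q) \<in> B"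
        unfolding slice_chart_simps by blast
      then have "(s, proj_at x (ray q)) \<in> ?O" using UB(4) by blast
      then have "flow s q \<in> V" using z(7)[OF sq(3)] by simp
      then show "w \<in> {z \<in> UNIV \<times> slice_set. inv_into (carrier_of M) split z \<in> V}"
        using sq(1,3) inv_split by simp
    qed
    then show ?thesis
      using UB N z(4) by (intro exI[of _ U] exI[of _ ?N]) (auto simp: slice_chart_simps)
  qed
  then show "openin (prod_topology euclidean (mtop slice))
      {z \<in> topspace (prod_topology (euclidean :: real topology) (mtop slice)). inv_into (carrier_of M) split z \<in> V}"
    unfolding space openin_prod_topology_alt by blast
qed

lemma inv_split_Cr_map: "Cr_map r (prod_mfd euclidean_mfd slice) M (inv_into (carrier_of M) split)"
  unfolding Cr_map_def
proof (intro conjI ballI)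
  show "continuous_map (mtop (prod_mfd euclidean_mfd slice)) (mtop M) (inv_into (carrier_of M) split)"
    using inv_split_continuous by (simp add: prod_mfd_def euclidean_mfd_def)
  fix c d assume "c \<in> atlas (prod_mfd (euclidean_mfd :: (real, real) mfd) slice)" and d: "d \<in> atlas M"
  then obtain z where z: "z \<in> slice_set" and c: "c = (UNIV \<times> fst (slice_chart z), map_prod id (snd (slice_chart z)))"
    using prod_slice_atlas by blast
  have za: "slice_chart z \<in> atlas slice" using z by (simp add: atlas_slice)
  have inv: "chart_inv c (t, y) = (t, slice_param z y)" if y: "y \<in> range_at z" for t y
    unfolding chart_inv_def c fst_conv snd_conv
  proof (rule inv_into_f_eq)
    show "inj_on (map_prod id (snd (slice_chart z))) (UNIV \<times> fst (slice_chart z))"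
      by (intro map_prod_inj_on inj_on_id slice.chart_inj[OF za])
    show "(t, slice_param z y) \<in> UNIV \<times> fst (slice_chart z)"
      using slice_box(8)[OF z y] by (simp add: slice_chart_simps)
    show "map_prod id (snd (slice_chart z)) (t, slice_param z y) = (t, y)"
      using slice_box(9)[OF z y] by (simp add: slice_chart_simps)
  qed
  let ?\<kappa> = "\<lambda>w. flow (fst w) (slice_param z (snd w))"
  let ?Y = "{w \<in> UNIV \<times> range_at z. ?\<kappa> w \<in> fst d}"
  note par = flow_param[OF z]
  have set: "snd c ` (fst c \<inter> inv_into (carrier_of M) split -` fst d) = ?Y"
  proof (intro subset_antisym image_subsetI subsetI)
    fix w assume w: "w \<in> fst c \<inter> inv_into (carrier_of M) split -` fst d"
    then obtain t q where tq: "w = (t, q)" "q \<in> nbhd_at z \<inter> slice_set" "inv_into (carrier_of M) split (t, q) \<in> fst d"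
      by (auto simp: c slice_chart_simps)
    then show "snd c w \<in> ?Y"
      using slice_box(6,7)[OF z tq(2)] inv_split by (simp add: c slice_chart_simps)
  next
    fix w assume w: "w \<in> ?Y"
    then have y: "snd w \<in> range_at z" "flow (fst w) (slice_param z (snd w)) \<in> fst d" by auto
    note b = slice_box(8,9)[OF z y(1)]
    show "w \<in> snd c ` (fst c \<inter> inv_into (carrier_of M) split -` fst d)"
    proof (rule image_eqI)
      show "w = snd c (fst w, slice_param z (snd w))" using b by (simp add: c slice_chart_simps)
      show "(fst w, slice_param z (snd w)) \<in> fst c \<inter> inv_into (carrier_of M) split -` fst d"
        using b y(2) inv_split[of "slice_param z (snd w)" "fst w"] by (simp add: c slice_chart_simps)
    qed
  qed
  have "Cr_on r ?Y (\<lambda>w. snd d (?\<kappa> w))" by (rule Cr_paramD(4)[OF par d])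
  then show "Cr_on r (snd c ` (fst c \<inter> inv_into (carrier_of M) split -` fst d))
      (snd d \<circ> inv_into (carrier_of M) split \<circ> chart_inv c)"
    unfolding set
  proof (rule Cr_on_cong[OF Cr_paramD(3)[OF par d], rotated])
    fix w assume "w \<in> ?Y"
    then have y: "snd w \<in> range_at z" by auto
    have "chart_inv c w = (fst w, slice_param z (snd w))" using inv[OF y, of "fst w"] by simp
    moreover have "slice_param z (snd w) \<in> slice_set" using slice_box(8)[OF z y] by simp
    ultimately show "snd d (?\<kappa> w) = (snd d \<circ> inv_into (carrier_of M) split \<circ> chart_inv c) w"
      by (simp add: inv_split)
  qed
qed

lemma split_diffeomorphism: "Cr_diffeomorphism r M (prod_mfd euclidean_mfd slice) split"
  unfolding Cr_diffeomorphism_def carrier_prod_slice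
  by (intro conjI bij_split split_Cr_map inv_split_Cr_map)

text \<open>By \<open>F_eq\<close> the value of \<open>F\<close> depends only on time and ray, and
  \<open>flow t x\<close> has time t and the ray of x.\<close>

lemma F_normal_form:
  assumes "x \<in> slice_set"
  shows "F (inv_into (carrier_of M) split (t, x)) = normal_form foot dir (t, x)"
proof -
  have x: "x \<in> carrier_of M" using assms slice_subset by blast
  have "base (flow t x) = base x" "dir (flow t x) = dir x"
    using flow(3)[OF x, of t] by (simp_all add: ray_def)
  moreover have "base x = foot x" by (simp add: base_def foot_def slice_time[OF assms])
  ultimately show ?thesis
    by (simp add: inv_split[OF assms] F_eq[of "flow t x"] flow(2)[OF x] normal_form_def)
qed

end

theorem theorem2p6:
  fixes r :: regularity
    and M :: "('a, real ^ 'n) mfd"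
    and F :: "'a \<Rightarrow> 'n spacetime"
    and \<alpha> :: "'a \<Rightarrow> 'n codual"
  assumes "CARD('n) \<ge> 2"
    and "CARD('m::finite) = CARD('n) - 1"
    and "Cr_manifold r M"
    and "null_wave_front r M F \<alpha>"
    and "L_complete r M F \<alpha>"
  shows "\<exists>(S :: ('a, real ^ 'm) mfd) (f :: 'a \<Rightarrow> real ^ 'n) (\<nu> :: 'a \<Rightarrow> real ^ 'n) (\<Phi> :: 'a \<Rightarrow> real \<times> 'a).
           Cr_manifold r S \<and>
           euclidean_wave_front r S f \<nu> \<and>
           Cr_diffeomorphism r M (prod_mfd euclidean_mfd S) \<Phi> \<and>
           (\<forall>t. \<forall>x\<in>carrier_of S. (F \<circ> inv_into (carrier_of M) \<Phi>) (t, x) = normal_form f \<nu> (t, x))"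
proof -
  obtain \<xi> where \<xi>: "E_normalized_null_field r M F \<alpha> \<xi>"
    "\<forall>p\<in>carrier_of M. \<exists>\<gamma>. integral_curve M \<xi> UNIV \<gamma> \<and> p \<in> range \<gamma> \<and> lightlike_line (range (F \<circ> \<gamma>))"
    using assms(5) unfolding L_complete_def by blast
  interpret complete_null_front_flow r M F \<alpha> \<xi> "TYPE('m)"
    by unfold_locales (use assms \<xi> in auto)
  show ?thesis
  proof (intro exI conjI allI ballI)
    show "Cr_manifold r slice" by (rule slice_manifold)
    show "euclidean_wave_front r slice foot dir" by (rule slice_front)
    show "Cr_diffeomorphism r M (prod_mfd euclidean_mfd slice) split" by (rule split_diffeomorphism)
    show "(F \<circ> inv_into (carrier_of M) split) (t, x) = normal_form foot dir (t, x)" if "x \<in> carrier_of slice" for t x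
      using that F_normal_form by (simp add: carrier_slice)
  qed
qed

end
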